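(* Let $b\in L^\infty(\mathbb{R}^{3N-3})$ and let $a\in L^2_{\mathrm{loc}}(\mathbb{R}^3)$ be such that $S^{(4)}_{3/4}(a)<\infty$. Then the operator $b\Psi a$, i.e. the integral operator from $L^2(\mathbb{R}^3)$ to $L^2(\mathbb{R}^{3N-3})$ with kernel $b(\hat{\mathbf{x}})\psi(\hat{\mathbf{x}},x)a(x)$, belongs to $\mathbf{S}_{3/4,\infty}$, and $$\|b\Psi a\|_{3/4,\infty}\le C\,\|b\|_{L^\infty}\,S^{(3)}_{3/4}(a),$$ $$\mathsf{G}_{3/4}(b\Psi a)\le C\,\big(M^{(4)}(b)\,S^{(4)}_{3/4}(a)\big)^{3/4},$$ with a constant $C>0$ independent of the weights $a$ and $b$.
   Context: Setting. Let $N\ge 2$, $Z>0$. Write $\mathbf{x}=(x_1,\dots,x_N)=(\hat{\mathbf{x}},x_N)\in\mathbb{R}^{3N}$, $x_j\in\mathbb{R}^3$, $\hat{\mathbf{x}}=(x_1,\dots,x_{N-1})$. Let $\psi\in H^2(\mathbb{R}^{3N})$ be an eigenfunction, $(H-E)\psi=0$, $E\in\mathbb{R}$, of $H=\sum_{k=1}^N(-\Delta_k-Z|x_k|^{-1})+\sum_{1\le j<k\le N}|x_j-x_k|^{-1}$ on $L^2(\mathbb{R}^{3N})$ with domain $H^2(\mathbb{R}^{3N})$ ($\psi$ is identified with its continuous representative). It is assumed that $|\psi(\mathbf{x})|\le C_0e^{-\varkappa_0|\mathbf{x}|_1}$ for all $\mathbf{x}$, with some $C_0,\varkappa_0>0$;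 $|\cdot|_1$ is the $\ell_1$-norm and $|\cdot|$ the Euclidean norm. Put $x_0=0\in\mathbb{R}^3$ and $d(\hat{\mathbf{x}},x)=\min\{|x-x_j|:0\le j\le N-1\}$. By a known result of Fournais and Sørensen there are constants $\varkappa_l>0$, $l\ge1$, such that for every multi-index $m\in\mathbb{N}_0^3$ with $l=|m|_1\ge1$ one has $|\partial_x^m\psi(\hat{\mathbf{x}},x)|\le C_m\,d(\hat{\mathbf{x}},x)^{1-l}e^{-\varkappa_l|\mathbf{x}|_1}$, where $\mathbf{x}=(\hat{\mathbf{x}},x)$ and $d(\hat{\mathbf{x}},x)>0$. Such constants are fixed, chosen (without loss of generality) so that $\varkappa_0=\varkappa_1\ge\varkappa_2\ge\dots>0$. Constants $C$ in the estimates may depend on $\psi$, $N$ and the $\varkappa_l$. $\Psi:L^2(\mathbb{R}^3)\to L^2(\mathbb{R}^{3N-3})$ is the operator $(\Psi u)(\hat{\mathbf{x}})=\int_{\mathbb{R}^3}\psi(\hat{\mathbf{x}},x)u(x)\,dx$. Weights. For $n\in\mathbb{Z}^3$ let $\mathcal{C}_n=(0,1)^3+n$. Define, for $l\ge1$, $$S_q^{(l)}(a)=\Big[\sum_{n\in\mathbb{Z}^3}e^{-q\varkappa_l|n|_1}\|a\|_{L^2(\mathcal{C}_n)}^q\Big]^{1/q},\quad q=\tfrac34,\qquad M^{(l)}(b)=\Big[\int_{\mathbb{R}^{3N-3}}|b(\hat{\mathbf{x}})|^2e^{-2\varkappa_l|\hat{\mathbf{x}}|_1}d\hat{\mathbf{x}}\Big]^{1/2}.$$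 Operator classes. For a compact operator $T$ between separable Hilbert spaces, $s_k(T)$, $k=1,2,\dots$, are its singular values in descending order counting multiplicity. For $p>0$, $T\in\mathbf{S}_{p,\infty}$ means $\|T\|_{p,\infty}:=\sup_kk^{1/p}s_k(T)<\infty$, and $\mathsf{G}_p(T):=\big(\limsup_{k\to\infty}k^{1/p}s_k(T)\big)^p$. *)

theory Defs
  imports "HOL-Analysis.Analysis" "HOL-Probability.Essential_Supremum"
begin

section \<open>The Hilbert space of complex square-integrable functions\<close>

definition square_integrable :: "('a::euclidean_space \<Rightarrow> complex) \<Rightarrow> bool" where
  "square_integrable f \<longleftrightarrow>
     f \<in> borel_measurable lebesgue \<and> integrable lebesgue (\<lambda>x. (norm (f x))\<^sup>2)"

lemma square_integrable_zero: "square_integrable (\<lambda>x. 0)"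
  by (simp add: square_integrable_def)

lemma square_integrable_add:
  assumes "square_integrable f" "square_integrable g"
  shows "square_integrable (\<lambda>x. f x + g x)"
proof -
  have [measurable]: "f \<in> borel_measurable lebesgue" "g \<in> borel_measurable lebesgue"
    using assms by (auto simp: square_integrable_def)
  have int: "integrable lebesgue (\<lambda>x. 2 * (norm (f x))\<^sup>2 + 2 * (norm (g x))\<^sup>2)"
    using assms by (auto simp: square_integrable_def)
  have bound: "(norm (f x + g x))\<^sup>2 \<le> 2 * (norm (f x))\<^sup>2 + 2 * (norm (g x))\<^sup>2" for x
  proof -
    have "(norm (f x + g x))\<^sup>2 \<le> (norm (f x) + norm (g x))\<^sup>2"
      by (intro power_mono norm_triangle_ineq) auto
    also have "\<dots> \<le> 2 * (norm (f x))\<^sup>2 + 2 * (norm (g x))\<^sup>2"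
      using zero_le_power2[of "norm (f x) - norm (g x)"]
      by (simp add: power2_eq_square algebra_simps)
    finally show ?thesis .
  qed
  have "integrable lebesgue (\<lambda>x. (norm (f x + g x))\<^sup>2)"
    by (rule Bochner_Integration.integrable_bound[OF int]) (use bound in auto)
  then show ?thesis by (simp add: square_integrable_def)
qed

lemma square_integrable_mult:
  assumes "square_integrable f"
  shows "square_integrable (\<lambda>x. c * f x)"
  using assms by (auto simp: square_integrable_def norm_mult power_mult_distrib)

lemma square_integrable_uminus:
  assumes "square_integrable f"
  shows "square_integrable (\<lambda>x. - f x)"
  using square_integrable_mult[OF assms, of "-1"] by simp

lemma square_integrable_diff:
  assumes "square_integrable f" "square_integrable g"
  shows "square_integrable (\<lambda>x. f x - g x)"
  using square_integrable_add[OF assms(1) square_integrable_uminus[OF assms(2)]] by simp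

lemma square_integrable_prod:
  assumes "square_integrable f" "square_integrable g"
  shows "integrable lebesgue (\<lambda>x. f x * cnj (g x))"
proof -
  have [measurable]: "f \<in> borel_measurable lebesgue" "g \<in> borel_measurable lebesgue"
    using assms by (auto simp: square_integrable_def)
  have int: "integrable lebesgue (\<lambda>x. (norm (f x))\<^sup>2 + (norm (g x))\<^sup>2)"
    using assms by (auto simp: square_integrable_def)
  have bound: "norm (f x * cnj (g x)) \<le> norm ((norm (f x))\<^sup>2 + (norm (g x))\<^sup>2)" for x
  proof -
    have "norm (f x) * norm (g x) \<le> (norm (f x))\<^sup>2 + (norm (g x))\<^sup>2"
      using sum_squares_bound[of "norm (f x)" "norm (g x)"]
        mult_nonneg_nonneg[OF norm_ge_zero norm_ge_zero, of "f x" "g x"] by linarith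
    then show ?thesis by (simp add: norm_mult)
  qed
  have meas: "(\<lambda>x. f x * cnj (g x)) \<in> borel_measurable lebesgue"
    by (intro borel_measurable_times measurable_compose[of g _ borel cnj]
        borel_measurable_continuous_onI continuous_intros) measurable
  show ?thesis
    by (rule Bochner_Integration.integrable_bound[OF int meas]) (use bound in blast)
qed

quotient_type (overloaded) 'a L2 =
  "'a::euclidean_space \<Rightarrow> complex" / partial:
  "\<lambda>f g. square_integrable f \<and> square_integrable g \<and> (AE x in lebesgue. f x = g x)"
  morphisms rep_L2 to_L2
proof (rule part_equivpI)
  show "\<exists>f :: 'a \<Rightarrow> complex. square_integrable f \<and> square_integrable f \<and> (AE x in lebesgue. f x = f x)"
    using square_integrable_zero by auto
qed (auto intro!: sympI transpI elim: eventually_elim2 simp: eq_commute)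

instantiation L2 :: (euclidean_space) real_vector
begin

lift_definition zero_L2 :: "'a L2" is "\<lambda>x. 0"
  by (simp add: square_integrable_zero)
lift_definition plus_L2 :: "'a L2 \<Rightarrow> 'a L2 \<Rightarrow> 'a L2" is "\<lambda>f g x. f x + g x"
  by (auto simp: square_integrable_add elim: eventually_elim2)
lift_definition uminus_L2 :: "'a L2 \<Rightarrow> 'a L2" is "\<lambda>f x. - f x"
  by (auto simp: square_integrable_uminus)
lift_definition minus_L2 :: "'a L2 \<Rightarrow> 'a L2 \<Rightarrow> 'a L2" is "\<lambda>f g x. f x - g x"
  by (auto simp: square_integrable_diff elim: eventually_elim2)
lift_definition scaleR_L2 :: "real \<Rightarrow> 'a L2 \<Rightarrow> 'a L2" is "\<lambda>r f x. of_real r * f x"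
  by (auto simp: square_integrable_mult)

instance
proof
  fix f g h :: "'a L2" and r s :: real
  note intros = square_integrable_add square_integrable_diff square_integrable_mult
    square_integrable_zero square_integrable_uminus
  show "f + g + h = f + (g + h)" by transfer (simp add: intros add.assoc)
  show "f + g = g + f" by transfer (simp add: intros add.commute)
  show "0 + f = f" by transfer simp
  show "- f + f = 0" by transfer (simp add: intros)
  show "f - g = f + - g" by transfer (simp add: intros)
  show "r *\<^sub>R (f + g) = r *\<^sub>R f + r *\<^sub>R g" by transfer (simp add: intros distrib_left)
  show "(r + s) *\<^sub>R f = r *\<^sub>R f + s *\<^sub>R f" by transfer (simp add: intros distrib_right)
  show "r *\<^sub>R s *\<^sub>R f = (r * s) *\<^sub>R f" by transfer (simp add: intros mult.assoc)
  show "1 *\<^sub>R f = f" by transfer simp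
qed

end

lift_definition scaleC :: "complex \<Rightarrow> 'a::euclidean_space L2 \<Rightarrow> 'a L2" is "\<lambda>c f x. c * f x"
  by (auto simp: square_integrable_mult)

interpretation complex_L2: vector_space "scaleC :: complex \<Rightarrow> 'a::euclidean_space L2 \<Rightarrow> 'a L2"
proof
  fix f g :: "'a L2" and c d :: complex
  note intros = square_integrable_add square_integrable_mult
  show "scaleC c (f + g) = scaleC c f + scaleC c g" by transfer (simp add: intros distrib_left)
  show "scaleC (c + d) f = scaleC c f + scaleC d f" by transfer (simp add: intros distrib_right)
  show "scaleC c (scaleC d f) = scaleC (c * d) f" by transfer (simp add: intros mult.assoc)
  show "scaleC 1 f = f" by transfer simp
qed

text \<open>The library's inner product is real: it is the real part of the usual sesquilinear one,
  and has the same norm. For complex-linear operators the resulting real adjoint is the same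
  operator as the adjoint with respect to the sesquilinear inner product.\<close>

instantiation L2 :: (euclidean_space) real_inner
begin

lift_definition inner_L2 :: "'a L2 \<Rightarrow> 'a L2 \<Rightarrow> real"
  is "\<lambda>f g. Re (LINT x|lebesgue. f x * cnj (g x))"
proof -
  fix f f' g g' :: "'a \<Rightarrow> complex"
  assume f: "square_integrable f \<and> square_integrable f' \<and> (AE x in lebesgue. f x = f' x)"
    and g: "square_integrable g \<and> square_integrable g' \<and> (AE x in lebesgue. g x = g' x)"
  have "(LINT x|lebesgue. f x * cnj (g x)) = (LINT x|lebesgue. f' x * cnj (g' x))"
  proof (rule integral_cong_AE)
    show "AE x in lebesgue. f x * cnj (g x) = f' x * cnj (g' x)"
      using f g by (auto elim: eventually_elim2)
  qed (use f g square_integrable_prod borel_measurable_integrable in blast)+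
  then show "Re (LINT x|lebesgue. f x * cnj (g x)) = Re (LINT x|lebesgue. f' x * cnj (g' x))"
    by simp
qed

definition norm_L2 :: "'a L2 \<Rightarrow> real" where "norm_L2 f = sqrt (inner f f)"
definition dist_L2 :: "'a L2 \<Rightarrow> 'a L2 \<Rightarrow> real" where "dist_L2 f g = norm (f - g)"
definition sgn_L2 :: "'a L2 \<Rightarrow> 'a L2" where "sgn_L2 f = f /\<^sub>R norm f"
definition uniformity_L2 :: "('a L2 \<times> 'a L2) filter" where
  "uniformity_L2 = (INF e\<in>{0<..}. principal {(f, g). dist f g < e})"
definition open_L2 :: "'a L2 set \<Rightarrow> bool" where
  "open_L2 U \<longleftrightarrow> (\<forall>f\<in>U. \<forall>\<^sub>F (f', g) in uniformity. f' = f \<longrightarrow> g \<in> U)"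

instance
proof
  fix f g h :: "'a L2" and r :: real and U :: "'a L2 set"
  show "inner f g = inner g f"
  proof transfer
    fix f g :: "'a \<Rightarrow> complex"
    have "(LINT x|lebesgue. g x * cnj (f x)) = cnj (LINT x|lebesgue. f x * cnj (g x))"
      unfolding Bochner_Integration.integral_cnj[symmetric] by (simp add: mult.commute)
    then show "Re (LINT x|lebesgue. f x * cnj (g x)) = Re (LINT x|lebesgue. g x * cnj (f x))"
      by simp
  qed
  show "inner (f + g) h = inner f h + inner g h"
    by transfer (simp add: distrib_right square_integrable_prod)
  show "inner (r *\<^sub>R f) g = r * inner f g"
    by transfer (simp add: mult.assoc)
  have *: "Re (LINT x|lebesgue. f x * cnj (f x)) = (LINT x|lebesgue. (norm (f x))\<^sup>2)"
    for f :: "'a \<Rightarrow> complex"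
    by (simp add: complex_norm_square[symmetric] flip: of_real_power)
  show "0 \<le> inner f f"
    by transfer (simp only: *, simp)
  show "inner f f = 0 \<longleftrightarrow> f = 0"
  proof transfer
    fix f :: "'a \<Rightarrow> complex"
    assume "square_integrable f \<and> square_integrable f \<and> (AE x in lebesgue. f x = f x)"
    then have f: "square_integrable f" by blast
    then have "integrable lebesgue (\<lambda>x. (norm (f x))\<^sup>2)" by (simp add: square_integrable_def)
    then show "Re (LINT x|lebesgue. f x * cnj (f x)) = 0 \<longleftrightarrow>
        square_integrable f \<and> square_integrable (\<lambda>x. 0::complex) \<and> (AE x in lebesgue. f x = 0)"
      unfolding * by (subst integral_nonneg_eq_0_iff_AE) (auto simp: f square_integrable_zero)
  qed
qed (simp_all add: norm_L2_def dist_L2_def sgn_L2_def uniformity_L2_def open_L2_def)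

end


section \<open>Compact operators and singular values\<close>

definition compact_operator :: "('a::euclidean_space L2 \<Rightarrow> 'b::euclidean_space L2) \<Rightarrow> bool" where
  "compact_operator T \<longleftrightarrow>
     (\<forall>f g. T (f + g) = T f + T g) \<and> (\<forall>c f. T (scaleC c f) = scaleC c (T f)) \<and>
     compact (closure (T ` cball 0 1))"

text \<open>For \<^term>\<open>\<sigma> > 0\<close>: the multiplicity of \<^term>\<open>\<sigma>\<close> as a singular value of \<^term>\<open>T\<close>, that is,
  the complex dimension of the eigenspace of \<^term>\<open>\<lambda>f. adjoint T (T f)\<close> for \<^term>\<open>\<sigma>\<^sup>2\<close>.
  (The library sets the dimension to zero if it is infinite; this does not occur for compact
  operators.)\<close>
definition sval_mult :: "('a::euclidean_space L2 \<Rightarrow> 'b::euclidean_space L2) \<Rightarrow> real \<Rightarrow> nat" where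
  "sval_mult T \<sigma> = complex_L2.dim {f. adjoint T (T f) = \<sigma>\<^sup>2 *\<^sub>R f}"

definition svals_above ::
    "('a::euclidean_space L2 \<Rightarrow> 'b::euclidean_space L2) \<Rightarrow> real \<Rightarrow> (real \<times> nat) set" where
  "svals_above T t = (SIGMA \<sigma>:{t<..}. {..<sval_mult T \<sigma>})"

text \<open>The \<^term>\<open>k\<close>-th largest singular value counted with multiplicity, for \<^term>\<open>k \<ge> 1\<close>:
  it is the least \<^term>\<open>t \<ge> 0\<close> such that fewer than \<^term>\<open>k\<close> singular values exceed \<^term>\<open>t\<close>,
  and is therefore zero if there are fewer than \<^term>\<open>k\<close> positive ones. The lemma below says that
  this is the enumeration in descending order.\<close>
definition sing_val :: "('a::euclidean_space L2 \<Rightarrow> 'b::euclidean_space L2) \<Rightarrow> nat \<Rightarrow> real" where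
  "sing_val T k = Inf {t. 0 \<le> t \<and> finite (svals_above T t) \<and> card (svals_above T t) < k}"

lemma sing_val_enumeration:
  fixes s :: "nat \<Rightarrow> real"
  assumes decr: "\<And>j k. 1 \<le> j \<Longrightarrow> j \<le> k \<Longrightarrow> s k \<le> s j"
    and nonneg: "\<And>k. 1 \<le> k \<Longrightarrow> 0 \<le> s k"
    and null: "s \<longlonglongrightarrow> 0"
    and mult: "\<And>\<sigma>. 0 < \<sigma> \<Longrightarrow> sval_mult T \<sigma> = card {k. 1 \<le> k \<and> s k = \<sigma>}"
    and "1 \<le> k"
  shows "sing_val T k = s k"
proof -
  have fin: "finite {k. 1 \<le> k \<and> t < s k}" if "0 < t" for t
  proof -
    obtain n where "\<And>m. m \<ge> n \<Longrightarrow> s m < t"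
      using order_tendstoD(2)[OF null \<open>0 < t\<close>] by (auto simp: eventually_sequentially)
    then have "{k. 1 \<le> k \<and> t < s k} \<subseteq> {..<n}"
      using less_asym not_less by (metis (no_types, lifting) lessThan_iff mem_Collect_eq subsetI)
    then show ?thesis by (rule finite_subset) simp
  qed
  have finfib: "finite {k. 1 \<le> k \<and> s k = \<sigma>}" if "0 < \<sigma>" for \<sigma>
    by (rule finite_subset[OF _ fin[of "\<sigma>/2"]]) (use that in auto)
  have bij: "\<exists>h. bij_betw h {k. 1 \<le> k \<and> t < s k} (svals_above T t)" if "0 \<le> t" for t
  proof -
    have "\<exists>g. bij_betw g {k. 1 \<le> k \<and> s k = \<sigma>} {..<sval_mult T \<sigma>}" if "\<sigma> > 0" for \<sigma>
      using finite_same_card_bij[OF finfib[OF that], of "{..<sval_mult T \<sigma>}"] mult[OF that] by auto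
    then obtain g where g: "\<And>\<sigma>. \<sigma> > 0 \<Longrightarrow> bij_betw (g \<sigma>) {k. 1 \<le> k \<and> s k = \<sigma>} {..<sval_mult T \<sigma>}"
      by metis
    have "bij_betw (\<lambda>k. (s k, g (s k) k)) {k. 1 \<le> k \<and> t < s k} (svals_above T t)"
      unfolding bij_betw_def
    proof
      show "inj_on (\<lambda>k. (s k, g (s k) k)) {k. 1 \<le> k \<and> t < s k}"
      proof (rule inj_onI)
        fix j k assume jk: "j \<in> {k. 1 \<le> k \<and> t < s k}" "k \<in> {k. 1 \<le> k \<and> t < s k}"
          "(s j, g (s j) j) = (s k, g (s k) k)"
        then have "inj_on (g (s k)) {i. 1 \<le> i \<and> s i = s k}"
          using g[of "s k"] \<open>0 \<le> t\<close> by (auto simp: bij_betw_def)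
        then show "j = k" by (rule inj_onD) (use jk in auto)
      qed
      show "(\<lambda>k. (s k, g (s k) k)) ` {k. 1 \<le> k \<and> t < s k} = svals_above T t"
      proof (intro equalityI subsetI)
        fix p assume "p \<in> (\<lambda>k. (s k, g (s k) k)) ` {k. 1 \<le> k \<and> t < s k}"
        then obtain k where k: "p = (s k, g (s k) k)" "1 \<le> k" "t < s k" by blast
        then have "g (s k) k \<in> {..<sval_mult T (s k)}"
          using bij_betw_apply[OF g[of "s k"], of k] \<open>0 \<le> t\<close> by simp
        then show "p \<in> svals_above T t" using k by (auto simp: svals_above_def)
      next
        fix p assume "p \<in> svals_above T t"
        then obtain \<sigma> i where p: "p = (\<sigma>, i)" "t < \<sigma>" "i \<in> {..<sval_mult T \<sigma>}"
          by (auto simp: svals_above_def)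
        then have "i \<in> g \<sigma> ` {k. 1 \<le> k \<and> s k = \<sigma>}"
          using g[of \<sigma>] \<open>0 \<le> t\<close> by (auto simp: bij_betw_def)
        then show "p \<in> (\<lambda>k. (s k, g (s k) k)) ` {k. 1 \<le> k \<and> t < s k}"
          using p by auto
      qed
    qed
    then show ?thesis by blast
  qed
  let ?A = "{t. 0 \<le> t \<and> finite (svals_above T t) \<and> card (svals_above T t) < k}"
  have "?A = {s k..}"
  proof (intro equalityI subsetI)
    fix t assume t: "t \<in> ?A"
    then obtain h where h: "bij_betw h {k. 1 \<le> k \<and> t < s k} (svals_above T t)" using bij by auto
    show "t \<in> {s k..}"
    proof (rule ccontr)
      assume "t \<notin> {s k..}"
      then have "t < s j" if "1 \<le> j" "j \<le> k" for j
        using decr[OF that] by simp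
      then have "{1..k} \<subseteq> {k. 1 \<le> k \<and> t < s k}" by auto
      moreover have "finite {k. 1 \<le> k \<and> t < s k}" "card {k. 1 \<le> k \<and> t < s k} < k"
        using t bij_betw_finite[OF h] bij_betw_same_card[OF h] by auto
      ultimately show False
        using card_mono[of "{k. 1 \<le> k \<and> t < s k}" "{1..k}"] by simp
    qed
  next
    fix t assume "t \<in> {s k..}"
    then have t: "s k \<le> t" "0 \<le> t" using nonneg[OF \<open>1 \<le> k\<close>] by auto
    then obtain h where h: "bij_betw h {k. 1 \<le> k \<and> t < s k} (svals_above T t)" using bij by auto
    have "j < k" if "t < s j" for j
    proof (rule ccontr)
      assume "\<not> j < k"
      then show False using decr[OF \<open>1 \<le> k\<close>, of j] t that by simp
    qed
    then have sub: "{k. 1 \<le> k \<and> t < s k} \<subseteq> {1..<k}" by auto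
    have "finite {k. 1 \<le> k \<and> t < s k}" "card {k. 1 \<le> k \<and> t < s k} \<le> card {1..<k}"
      using finite_subset[OF sub] card_mono[OF _ sub] by simp_all
    then show "t \<in> ?A"
      using t \<open>1 \<le> k\<close> bij_betw_finite[OF h] bij_betw_same_card[OF h] by auto
  qed
  then show ?thesis by (simp add: sing_val_def)
qed

definition weak_schatten_norm ::
    "real \<Rightarrow> ('a::euclidean_space L2 \<Rightarrow> 'b::euclidean_space L2) \<Rightarrow> ereal" where
  "weak_schatten_norm p T = (SUP k\<in>{1..}. ereal (real k powr (1 / p) * sing_val T k))"

definition weak_schatten ::
    "real \<Rightarrow> ('a::euclidean_space L2 \<Rightarrow> 'b::euclidean_space L2) set" where
  "weak_schatten p = {T. compact_operator T \<and> weak_schatten_norm p T < \<infinity>}"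

text \<open>Only meaningful on \<^term>\<open>weak_schatten p\<close>, where the upper limit is finite.\<close>
definition G_functional ::
    "real \<Rightarrow> ('a::euclidean_space L2 \<Rightarrow> 'b::euclidean_space L2) \<Rightarrow> real" where
  "G_functional p T =
     real_of_ereal (limsup (\<lambda>k. ereal (real k powr (1 / p) * sing_val T k))) powr p"

text \<open>\<^term>\<open>T\<close> is the integral operator with kernel \<^term>\<open>K\<close>: the integral converges absolutely at
  almost every point and represents \<^term>\<open>T u\<close>.\<close>
definition integral_operator ::
    "('b::euclidean_space \<Rightarrow> 'a::euclidean_space \<Rightarrow> complex) \<Rightarrow> ('a L2 \<Rightarrow> 'b L2) \<Rightarrow> bool" where
  "integral_operator K T \<longleftrightarrow>
     (\<forall>u. AE y in lebesgue.
        integrable lebesgue (\<lambda>x. K y x * rep_L2 u x) \<and>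
        rep_L2 (T u) y = (LINT x|lebesgue. K y x * rep_L2 u x))"


section \<open>Derivatives and the Sobolev space of order two\<close>

definition partial :: "'a::euclidean_space \<Rightarrow> ('a \<Rightarrow> complex) \<Rightarrow> 'a \<Rightarrow> complex" where
  "partial v f = (\<lambda>x. frechet_derivative f (at x) v)"

definition partials :: "'a::euclidean_space list \<Rightarrow> ('a \<Rightarrow> complex) \<Rightarrow> 'a \<Rightarrow> complex" where
  "partials vs f = foldr partial vs f"

text \<open>Meant for open \<^term>\<open>U\<close>: all iterated partial derivatives are Frechet differentiable, hence
  also continuous, on \<^term>\<open>U\<close>.\<close>
definition smooth_on :: "'a::euclidean_space set \<Rightarrow> ('a \<Rightarrow> complex) \<Rightarrow> bool" where
  "smooth_on U f \<longleftrightarrow>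
     (\<forall>vs. set vs \<subseteq> Basis \<longrightarrow> (\<forall>x\<in>U. partials vs f differentiable (at x)))"

definition test_function :: "('a::euclidean_space \<Rightarrow> complex) \<Rightarrow> bool" where
  "test_function \<phi> \<longleftrightarrow> smooth_on UNIV \<phi> \<and> compact (closure {x. \<phi> x \<noteq> 0})"

definition weak_partials ::
    "'a::euclidean_space list \<Rightarrow> ('a \<Rightarrow> complex) \<Rightarrow> ('a \<Rightarrow> complex) \<Rightarrow> bool" where
  "weak_partials vs f g \<longleftrightarrow>
     (\<forall>\<phi>. test_function \<phi> \<longrightarrow>
        (LINT x|lebesgue. f x * partials vs \<phi> x)
          = (-1) ^ length vs * (LINT x|lebesgue. g x * \<phi> x))"

definition sobolev_H2 :: "('a::euclidean_space \<Rightarrow> complex) set" where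
  "sobolev_H2 = {f. square_integrable f \<and>
     (\<forall>vs. set vs \<subseteq> Basis \<and> length vs \<le> 2 \<longrightarrow>
        (\<exists>g. square_integrable g \<and> weak_partials vs f g))}"

definition laplacian :: "('a::euclidean_space \<Rightarrow> complex) \<Rightarrow> 'a \<Rightarrow> complex" where
  "laplacian f = (\<lambda>x. \<Sum>v\<in>Basis. (SOME g. square_integrable g \<and> weak_partials [v, v] f g) x)"

definition multi_partial :: "nat^3 \<Rightarrow> (real^3 \<Rightarrow> complex) \<Rightarrow> real^3 \<Rightarrow> complex" where
  "multi_partial m f =
     (partial (axis 1 1) ^^ (m $ 1)) ((partial (axis 2 1) ^^ (m $ 2))
       ((partial (axis 3 1) ^^ (m $ 3)) f))"


section \<open>The atomic Hamiltonian\<close>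

text \<open>Configurations of \<^term>\<open>N\<close> electrons are pairs of the positions of the first \<^term>\<open>N - 1\<close>
  electrons, indexed by a finite type of cardinality \<^term>\<open>N - 1\<close>, and the position of the last
  one. As types are nonempty, the case \<^term>\<open>N \<ge> 2\<close> is exactly what is covered.\<close>

type_synonym 'n config = "((real^3)^'n) \<times> (real^3)"

text \<open>The last electron has index \<^term>\<open>None\<close>.\<close>
definition electron :: "'n::finite config \<Rightarrow> 'n option \<Rightarrow> real^3" where
  "electron z k = (case k of Some j \<Rightarrow> fst z $ j | None \<Rightarrow> snd z)"

text \<open>The factor \<^term>\<open>1 / 2\<close> compensates for summing over ordered pairs. Division by zero matters
  only on a null set.\<close>
definition coulomb_potential :: "real \<Rightarrow> 'n::finite config \<Rightarrow> real" where
  "coulomb_potential Z z =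
     - (\<Sum>k\<in>UNIV. Z / norm (electron z k))
     + 1 / 2 * (\<Sum>j\<in>UNIV. \<Sum>k\<in>UNIV - {j}. 1 / norm (electron z j - electron z k))"

definition hamiltonian :: "real \<Rightarrow> ('n::finite config \<Rightarrow> complex) \<Rightarrow> 'n config \<Rightarrow> complex" where
  "hamiltonian Z f = (\<lambda>z. - laplacian f z + of_real (coulomb_potential Z z) * f z)"

definition eigenfunction :: "real \<Rightarrow> real \<Rightarrow> ('n::finite config \<Rightarrow> complex) \<Rightarrow> bool" where
  "eigenfunction Z E \<psi> \<longleftrightarrow>
     \<psi> \<in> sobolev_H2 \<and> \<not> (AE z in lebesgue. \<psi> z = 0) \<and>
     (AE z in lebesgue. hamiltonian Z \<psi> z = of_real E * \<psi> z)"

definition l1_norm :: "'a::euclidean_space \<Rightarrow> real" where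
  "l1_norm x = (\<Sum>v\<in>Basis. \<bar>x \<bullet> v\<bar>)"

text \<open>The nucleus is at the origin.\<close>
definition coalescence_dist :: "(real^3)^'n::finite \<Rightarrow> real^3 \<Rightarrow> real" where
  "coalescence_dist y x = Min (insert (norm x) (range (\<lambda>j. norm (x - y $ j))))"


section \<open>Weights\<close>

definition unit_cube :: "int^3 \<Rightarrow> (real^3) set" where
  "unit_cube n = {x. \<forall>i. of_int (n $ i) < x $ i \<and> x $ i < of_int (n $ i) + 1}"

definition L2_loc :: "('a::euclidean_space \<Rightarrow> complex) set" where
  "L2_loc = {a. a \<in> borel_measurable lebesgue \<and>
     (\<forall>K. compact K \<longrightarrow> set_integrable lebesgue K (\<lambda>x. (norm (a x))\<^sup>2))}"

definition S_term :: "real \<Rightarrow> real \<Rightarrow> (real^3 \<Rightarrow> complex) \<Rightarrow> int^3 \<Rightarrow> real" where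
  "S_term q \<kappa> a n =
     exp (- q * \<kappa> * (\<Sum>i\<in>UNIV. \<bar>of_int (n $ i)\<bar>)) *
     sqrt (LINT x:unit_cube n|lebesgue. (norm (a x))\<^sup>2) powr q"

definition S_finite :: "real \<Rightarrow> real \<Rightarrow> (real^3 \<Rightarrow> complex) \<Rightarrow> bool" where
  "S_finite q \<kappa> a \<longleftrightarrow> S_term q \<kappa> a summable_on UNIV"

text \<open>Zero, not infinity, unless \<^term>\<open>S_finite q \<kappa> a\<close>\<close>
definition S_weight :: "real \<Rightarrow> real \<Rightarrow> (real^3 \<Rightarrow> complex) \<Rightarrow> real" where
  "S_weight q \<kappa> a = (\<Sum>\<^sub>\<infinity>n. S_term q \<kappa> a n) powr (1 / q)"

definition M_weight :: "real \<Rightarrow> ((real^3)^'n::finite \<Rightarrow> complex) \<Rightarrow> real" where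
  "M_weight \<kappa> b =
     sqrt (LINT y|lebesgue. (norm (b y))\<^sup>2 * exp (- 2 * \<kappa> * l1_norm y))"

definition Linf_norm :: "('a::euclidean_space \<Rightarrow> complex) \<Rightarrow> ereal" where
  "Linf_norm b = esssup lebesgue (\<lambda>y. ereal (norm (b y)))"

definition Linf :: "('a::euclidean_space \<Rightarrow> complex) set" where
  "Linf = {b. b \<in> borel_measurable lebesgue \<and> Linf_norm b < \<infinity>}"

end

theory Submission
  imports Defs "HOL-Real_Asymp.Real_Asymp"
begin

text \<open>If the kernel of \<open>T\<close> is within Hilbert--Schmidt distance \<open>\<epsilon>\<close> of a kernel of rank \<open>r\<close>, counting
  eigenvectors orthogonal to \<open>2 * r\<close> exceptional vectors gives \<open>sing_val T k = O(\<epsilon> / sqrt (k - 2 * r))\<close>.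
  The finite-rank kernel interpolates \<open>\<psi>(y, \<sqdot>)\<close> by piecewise quadratics on dyadic cubes. On a cube of
  side \<open>h\<close> at distance \<open>\<delta>\<close> from the coalescence points the error is of order \<open>h ^ 3 / \<delta> ^ 2\<close> (third
  derivatives) and of order \<open>h\<close> (Lipschitz bound); its square, summed over the cubes of side \<open>h\<close>, is
  \<open>O(h ^ 2)\<close> uniformly in \<open>y\<close>. Refining until \<open>h * \<integral>|a| ^ 2\<close> over each cube is at most \<open>k powr (-4/3)\<close>
  times the mass of the unit cell costs \<open>O(k)\<close> cubes and leaves a squared error \<open>O(k powr (-5/3))\<close>.
  Distributing the cubes over the unit cells in proportion to the terms of \<open>S_weight (3/4)\<close> gives
  \<open>sing_val T k \<le> C * k powr (-4/3) * M_weight \<kappa> b * S_weight (3/4) \<kappa> a\<close> with \<open>\<kappa> = \<kappa> 3\<close>, hence both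
  estimates, as the weights with \<open>\<kappa> 4\<close> dominate those with \<open>\<kappa> 3\<close>.\<close>

section \<open>Orthonormal families\<close>

text \<open>A kernel of finite rank needs functions of \<open>x\<close> that are independent of
  \<open>y\<close>, while the cusps of \<open>\<psi> (y, x)\<close> in \<open>x\<close> move with
  \<open>y\<close>. The cubes therefore cannot be refined towards the cusps and follow the mass of
  \<open>a\<close> alone. This is affordable because the squared error on a cube that is
  \<open>D\<close> sides away from a cusp decays like the inverse fourth power of \<open>D\<close>,
  which is summable over a three-dimensional lattice uniformly in the position of the cusp. Linear
  interpolation would leave the inverse square, which is not summable; quadratics are the lowest
  degree for which this works, and their third derivatives bring in the rate
  \<open>\<kappa> 3\<close>. The inner product is real. One complex functional amounts to two real
  ones, hence \<open>2 * r\<close> exceptional vectors for rank \<open>r\<close>, and orthonormality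
  is meant in the real sense throughout. Orthonormal sets are finite by definition, since a sum over
  an infinite set is 0.\<close>

definition orthonormal :: "'a::real_inner set \<Rightarrow> bool" where
  "orthonormal E \<longleftrightarrow> finite E \<and> pairwise orthogonal E \<and> (\<forall>e\<in>E. norm e = 1)"

lemma orthonormal_inner:
  assumes "orthonormal E" "d \<in> E" "e \<in> E"
  shows "inner d e = (if d = e then 1 else 0)"
  using assms by (auto simp: orthonormal_def pairwise_def orthogonal_def norm_eq_1)

lemma orthonormal_finite: "orthonormal E \<Longrightarrow> finite E"
  by (simp add: orthonormal_def)

lemma orthonormal_independent: "orthonormal E \<Longrightarrow> independent E"
  by (rule pairwise_orthogonal_independent) (auto simp: orthonormal_def)

lemma orthonormal_insert:
  assumes "orthonormal E" "norm e = 1" "\<And>d. d \<in> E \<Longrightarrow> inner e d = 0"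
  shows "orthonormal (insert e E)"
  using assms by (auto simp: orthonormal_def pairwise_insert orthogonal_def inner_commute)

lemma orthonormal_inner_sum:
  assumes E: "orthonormal E" and "e \<in> E"
  shows "inner (\<Sum>d\<in>E. c d *\<^sub>R d) e = c e"
proof -
  have "inner (\<Sum>d\<in>E. c d *\<^sub>R d) e = (\<Sum>d\<in>E. if d = e then c d else 0)"
    unfolding inner_sum_left
    by (intro sum.cong) (auto simp: orthonormal_inner[OF E _ \<open>e \<in> E\<close>])
  then show ?thesis using orthonormal_finite[OF E] \<open>e \<in> E\<close> by simp
qed

lemma orthonormal_span_expand:
  assumes E: "orthonormal E" and "v \<in> span E"
  shows "v = (\<Sum>e\<in>E. inner v e *\<^sub>R e)"
proof -
  obtain c where c: "v = (\<Sum>e\<in>E. c e *\<^sub>R e)"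
    using assms(2) by (auto simp: span_finite[OF orthonormal_finite[OF E]])
  show ?thesis
    unfolding c using orthonormal_inner_sum[OF E, of _ c] by (intro sum.cong) simp_all
qed

lemma orthonormal_residual:
  assumes E: "orthonormal E" and "v \<in> span E"
  shows "inner (a - (\<Sum>e\<in>E. inner a e *\<^sub>R e)) v = 0"
proof -
  have "orthogonal (a - (\<Sum>e\<in>E. inner a e *\<^sub>R e)) v"
    by (rule orthogonal_to_span[OF assms(2)])
       (simp add: orthogonal_def inner_diff_left orthonormal_inner_sum[OF E])
  then show ?thesis by (simp add: orthogonal_def)
qed

lemma orthonormal_norm_sum:
  assumes E: "orthonormal E"
  shows "(norm (\<Sum>e\<in>E. c e *\<^sub>R e))^2 = (\<Sum>e\<in>E. (c e)^2)"
proof -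
  have "(norm (\<Sum>e\<in>E. c e *\<^sub>R e))^2 = (\<Sum>e\<in>E. c e * inner (\<Sum>d\<in>E. c d *\<^sub>R d) e)"
    by (simp add: dot_square_norm[symmetric] inner_sum_right)
  also have "\<dots> = (\<Sum>e\<in>E. (c e)^2)"
    using orthonormal_inner_sum[OF E, of _ c] by (intro sum.cong) (simp_all add: power2_eq_square)
  finally show ?thesis .
qed

lemma Bessel_inequality:
  assumes E: "orthonormal E"
  shows "(\<Sum>e\<in>E. (inner a e)^2) \<le> (norm a)^2"
proof -
  let ?p = "\<Sum>e\<in>E. inner a e *\<^sub>R e"
  have p: "?p \<in> span E" by (intro span_sum span_scale span_base)
  have "(norm a)^2 = (norm (a - ?p + ?p))^2" by simp
  also have "\<dots> = (norm (a - ?p))^2 + (norm ?p)^2"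
    using orthonormal_residual[OF E p, of a] norm_add_Pythagorean[of "a - ?p" ?p]
    by (simp add: orthogonal_def)
  finally show ?thesis by (simp add: orthonormal_norm_sum[OF E])
qed

lemma orthonormal_basis_of_span:
  fixes B :: "'a::real_inner set"
  assumes "finite B"
  obtains C where "orthonormal C" "span C = span B"
proof -
  obtain C where C: "finite C" "span C = span B" "pairwise orthogonal C"
    using basis_orthogonal[OF assms] by blast
  define D where "D = (\<lambda>x. (1 / norm x) *\<^sub>R x) ` (C - {0})"
  have "span D = span B"
    unfolding D_def using C by (subst span_image_scale) (auto simp: span_delete_0)
  moreover have "orthonormal D"
    using C by (auto simp: D_def orthonormal_def pairwise_def orthogonal_def)
  ultimately show ?thesis using that by blast
qed

lemma independent_span_eq_card:
  assumes "finite B" "finite C" "independent B" "independent C" "span B = span C"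
  shows "card B = card C"
proof (rule antisym)
  show "card B \<le> card C" using independent_span_bound[of C B] assms span_superset[of B] by auto
  show "card C \<le> card B" using independent_span_bound[of B C] assms span_superset[of C] by auto
qed

text \<open>The orthogonal projection onto the span of \<open>S\<close> cannot be injective on
  \<open>span B\<close>, whose dimension is larger; any nonzero vector in its kernel is orthogonal
  to \<open>S\<close>.\<close>

lemma exists_orthogonal_in_span:
  fixes B :: "'a::real_inner set"
  assumes B: "finite B" "independent B" and S: "finite S" and less: "card S < card B"
  obtains v where "v \<in> span B" "norm v = 1" "\<And>s. s \<in> S \<Longrightarrow> inner v s = 0"
proof -
  obtain C where C: "orthonormal C" "span C = span S"
    using orthonormal_basis_of_span[OF S] .
  define P where "P v = (\<Sum>e\<in>C. inner v e *\<^sub>R e)" for v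
  have lin: "linear P"
    unfolding P_def
    by (intro linearI)
       (simp_all add: inner_add_left scaleR_add_left sum.distrib scaleR_sum_right)
  have "\<not> inj_on P (span B)"
  proof
    assume inj: "inj_on P (span B)"
    have "independent (P ` B)"
      using linear_independent_injective_image[OF lin B(2) inj] .
    moreover have "P ` B \<subseteq> span C"
      unfolding P_def by (intro image_subsetI span_sum span_scale span_base)
    ultimately have "card (P ` B) \<le> card S"
      using independent_span_bound[OF S] C(2) by auto
    moreover have "card (P ` B) = card B"
      using inj by (intro card_image) (meson inj_on_subset span_superset)
    ultimately show False using less by simp
  qed
  then obtain u where u: "u \<in> span B" "P u = 0" "u \<noteq> 0"
    using linear_inj_on_span_iff_independent_image linear_injective_on_subspace_0[OF lin subspace_span]
    by blast
  have orth: "inner u s = 0" if "s \<in> S" for s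
  proof -
    have "s \<in> span C" using C(2) that by (auto intro: span_base)
    then show ?thesis using orthonormal_residual[OF C(1), of s u] u(2) by (simp add: P_def)
  qed
  show ?thesis
    by (rule that[of "(1 / norm u) *\<^sub>R u"]) (use u orth in \<open>auto intro: span_scale\<close>)
qed

text \<open>Induction on \<open>n\<close>: the vectors already found join \<open>W\<close> as
  further constraints.\<close>

lemma exists_orthonormal_in_complement:
  fixes B :: "'a::real_inner set"
  assumes B: "finite B" "independent B" and W: "finite W" and "n + card W \<le> card B"
  shows "\<exists>C. orthonormal C \<and> card C = n \<and> C \<subseteq> span B \<and> (\<forall>c\<in>C. \<forall>w\<in>W. inner c w = 0)"
  using assms(4)
proof (induction n)
  case 0
  show ?case by (rule exI[of _ "{}"]) (simp add: orthonormal_def)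
next
  case (Suc n)
  then obtain C where C: "orthonormal C" "card C = n" "C \<subseteq> span B"
    "\<And>c w. c \<in> C \<Longrightarrow> w \<in> W \<Longrightarrow> inner c w = 0" by auto
  have fin: "finite (C \<union> W)" using W C(1) by (simp add: orthonormal_def)
  have "card (C \<union> W) < card B" using card_Un_le[of C W] C(2) Suc.prems by simp
  then obtain v where v: "v \<in> span B" "norm v = 1" "\<And>s. s \<in> C \<union> W \<Longrightarrow> inner v s = 0"
    using exists_orthogonal_in_span[OF B fin] by blast
  have "v \<notin> C" using v by (metis UnI1 inner_eq_zero_iff norm_eq_zero zero_neq_one)
  show ?case
    by (rule exI[of _ "insert v C"])
       (use C v \<open>v \<notin> C\<close> in \<open>auto intro!: orthonormal_insert simp: orthonormal_finite\<close>)
qed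

text \<open>The projection of a unit vector onto the span of an orthonormal set has coefficients in
  [-1, 1], so with \<open>f i = T i\<close> this compact set contains the images of all such
  projections.\<close>

lemma compact_bounded_combinations:
  fixes f :: "'i \<Rightarrow> 'a::real_normed_vector"
  assumes "finite I"
  shows "compact {\<Sum>i\<in>I. r i *\<^sub>R f i | r. \<forall>i\<in>I. \<bar>r i\<bar> \<le> (1::real)}"
  using assms
proof (induction I rule: finite_induct)
  case (insert j I)
  let ?A = "{\<Sum>i\<in>I. r i *\<^sub>R f i | r. \<forall>i\<in>I. \<bar>r i\<bar> \<le> (1::real)}"
  let ?B = "(\<lambda>t. t *\<^sub>R f j) ` {-1..1}"
  have "compact ?B"
    by (intro compact_continuous_image continuous_intros) auto
  then have "compact {x + y | x y. x \<in> ?B \<and> y \<in> ?A}"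
    using insert.IH by (rule compact_sums)
  also have "{x + y | x y. x \<in> ?B \<and> y \<in> ?A} =
      {\<Sum>i\<in>insert j I. r i *\<^sub>R f i | r. \<forall>i\<in>insert j I. \<bar>r i\<bar> \<le> (1::real)}" (is "?L = ?R")
  proof (intro equalityI subsetI)
    fix z assume "z \<in> ?L"
    then obtain t r where tr: "z = t *\<^sub>R f j + (\<Sum>i\<in>I. r i *\<^sub>R f i)" "\<bar>t\<bar> \<le> 1" "\<forall>i\<in>I. \<bar>r i\<bar> \<le> 1"
      by force
    have "z = (\<Sum>i\<in>insert j I. (r(j := t)) i *\<^sub>R f i)"
      using insert.hyps tr(1) by (auto intro!: sum.cong)
    moreover have "\<forall>i\<in>insert j I. \<bar>(r(j := t)) i\<bar> \<le> 1" using tr by auto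
    ultimately show "z \<in> ?R" by blast
  next
    fix z assume "z \<in> ?R"
    then obtain r where "z = (\<Sum>i\<in>insert j I. r i *\<^sub>R f i)" "\<forall>i\<in>insert j I. \<bar>r i\<bar> \<le> 1" by blast
    then show "z \<in> ?L" using insert.hyps by (force simp: abs_le_iff)
  qed
  finally show ?case .
qed simp

section \<open>Singular values\<close>

lemma scaleR_eq_scaleC: "r *\<^sub>R (f :: 'a::euclidean_space L2) = scaleC (of_real r) f"
  by transfer (simp add: square_integrable_mult)

lemma complex_independent_imp_real_independent:
  fixes B :: "'a::euclidean_space L2 set"
  assumes "finite B" "complex_L2.independent B"
  shows "independent B"
proof (rule real_vector.independent_if_scalars_zero[OF assms(1)])
  fix c :: "'a L2 \<Rightarrow> real" and v
  assume "(\<Sum>x\<in>B. c x *\<^sub>R x) = 0" and v: "v \<in> B"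
  then have "(\<Sum>x\<in>B. scaleC (complex_of_real (c x)) x) = 0" by (simp add: scaleR_eq_scaleC)
  from complex_L2.independentD[OF assms(2,1) order_refl this v] show "c v = 0" by simp
qed

text \<open>The multiplicity is a complex dimension. The real span of a complex basis lies in the
  eigenspace and has this number as its real dimension; that is half of the real dimension of the
  eigenspace, and enough here. A formal adjoint \<open>T'\<close> is automatically linear and agrees
  with \<open>adjoint T\<close> by uniqueness.\<close>

lemma eigenspace_orthonormal:
  fixes T :: "'a::euclidean_space L2 \<Rightarrow> 'b::euclidean_space L2"
  assumes T: "linear T" and adj: "\<And>f g. inner (T f) g = inner f (T' g)"
  shows "\<exists>C. orthonormal C \<and> card C = sval_mult T \<sigma> \<and> (\<forall>f\<in>C. T' (T f) = \<sigma>^2 *\<^sub>R f)"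
proof (cases "sval_mult T \<sigma> = 0")
  case True
  then show ?thesis by (intro exI[of _ "{}"]) (simp add: orthonormal_def)
next
  case False
  have T': "linear T'"
  proof (rule linearI)
    show "T' (x + y) = T' x + T' y" for x y
    proof -
      have "inner f (T' (x + y) - (T' x + T' y)) = 0" for f
        using adj[of f "x + y"] adj[of f x] adj[of f y]
        by (simp add: inner_diff_right inner_add_right)
      from this[of "T' (x + y) - (T' x + T' y)"] show ?thesis by simp
    qed
    show "T' (r *\<^sub>R x) = r *\<^sub>R T' x" for r x
    proof -
      have "inner f (T' (r *\<^sub>R x) - r *\<^sub>R T' x) = 0" for f
        using adj[of f "r *\<^sub>R x"] adj[of f x] by (simp add: inner_diff_right)
      from this[of "T' (r *\<^sub>R x) - r *\<^sub>R T' x"] show ?thesis by simp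
    qed
  qed
  let ?V = "{f. adjoint T (T f) = \<sigma>^2 *\<^sub>R f}"
  have adjoint: "adjoint T = T'" by (rule adjoint_unique) (simp add: adj)
  have V: "subspace ?V"
    unfolding adjoint
    by (rule subspaceI)
       (simp_all add: linear_0[OF T] linear_0[OF T'] linear_add[OF T] linear_add[OF T']
         linear_scale[OF T] linear_scale[OF T'] scaleR_add_right)
  obtain B where B: "B \<subseteq> ?V" "complex_L2.independent B" "?V \<subseteq> complex_L2.span B"
      "card B = complex_L2.dim ?V"
    by (rule complex_L2.basis_exists)
  then have card: "card B = sval_mult T \<sigma>" by (simp add: sval_mult_def)
  \<comment> \<open>An infinite basis would have \<open>card B = 0\<close>, contrary to the present
    case.\<close>
  then have fin: "finite B" using False by (metis card.infinite)
  obtain C where C: "orthonormal C" "span C = span B"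
    using orthonormal_basis_of_span[OF fin] .
  have "card C = card B"
    using independent_span_eq_card[OF fin _ complex_independent_imp_real_independent[OF fin B(2)]]
      C orthonormal_independent[OF C(1)] by (metis orthonormal_finite)
  moreover have "C \<subseteq> ?V"
    using span_minimal[OF B(1) V] C(2) span_superset[of C] by auto
  ultimately show ?thesis using C(1) card adjoint by auto
qed

lemma eigenvectors_orthogonal:
  fixes T :: "'a::real_inner \<Rightarrow> 'b::real_inner"
  assumes adj: "\<And>f g. inner (T f) g = inner f (T' g)"
    and "T' (T f) = \<sigma>^2 *\<^sub>R f" "T' (T g) = \<tau>^2 *\<^sub>R g" "\<sigma> > 0" "\<tau> > 0" "\<sigma> \<noteq> \<tau>"
  shows "inner f g = 0"
proof -
  have "\<sigma>^2 * inner f g = inner (T' (T f)) g" using assms(2) by simp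
  also have "\<dots> = inner f (T' (T g))" using adj[of g "T f"] adj[of f "T g"] by (simp add: inner_commute)
  also have "\<dots> = \<tau>^2 * inner f g" using assms(3) by simp
  finally have "\<sigma>^2 * inner f g = \<tau>^2 * inner f g" .
  moreover have "\<sigma>^2 \<noteq> \<tau>^2" using assms(4-6) by (simp add: power2_eq_iff_nonneg)
  ultimately show ?thesis by simp
qed

text \<open>Only \<open>k\<close> labels are picked, so finitely many values \<sigma> are involved
  even if infinitely many exceed \<open>t\<close>. Eigenspaces of distinct values are orthogonal,
  hence their bases unite to one orthonormal set.\<close>

lemma eigenvectors_above:
  fixes T :: "'a::euclidean_space L2 \<Rightarrow> 'b::euclidean_space L2"
  assumes T: "linear T" and adj: "\<And>f g. inner (T f) g = inner f (T' g)"
    and t: "t \<ge> 0" and many: "\<not> (finite (svals_above T t) \<and> card (svals_above T t) < k)"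
  obtains C s where "orthonormal C" "k \<le> card C" "\<And>f. f \<in> C \<Longrightarrow> t < s f"
    "\<And>f. f \<in> C \<Longrightarrow> T' (T f) = (s f)^2 *\<^sub>R f"
proof -
  obtain S where S: "S \<subseteq> svals_above T t" "finite S" "card S = k"
    using many by (metis infinite_arbitrarily_large not_le obtain_subset_with_card_n)
  have "\<forall>\<sigma>. \<exists>C. orthonormal C \<and> card C = sval_mult T \<sigma> \<and> (\<forall>f\<in>C. T' (T f) = \<sigma>^2 *\<^sub>R f)"
    using eigenspace_orthonormal[OF T adj] by blast
  then obtain D where D: "\<And>\<sigma>. orthonormal (D \<sigma>)" "\<And>\<sigma>. card (D \<sigma>) = sval_mult T \<sigma>"
    "\<And>\<sigma> f. f \<in> D \<sigma> \<Longrightarrow> T' (T f) = \<sigma>^2 *\<^sub>R f" by metis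
  define R where "R = fst ` S"
  have R: "finite R" "\<And>\<sigma>. \<sigma> \<in> R \<Longrightarrow> t < \<sigma>" using S by (auto simp: R_def svals_above_def)
  have orth: "inner f g = 0" if "f \<in> D \<sigma>" "g \<in> D \<tau>" "\<sigma> \<in> R" "\<tau> \<in> R" "\<sigma> \<noteq> \<tau>" for f g \<sigma> \<tau>
    by (rule eigenvectors_orthogonal[OF adj D(3) D(3)]) (use that R(2) t in \<open>auto intro: le_less_trans\<close>)
  have nz: "inner f f = 1" if "f \<in> D \<sigma>" for f \<sigma>
    using orthonormal_inner[OF D(1) that that] by simp
  define C where "C = (\<Union>\<sigma>\<in>R. D \<sigma>)"
  have ortho: "orthonormal C"
    unfolding orthonormal_def
  proof (intro conjI ballI)
    show "finite C" using R(1) D(1) by (auto simp: C_def orthonormal_def)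
    show "pairwise orthogonal C"
      unfolding pairwise_def orthogonal_def C_def
      using orth orthonormal_inner[OF D(1)] by (metis UN_E)
    show "norm f = 1" if "f \<in> C" for f using that D(1) by (auto simp: C_def orthonormal_def)
  qed
  have disj: "D \<sigma> \<inter> D \<tau> = {}" if "\<sigma> \<in> R" "\<tau> \<in> R" "\<sigma> \<noteq> \<tau>" for \<sigma> \<tau>
    using orth[OF _ _ that] nz by force
  have sub: "S \<subseteq> (SIGMA \<sigma>:R. {..<sval_mult T \<sigma>})"
  proof
    fix p assume "p \<in> S"
    then have "p \<in> svals_above T t" "fst p \<in> R" using S(1) by (auto simp: R_def)
    then show "p \<in> (SIGMA \<sigma>:R. {..<sval_mult T \<sigma>})" by (cases p) (simp add: svals_above_def)
  qed
  have "k \<le> card (SIGMA \<sigma>:R. {..<sval_mult T \<sigma>})"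
    unfolding S(3)[symmetric] by (rule card_mono[OF _ sub]) (use R(1) in simp)
  also have "\<dots> = (\<Sum>\<sigma>\<in>R. card (D \<sigma>))" using R(1) by (simp add: D(2))
  also have "\<dots> = card C"
    unfolding C_def using R(1) D(1) disj by (subst card_UN_disjoint) (auto simp: orthonormal_def)
  finally have card: "k \<le> card C" .
  have "\<forall>f. \<exists>\<sigma>. f \<in> C \<longrightarrow> \<sigma> \<in> R \<and> f \<in> D \<sigma>" by (auto simp: C_def)
  then obtain s where s: "\<And>f. f \<in> C \<Longrightarrow> s f \<in> R \<and> f \<in> D (s f)" by metis
  show ?thesis
    by (rule that[OF ortho card, of s]) (use s R(2) D(3) in auto)
qed

text \<open>In the eigenvector basis \<open>(norm (T g))^2\<close> is a mean of the
  \<open>(s f)^2\<close> with weights \<open>(inner g f)^2\<close> that add up to 1.\<close>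

lemma norm_above_on_span_eigenvectors:
  fixes T :: "'a::real_inner \<Rightarrow> 'b::real_inner"
  assumes T: "linear T" and adj: "\<And>f g. inner (T f) g = inner f (T' g)"
    and C: "orthonormal C" and t: "t \<ge> 0" and s: "\<And>f. f \<in> C \<Longrightarrow> t < s f"
    and eig: "\<And>f. f \<in> C \<Longrightarrow> T' (T f) = (s f)^2 *\<^sub>R f"
    and g: "g \<in> span C" "norm g = 1"
  shows "t^2 < (norm (T g))^2"
proof -
  let ?c = "\<lambda>f. inner g f"
  have exp: "g = (\<Sum>f\<in>C. ?c f *\<^sub>R f)" by (rule orthonormal_span_expand[OF C g(1)])
  have one: "(\<Sum>f\<in>C. (?c f)^2) = 1"
    using orthonormal_norm_sum[OF C, of ?c] exp g(2) by simp
  have "(norm (T g))^2 = inner (T (\<Sum>f\<in>C. ?c f *\<^sub>R f)) (T g)"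
    using exp by (simp add: dot_square_norm)
  also have "\<dots> = (\<Sum>f\<in>C. ?c f * inner (T f) (T g))"
    by (simp add: linear_sum[OF T] linear_scale[OF T] inner_sum_left)
  also have "\<dots> = (\<Sum>f\<in>C. (s f)^2 * (?c f)^2)"
  proof (rule sum.cong[OF refl])
    fix f assume "f \<in> C"
    then show "?c f * inner (T f) (T g) = (s f)^2 * (?c f)^2"
      using adj[of g "T f"] eig[of f] by (simp add: inner_commute power2_eq_square)
  qed
  finally have eq: "(norm (T g))^2 = (\<Sum>f\<in>C. (s f)^2 * (?c f)^2)" .
  obtain f where f: "f \<in> C" "?c f \<noteq> 0"
    using one by (metis (no_types, lifting) sum.neutral zero_neq_one zero_power2)
  have lt: "t^2 < (s f)^2" if "f \<in> C" for f
    using s[OF that] t by (intro power_strict_mono) auto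
  have "(\<Sum>f\<in>C. t^2 * (?c f)^2) < (\<Sum>f\<in>C. (s f)^2 * (?c f)^2)"
  proof (rule sum_strict_mono_ex1[OF orthonormal_finite[OF C]])
    show "\<forall>x\<in>C. t^2 * (g \<bullet> x)^2 \<le> (s x)^2 * (g \<bullet> x)^2"
      using lt by (intro ballI mult_right_mono) (auto intro: less_imp_le)
    show "\<exists>a\<in>C. t^2 * (g \<bullet> a)^2 < (s a)^2 * (g \<bullet> a)^2"
      using f lt by (intro bexI[of _ f]) auto
  qed
  then show ?thesis using eq one by (simp add: sum_distrib_left[symmetric])
qed

section \<open>Smallness off finitely many vectors\<close>

text \<open>For linear \<open>T\<close> the supremum of these sums is the squared Hilbert-Schmidt
  norm on the orthogonal complement of \<open>W\<close>, expressed without bases. The same quantity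
  controls the singular values beyond \<open>card W\<close> and the total boundedness of the image
  of the unit ball.\<close>

definition small_on_complement ::
    "('a::real_inner \<Rightarrow> 'b::real_inner) \<Rightarrow> 'a set \<Rightarrow> real \<Rightarrow> bool" where
  "small_on_complement T W h \<longleftrightarrow> finite W \<and>
     (\<forall>E. orthonormal E \<longrightarrow> (\<forall>e\<in>E. \<forall>w\<in>W. inner e w = 0) \<longrightarrow> (\<Sum>e\<in>E. (norm (T e))^2) \<le> h)"

lemma small_on_complement_nonneg: "small_on_complement T W h \<Longrightarrow> h \<ge> 0"
  unfolding small_on_complement_def
  by (elim conjE allE[of _ "{}"]) (simp add: orthonormal_def)

text \<open>If \<open>k\<close> singular values exceed \<^term>\<open>t\<close>, the span of their eigenvectors contains \<^term>\<open>k - card W\<close>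
  orthonormal vectors orthogonal to \<^term>\<open>W\<close>, and each contributes more than \<^term>\<open>t^2\<close>.\<close>
lemma sing_val_le:
  fixes T :: "'a::euclidean_space L2 \<Rightarrow> 'b::euclidean_space L2"
  assumes T: "linear T" and adj: "\<And>f g. inner (T f) g = inner f (T' g)"
    and small: "small_on_complement T W h" and k: "card W < k"
  shows "0 \<le> sing_val T k" "sing_val T k \<le> sqrt (h / (k - card W))"
proof -
  let ?A = "{t. 0 \<le> t \<and> finite (svals_above T t) \<and> card (svals_above T t) < k}"
  define t where "t = sqrt (h / (k - card W))"
  have h: "h \<ge> 0" by (rule small_on_complement_nonneg[OF small])
  have pos: "real k - real (card W) > 0" using k by simp
  have t: "t \<ge> 0" using h by (simp add: t_def)
  have t2: "t^2 = h / (real k - real (card W))" using h k by (simp add: t_def of_nat_diff)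
  have "finite (svals_above T t) \<and> card (svals_above T t) < k"
  proof (rule ccontr)
    assume many: "\<not> ?thesis"
    obtain C s where C: "orthonormal C" "k \<le> card C" "\<And>f. f \<in> C \<Longrightarrow> t < s f"
      "\<And>f. f \<in> C \<Longrightarrow> T' (T f) = (s f)^2 *\<^sub>R f"
      using eigenvectors_above[OF T adj t many] by blast
    have "\<exists>E. orthonormal E \<and> card E = k - card W \<and> E \<subseteq> span C \<and> (\<forall>c\<in>E. \<forall>w\<in>W. inner c w = 0)"
      by (rule exists_orthonormal_in_complement)
         (use C(1,2) k small in \<open>auto simp: orthonormal_finite orthonormal_independent small_on_complement_def\<close>)
    then obtain E where E: "orthonormal E" "card E = k - card W" "E \<subseteq> span C"
      "\<forall>c\<in>E. \<forall>w\<in>W. inner c w = 0" by blast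
    have "(\<Sum>e\<in>E. t^2) < (\<Sum>e\<in>E. (norm (T e))^2)"
    proof (rule sum_strict_mono)
      show "finite E" by (rule orthonormal_finite[OF E(1)])
      show "E \<noteq> {}" using E(2) k by auto
      show "t^2 < (norm (T e))^2" if "e \<in> E" for e
        using norm_above_on_span_eigenvectors[OF T adj C(1) t C(3,4)] E(1,3) that
        by (auto simp: orthonormal_def)
    qed
    also have "\<dots> \<le> h" using small E by (auto simp: small_on_complement_def)
    finally have "real (k - card W) * t^2 < h" using E(2) by simp
    then show False using pos k by (simp add: t2 of_nat_diff)
  qed
  then have "t \<in> ?A" using t by simp
  moreover have "bdd_below ?A" by (rule bdd_belowI[of _ 0]) simp
  ultimately show "sing_val T k \<le> sqrt (h / (k - card W))"
    unfolding sing_val_def t_def[symmetric] by (rule cInf_lower)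
  show "0 \<le> sing_val T k"
    unfolding sing_val_def using \<open>t \<in> ?A\<close> by (intro cInf_greatest) auto
qed

section \<open>Completeness of the space L2\<close>

lemma square_integrable_rep_L2: "square_integrable (rep_L2 f)"
  using Quotient3_rep_reflp[OF Quotient3_L2, of f] by simp

lemma rep_L2_measurable [measurable]: "rep_L2 f \<in> borel_measurable lebesgue"
  using square_integrable_rep_L2[of f] by (simp add: square_integrable_def)

lemma to_L2_rep_L2: "to_L2 (rep_L2 f) = f"
  by (rule Quotient3_abs_rep[OF Quotient3_L2])

lemma rep_to_L2: "square_integrable f \<Longrightarrow> AE x in lebesgue. rep_L2 (to_L2 f) x = f x"
  using Quotient3_rep_abs[OF Quotient3_L2, of f] by simp

lemma norm_to_L2:
  assumes "square_integrable f"
  shows "(norm (to_L2 f))^2 = (LINT x|lebesgue. (norm (f x))^2)"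
proof -
  have "(norm (to_L2 f))^2 = Re (LINT x|lebesgue. f x * cnj (f x))"
    by (simp add: dot_square_norm[symmetric] inner_L2.abs_eq assms)
  also have "\<dots> = (LINT x|lebesgue. (norm (f x))^2)"
    by (simp add: complex_norm_square[symmetric] flip: of_real_power)
  finally show ?thesis .
qed

lemma norm_L2_rep: "(norm f)^2 = (LINT x|lebesgue. (norm (rep_L2 f x))^2)"
  using norm_to_L2[OF square_integrable_rep_L2, of f] by (simp add: to_L2_rep_L2)

abbreviation sq_mass :: "('a::euclidean_space \<Rightarrow> 'b::real_normed_vector) \<Rightarrow> ennreal" where
  "sq_mass f \<equiv> (\<integral>\<^sup>+x. ennreal ((norm (f x))^2) \<partial>lebesgue)"

lemma nn_integral_norm_L2_rep: "sq_mass (rep_L2 f) = ennreal ((norm f)^2)"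
  unfolding norm_L2_rep
  by (rule nn_integral_eq_integral) (use square_integrable_rep_L2 in \<open>auto simp: square_integrable_def\<close>)

lemma rep_L2_diff: "AE x in lebesgue. rep_L2 (f - g) x = rep_L2 f x - rep_L2 g x"
proof -
  have "f - g = to_L2 (\<lambda>x. rep_L2 f x - rep_L2 g x)"
    using minus_L2.abs_eq[of "rep_L2 f" "rep_L2 g"]
    by (simp add: to_L2_rep_L2 square_integrable_rep_L2)
  then show ?thesis
    using rep_to_L2[OF square_integrable_diff[OF square_integrable_rep_L2[of f] square_integrable_rep_L2[of g]]]
    by simp
qed

lemma square_integrable_iff_nn_integral:
  assumes "f \<in> borel_measurable lebesgue"
  shows "square_integrable f \<longleftrightarrow> sq_mass f < \<infinity>"
  using assms unfolding square_integrable_def integrable_iff_bounded by simp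

lemma nn_integral_rep_diff:
  "sq_mass (\<lambda>x. rep_L2 f x - rep_L2 g x) = ennreal ((norm (f - g))^2)"
proof -
  have "sq_mass (\<lambda>x. rep_L2 f x - rep_L2 g x)
      = sq_mass (\<lambda>x. rep_L2 (f - g) x)"
    by (rule nn_integral_cong_AE) (use rep_L2_diff[of f g] in \<open>auto elim: eventually_mono\<close>)
  then show ?thesis by (simp add: nn_integral_norm_L2_rep)
qed

lemma convergent_if_geometric_increments:
  fixes u :: "nat \<Rightarrow> complex"
  assumes "\<And>n. norm (u (Suc n) - u n) \<le> c * (1/2) ^ n"
  shows "convergent u"
proof -
  have "summable (\<lambda>n. u (Suc n) - u n)"
    by (rule summable_comparison_test'[of "\<lambda>n. c * (1/2) ^ n" 0])
       (use assms in \<open>auto intro!: summable_mult summable_geometric\<close>)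
  then have "convergent (\<lambda>n. \<Sum>i<n. u (Suc i) - u i)"
    by (simp add: summable_iff_convergent)
  then have "convergent (\<lambda>n. u n - u 0)" by (simp add: sum_lessThan_telescope)
  then have "convergent (\<lambda>n. u n - u 0 + u 0)" by (intro convergent_add convergent_const)
  then show ?thesis by simp
qed

text \<open>Riesz-Fischer for a geometrically converging sequence; a general Cauchy sequence is
  reduced to it by passing to a subsequence.\<close>

lemma L2_fast_Cauchy_converges:
  fixes X :: "nat \<Rightarrow> 'a::euclidean_space L2"
  assumes fast: "\<And>n m. n \<le> m \<Longrightarrow> norm (X m - X n) \<le> (1/4) ^ n"
  shows "\<exists>l. X \<longlonglongrightarrow> l"
proof -
  define u where "u n = rep_L2 (X n)" for n
  have [measurable]: "u n \<in> borel_measurable lebesgue" for n by (simp add: u_def)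
  have incr: "sq_mass (\<lambda>x. u m x - u n x) \<le> ennreal ((1/16) ^ n)"
    if "n \<le> m" for n m
  proof -
    have "(norm (X m - X n))^2 \<le> ((1/4) ^ n)^2" using fast[OF that] by (intro power_mono) auto
    also have "\<dots> = (1/16) ^ n" by (simp add: power_mult[symmetric] power_mult power2_eq_square power_mult_distrib[symmetric])
    finally show ?thesis unfolding u_def nn_integral_rep_diff by (rule ennreal_leI)
  qed
  \<comment> \<open>The weight \<open>4 ^ n\<close> is beaten by the decay \<open>(1/16) ^ n\<close>
    of the squared increments, so \<open>G\<close> is integrable, yet it is large enough that
    finiteness of \<open>G x\<close> forces increments of order \<open>(1/2) ^ n\<close>.\<close>
  define G where "G x = (\<Sum>n. ennreal (4 ^ n * (norm (u (Suc n) x - u n x))^2))" for x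
  have "(\<integral>\<^sup>+x. G x \<partial>lebesgue) = (\<Sum>n. \<integral>\<^sup>+x. ennreal (4 ^ n * (norm (u (Suc n) x - u n x))^2) \<partial>lebesgue)"
    unfolding G_def by (rule nn_integral_suminf) measurable
  also have "\<dots> \<le> (\<Sum>n. ennreal ((1/4) ^ n))"
  proof (rule suminf_le)
    fix n
    have "(\<integral>\<^sup>+x. ennreal (4 ^ n * (norm (u (Suc n) x - u n x))^2) \<partial>lebesgue)
        = ennreal (4 ^ n) * sq_mass (\<lambda>x. u (Suc n) x - u n x)"
      by (subst nn_integral_cmult[symmetric]) (auto simp: ennreal_mult)
    also have "\<dots> \<le> ennreal (4 ^ n) * ennreal ((1/16) ^ n)"
      by (intro mult_left_mono incr) auto
    also have "\<dots> = ennreal ((1/4) ^ n)"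
      by (subst ennreal_mult[symmetric]) (auto simp: power_mult_distrib[symmetric])
    finally show "(\<integral>\<^sup>+x. ennreal (4 ^ n * (norm (u (Suc n) x - u n x))^2) \<partial>lebesgue) \<le> ennreal ((1/4) ^ n)" .
  qed auto
  also have "\<dots> = ennreal (\<Sum>n. (1/4) ^ n)"
    by (rule suminf_ennreal2) (auto intro: summable_geometric)
  finally have fin: "(\<integral>\<^sup>+x. G x \<partial>lebesgue) \<noteq> \<infinity>" by (auto simp: top_unique)
  have "AE x in lebesgue. G x \<noteq> \<infinity>"
    by (rule nn_integral_PInf_AE[OF _ fin]) (unfold G_def, measurable)
  then have conv: "AE x in lebesgue. convergent (\<lambda>n. u n x)"
  proof (rule eventually_mono)
    fix x assume "G x \<noteq> \<infinity>"
    then obtain g where g: "G x = ennreal g" "g \<ge> 0" by (cases "G x") auto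
    have "norm (u (Suc n) x - u n x) \<le> sqrt g * (1/2) ^ n" for n
    proof -
      have "ennreal (4 ^ n * (norm (u (Suc n) x - u n x))^2) \<le> G x"
        unfolding G_def using ennreal_suminf_lessD not_le by blast
      then have "4 ^ n * (norm (u (Suc n) x - u n x))^2 \<le> g" using g by simp
      moreover have "(2 ^ n * norm (u (Suc n) x - u n x))^2 = 4 ^ n * (norm (u (Suc n) x - u n x))^2"
        by (simp add: power_mult_distrib power_mult[symmetric] mult.commute[of n 2]) (simp add: power_mult)
      ultimately have "2 ^ n * norm (u (Suc n) x - u n x) \<le> sqrt g"
        by (intro real_le_rsqrt) simp
      then show ?thesis by (simp add: field_simps power_divide)
    qed
    then show "convergent (\<lambda>n. u n x)" by (rule convergent_if_geometric_increments)
  qed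
  define U where "U x = lim (\<lambda>n. u n x)" for x
  have [measurable]: "U \<in> borel_measurable lebesgue"
    unfolding U_def[abs_def] by (rule borel_measurable_lim_metric) measurable
  \<comment> \<open>Fatou's lemma in \<open>m\<close> for fixed \<open>n\<close> turns bounds on
    increments into bounds on the distance to the limit.\<close>
  have tail: "sq_mass (\<lambda>x. U x - u n x) \<le> ennreal ((1/16) ^ n)" for n
  proof -
    have "sq_mass (\<lambda>x. U x - u n x)
        = (\<integral>\<^sup>+x. liminf (\<lambda>m. ennreal ((norm (u m x - u n x))^2)) \<partial>lebesgue)"
    proof (rule nn_integral_cong_AE, use conv in \<open>rule eventually_mono\<close>)
      fix x assume "convergent (\<lambda>n. u n x)"
      then have "(\<lambda>m. u m x) \<longlonglongrightarrow> U x" by (simp add: U_def convergent_LIMSEQ_iff)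
      then have "(\<lambda>m. ennreal ((norm (u m x - u n x))^2)) \<longlonglongrightarrow> ennreal ((norm (U x - u n x))^2)"
        by (intro tendsto_intros)
      then show "ennreal ((norm (U x - u n x))^2) = liminf (\<lambda>m. ennreal ((norm (u m x - u n x))^2))"
        by (metis lim_imp_Liminf sequentially_bot)
    qed
    also have "\<dots> \<le> liminf (\<lambda>m. \<integral>\<^sup>+x. ennreal ((norm (u m x - u n x))^2) \<partial>lebesgue)"
      by (rule nn_integral_liminf) measurable
    also have "\<dots> \<le> liminf (\<lambda>m::nat. ennreal ((1/16) ^ n))"
      by (rule Liminf_mono) (use incr in \<open>auto intro: eventually_sequentiallyI[of n]\<close>)
    also have "\<dots> = ennreal ((1/16) ^ n)" by (simp add: Liminf_const)
    finally show ?thesis .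
  qed
  have "square_integrable (\<lambda>x. U x - u 0 x)"
    by (subst square_integrable_iff_nn_integral) (use tail[of 0] in \<open>auto intro: le_less_trans\<close>)
  from square_integrable_add[OF this square_integrable_rep_L2[of "X 0"]]
  have U: "square_integrable U" by (simp add: u_def)
  have close: "norm (X n - to_L2 U) \<le> (1/4) ^ n" for n
  proof -
    have "ennreal ((norm (to_L2 U - X n))^2) = sq_mass (\<lambda>x. rep_L2 (to_L2 U) x - u n x)"
      unfolding u_def by (rule nn_integral_rep_diff[symmetric])
    also have "\<dots> = sq_mass (\<lambda>x. U x - u n x)"
      by (rule nn_integral_cong_AE) (use rep_to_L2[OF U] in \<open>auto elim: eventually_mono\<close>)
    also have "\<dots> \<le> ennreal ((1/16) ^ n)" by (rule tail)
    finally have "(norm (to_L2 U - X n))^2 \<le> (1/16) ^ n" by simp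
    also have "(1/16) ^ n = ((1/4) ^ n :: real)^2"
      by (simp add: power_mult[symmetric] power_mult power2_eq_square power_mult_distrib[symmetric])
    finally have "norm (to_L2 U - X n) \<le> (1/4) ^ n" by (rule power2_le_imp_le) simp
    then show ?thesis by (simp add: norm_minus_commute)
  qed
  have "(\<lambda>n. (1/4::real) ^ n) \<longlonglongrightarrow> 0" by (rule LIMSEQ_power_zero) simp
  with close have "(\<lambda>n. X n - to_L2 U) \<longlonglongrightarrow> 0"
    using Lim_null_comparison[OF always_eventually, of "\<lambda>n. X n - to_L2 U" "\<lambda>n. (1/4) ^ n"] by blast
  then have "X \<longlonglongrightarrow> to_L2 U" by (simp add: LIM_zero_iff)
  then show ?thesis by blast
qed

lemma complete_L2: "complete (UNIV :: 'a::euclidean_space L2 set)"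
proof (rule completeI)
  fix X :: "nat \<Rightarrow> 'a L2" assume X: "Cauchy X"
  have "\<forall>n. \<exists>N. \<forall>m\<ge>N. \<forall>k\<ge>N. norm (X m - X k) < (1/4) ^ n"
    using X unfolding Cauchy_def dist_norm by simp
  then obtain N where N: "\<And>n m k. m \<ge> N n \<Longrightarrow> k \<ge> N n \<Longrightarrow> norm (X m - X k) < (1/4) ^ n" by metis
  \<comment> \<open>The partial sum makes \<open>r\<close> dominate all earlier values of
    \<open>N\<close>, the summand \<open>n\<close> makes it strictly increasing.\<close>
  define r where "r n = (\<Sum>i\<le>n. N i) + n" for n
  have mono: "strict_mono r" by (rule strict_mono_Suc_iff[THEN iffD2]) (simp add: r_def)
  have rN: "r m \<ge> N n" if "n \<le> m" for n m
    using member_le_sum[of n "{..m}" N] that by (simp add: r_def trans_le_add1)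
  have "\<exists>l. (X \<circ> r) \<longlonglongrightarrow> l"
    by (rule L2_fast_Cauchy_converges) (use N rN in \<open>auto intro: less_imp_le\<close>)
  then show "\<exists>l\<in>UNIV. X \<longlonglongrightarrow> l"
    using Cauchy_converges_subseq[OF X mono] by blast
qed

text \<open>The projection of the unit ball onto \<open>span W\<close> has its image in a compact
  set because it is finite-dimensional. The complementary part has an image of norm at most
  \<open>sqrt h\<close>, since a single unit vector is already an orthonormal family.\<close>

lemma compact_closure_image_ball:
  fixes T :: "'a::euclidean_space L2 \<Rightarrow> 'b::euclidean_space L2"
  assumes T: "linear T" and small: "\<And>\<epsilon>. \<epsilon> > 0 \<Longrightarrow> \<exists>W h. small_on_complement T W h \<and> h \<le> \<epsilon>"
  shows "compact (closure (T ` cball 0 1))"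
  unfolding compact_eq_totally_bounded
proof (intro conjI allI impI)
  show "complete (closure (T ` cball 0 1))"
    using closed_closure complete_L2 by (metis complete_Int_closed Int_UNIV_left)
  fix \<epsilon> :: real assume \<epsilon>: "\<epsilon> > 0"
  obtain W h where W: "small_on_complement T W h" "h \<le> (\<epsilon>/4)^2"
    using small[of "(\<epsilon>/4)^2"] \<epsilon> by auto
  obtain C where C: "orthonormal C" "span C = span W"
    using orthonormal_basis_of_span[of W] W(1) unfolding small_on_complement_def by metis
  let ?K = "{\<Sum>c\<in>C. r c *\<^sub>R T c | r. \<forall>c\<in>C. \<bar>r c\<bar> \<le> (1::real)}"
  have K: "compact ?K" by (rule compact_bounded_combinations[OF orthonormal_finite[OF C(1)]])
  have "\<exists>k. finite k \<and> ?K \<subseteq> (\<Union>x\<in>k. ball x (\<epsilon>/4))"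
    by (rule conjunct2[OF iffD1[OF compact_eq_totally_bounded K], rule_format]) (use \<epsilon> in simp)
  then obtain k where k: "finite k" "?K \<subseteq> (\<Union>x\<in>k. ball x (\<epsilon>/4))" by (elim exE conjE)
  have "T u \<in> (\<Union>x\<in>k. cball x (\<epsilon>/2))" if "u \<in> cball 0 1" for u
  proof -
    define p where "p = (\<Sum>c\<in>C. inner u c *\<^sub>R c)"
    have p: "p \<in> span C" unfolding p_def by (intro span_sum span_scale span_base)
    have orth: "inner (u - p) v = 0" if "v \<in> span C" for v
      using orthonormal_residual[OF C(1) that, of u] by (simp add: p_def)
    have abs: "\<bar>inner u c\<bar> \<le> 1" if "c \<in> C" for c
    proof -
      have "\<bar>inner u c\<bar> \<le> norm u * norm c" by (rule Cauchy_Schwarz_ineq2)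
      then show ?thesis using C(1) that \<open>u \<in> cball 0 1\<close> by (simp add: orthonormal_def)
    qed
    have "T p = (\<Sum>c\<in>C. inner u c *\<^sub>R T c)"
      unfolding p_def by (simp add: linear_sum[OF T] linear_scale[OF T])
    then have "T p \<in> ?K" using abs by blast
    then obtain x where x: "x \<in> k" "dist x (T p) < \<epsilon>/4" using k(2) by auto
    have nq: "norm (u - p) \<le> 1"
    proof -
      have "(norm u)^2 = (norm (u - p))^2 + (norm p)^2"
        using norm_add_Pythagorean[of "u - p" p] orth[OF p] by (simp add: orthogonal_def)
      then have "(norm (u - p))^2 \<le> (norm u)^2" using zero_le_power2[of "norm p"] by linarith
      then have "norm (u - p) \<le> norm u" by (rule power2_le_imp_le) simp
      then show ?thesis using that by simp
    qed
    have "norm (T (u - p)) \<le> \<epsilon>/4"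
    proof (cases "u - p = 0")
      case True then show ?thesis using \<epsilon> linear_0[OF T] by simp
    next
      case False
      define e where "e = (1 / norm (u - p)) *\<^sub>R (u - p)"
      have "orthonormal {e}" using False by (simp add: orthonormal_def e_def)
      moreover have "\<forall>d\<in>{e}. \<forall>w\<in>W. inner d w = 0"
        using orth C(2) by (simp add: e_def span_base)
      ultimately have "(\<Sum>d\<in>{e}. (norm (T d))^2) \<le> h"
        using W(1) unfolding small_on_complement_def by blast
      then have "(norm (T e))^2 \<le> (\<epsilon>/4)^2" using W(2) by simp
      then have e: "norm (T e) \<le> \<epsilon>/4" by (rule power2_le_imp_le) (use \<epsilon> in simp)
      have "norm (u - p) *\<^sub>R e = u - p" using False by (simp add: e_def)
      from linear_scale[OF T, of "norm (u - p)" e, unfolded this]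
      have "norm (T (u - p)) = norm (u - p) * norm (T e)" by simp
      also have "\<dots> \<le> 1 * (\<epsilon>/4)" using nq e by (intro mult_mono) auto
      finally show ?thesis by simp
    qed
    moreover have "T u = T p + T (u - p)" using linear_add[OF T, of p "u - p"] by simp
    ultimately have "dist (T u) (T p) \<le> \<epsilon>/4" by (simp add: dist_norm)
    then have "dist x (T u) \<le> \<epsilon>/2" using x(2) dist_triangle[of x "T u" "T p"] by (simp add: dist_commute)
    then show ?thesis using x(1) by auto
  qed
  then have "T ` cball 0 1 \<subseteq> (\<Union>x\<in>k. cball x (\<epsilon>/2))" by auto
  \<comment> \<open>Closed balls of half the radius absorb the closure.\<close>
  moreover have "closed (\<Union>x\<in>k. cball x (\<epsilon>/2))" using k(1) by (intro closed_UN) auto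
  ultimately have "closure (T ` cball 0 1) \<subseteq> (\<Union>x\<in>k. cball x (\<epsilon>/2))" by (rule closure_minimal)
  also have "\<dots> \<subseteq> (\<Union>x\<in>k. ball x \<epsilon>)" using \<epsilon> by (intro UN_mono) auto
  finally show "\<exists>k. finite k \<and> closure (T ` cball 0 1) \<subseteq> (\<Union>x\<in>k. ball x \<epsilon>)" using k(1) by blast
qed

section \<open>Hilbert--Schmidt integral operators\<close>

lemma sigma_finite_lebesgue: "sigma_finite_measure (lebesgue :: 'a::euclidean_space measure)"
proof
  show "\<exists>A. countable A \<and> A \<subseteq> sets lebesgue \<and> \<Union> A = space lebesgue \<and>
      (\<forall>a\<in>A. emeasure (lebesgue :: 'a measure) a \<noteq> \<infinity>)"
  proof (intro exI conjI)
    show "countable (range (\<lambda>n::nat. cball (0::'a) n))" by simp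
    show "range (\<lambda>n::nat. cball (0::'a) n) \<subseteq> sets lebesgue" by auto
    show "\<Union> (range (\<lambda>n::nat. cball (0::'a) n)) = space lebesgue"
      using real_arch_simple by fastforce
    show "\<forall>a\<in>range (\<lambda>n::nat. cball (0::'a) n). emeasure lebesgue a \<noteq> \<infinity>"
      using emeasure_lborel_cball_finite by (auto simp: emeasure_completion less_top[symmetric])
  qed
qed

text \<open>The product of the completions, not the Lebesgue measure of the product type: every
  section of a function measurable for it is measurable, not just almost every one, and Fubini's
  theorem applies directly.\<close>

abbreviation lebesgue2 :: "('a::euclidean_space \<times> 'b::euclidean_space) measure" where
  "lebesgue2 \<equiv> lebesgue \<Otimes>\<^sub>M lebesgue"

interpretation lebesgue: sigma_finite_measure lebesgue by (rule sigma_finite_lebesgue)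
interpretation lebesgue_pair: pair_sigma_finite lebesgue lebesgue ..

lemma cnj_measurable [measurable]: "cnj \<in> borel_measurable borel"
  by (intro borel_measurable_continuous_onI continuous_intros)

lemma square_integrable_cnj: "square_integrable f \<Longrightarrow> square_integrable (\<lambda>x. cnj (f x))"
  unfolding square_integrable_def by (auto intro: measurable_compose[OF _ cnj_measurable])

section \<open>Complex functionals seen through the real inner product\<close>

definition pairing :: "('a::euclidean_space \<Rightarrow> complex) \<Rightarrow> 'a L2 \<Rightarrow> complex" where
  "pairing k u = (LINT x|lebesgue. k x * rep_L2 u x)"

text \<open>The vector representing the real part of the functional:
  \<open>Re (pairing k u) = inner u (riesz k)\<close> for square-integrable
  \<open>k\<close>.\<close>

definition riesz :: "('a::euclidean_space \<Rightarrow> complex) \<Rightarrow> 'a L2" where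
  "riesz k = to_L2 (\<lambda>x. cnj (k x))"

lemma pairing_integrable:
  assumes "square_integrable k"
  shows "integrable lebesgue (\<lambda>x. k x * rep_L2 u x)"
  using square_integrable_prod[OF square_integrable_rep_L2 square_integrable_cnj[OF assms], of u]
  by (simp add: mult.commute)

lemma inner_to_L2: "square_integrable f \<Longrightarrow> square_integrable g \<Longrightarrow>
    inner (to_L2 f) (to_L2 g) = Re (LINT x|lebesgue. f x * cnj (g x))"
  by (simp add: inner_L2.abs_eq)

text \<open>The real inner product sees only the real part of a functional, and
  \<open>Im z = Re (- \<i> * z)\<close>. Orthogonality to both vectors is therefore equivalent to
  the vanishing of the complex functional.\<close>

lemma pairing_eq_inner:
  assumes k: "square_integrable k"
  shows "pairing k u = Complex (inner u (riesz k)) (inner u (riesz (\<lambda>x. - \<i> * k x)))"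
proof (rule complex_eqI)
  have "inner (to_L2 (rep_L2 u)) (riesz k) = Re (LINT x|lebesgue. rep_L2 u x * cnj (cnj (k x)))"
    unfolding riesz_def by (rule inner_to_L2[OF square_integrable_rep_L2 square_integrable_cnj[OF k]])
  then show "Re (pairing k u) = Re (Complex (inner u (riesz k)) (inner u (riesz (\<lambda>x. - \<i> * k x))))"
    by (simp add: pairing_def to_L2_rep_L2 mult.commute)
  have "inner (to_L2 (rep_L2 u)) (riesz (\<lambda>x. - \<i> * k x))
      = Re (LINT x|lebesgue. rep_L2 u x * cnj (cnj (- \<i> * k x)))"
    unfolding riesz_def
    by (rule inner_to_L2[OF square_integrable_rep_L2 square_integrable_cnj[OF square_integrable_mult[OF k]]])
  also have "\<dots> = Re (LINT x|lebesgue. - \<i> * (k x * rep_L2 u x))"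
    by (intro arg_cong[of _ _ Re] Bochner_Integration.integral_cong) simp_all
  also have "\<dots> = Im (pairing k u)"
    by (subst integral_mult_right_zero) (simp add: pairing_def)
  finally show "Im (pairing k u) = Im (Complex (inner u (riesz k)) (inner u (riesz (\<lambda>x. - \<i> * k x))))"
    by (simp add: to_L2_rep_L2)
qed

lemma norm_riesz:
  assumes k: "square_integrable k"
  shows "(norm (riesz k))^2 = (LINT x|lebesgue. (norm (k x))^2)"
  unfolding riesz_def norm_to_L2[OF square_integrable_cnj[OF k]] by simp

text \<open>Bessel's inequality holds for each of the two real vectors separately, whence the factor
  2.\<close>

lemma Bessel_pairing:
  assumes k: "square_integrable k" and E: "orthonormal E"
  shows "(\<Sum>e\<in>E. (norm (pairing k e))^2) \<le> 2 * (LINT x|lebesgue. (norm (k x))^2)"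
proof -
  have k': "square_integrable (\<lambda>x. - \<i> * k x)" by (rule square_integrable_mult[OF k])
  have "(\<Sum>e\<in>E. (norm (pairing k e))^2)
      = (\<Sum>e\<in>E. (inner (riesz k) e)^2) + (\<Sum>e\<in>E. (inner (riesz (\<lambda>x. - \<i> * k x)) e)^2)"
    unfolding pairing_eq_inner[OF k] sum.distrib[symmetric] by (simp add: cmod_power2 inner_commute)
  also have "\<dots> \<le> (norm (riesz k))^2 + (norm (riesz (\<lambda>x. - \<i> * k x)))^2"
    by (intro add_mono Bessel_inequality E)
  also have "\<dots> = 2 * (LINT x|lebesgue. (norm (k x))^2)"
    unfolding norm_riesz[OF k] norm_riesz[OF k'] by (simp add: norm_mult)
  finally show ?thesis .
qed

lemma norm_pairing_le:
  assumes k: "square_integrable k"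
  shows "(norm (pairing k u))^2 \<le> 2 * (LINT x|lebesgue. (norm (k x))^2) * (norm u)^2"
proof -
  have k': "square_integrable (\<lambda>x. - \<i> * k x)" by (rule square_integrable_mult[OF k])
  have CS: "(inner u v)^2 \<le> (norm u)^2 * (norm v)^2" for v :: "'a L2"
    using Cauchy_Schwarz_ineq[of u v] by (simp add: dot_square_norm)
  have "(norm (pairing k u))^2 = (inner u (riesz k))^2 + (inner u (riesz (\<lambda>x. - \<i> * k x)))^2"
    unfolding pairing_eq_inner[OF k] by (simp add: cmod_power2)
  also have "\<dots> \<le> (norm u)^2 * (norm (riesz k))^2 + (norm u)^2 * (norm (riesz (\<lambda>x. - \<i> * k x)))^2"
    by (intro add_mono CS)
  also have "\<dots> = 2 * (LINT x|lebesgue. (norm (k x))^2) * (norm u)^2"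
    unfolding norm_riesz[OF k] norm_riesz[OF k'] by (simp add: norm_mult)
  finally show ?thesis .
qed

lemma pairing_add: "square_integrable k \<Longrightarrow> pairing k (u + v) = pairing k u + pairing k v"
  by (simp add: pairing_eq_inner inner_add_left complex_eq_iff)

lemma rep_scaleC: "AE x in lebesgue. rep_L2 (scaleC c u) x = c * rep_L2 u x"
proof -
  have "scaleC c u = to_L2 (\<lambda>x. c * rep_L2 u x)"
    using scaleC.abs_eq[of "rep_L2 u" c] by (simp add: to_L2_rep_L2 square_integrable_rep_L2)
  then show ?thesis using rep_to_L2[OF square_integrable_mult[OF square_integrable_rep_L2]] by simp
qed

lemma pairing_scaleC:
  assumes "square_integrable k"
  shows "pairing k (scaleC c u) = c * pairing k u"
proof -
  have [measurable]: "k \<in> borel_measurable lebesgue" using assms by (simp add: square_integrable_def)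
  have "pairing k (scaleC c u) = (LINT x|lebesgue. c * (k x * rep_L2 u x))"
    unfolding pairing_def
    by (rule integral_cong_AE; measurable?) (use rep_scaleC[of c u] in \<open>auto elim!: eventually_mono\<close>)
  then show ?thesis by (simp add: pairing_def)
qed

text \<open>The rows of the kernel are bounded at every point rather than almost everywhere.\<close>
definition hs_kernel :: "('b::euclidean_space \<Rightarrow> 'a::euclidean_space \<Rightarrow> complex) \<Rightarrow> ('b \<Rightarrow> real) \<Rightarrow> bool" where
  "hs_kernel K w \<longleftrightarrow> (\<lambda>(y, x). K y x) \<in> borel_measurable lebesgue2 \<and>
     integrable lebesgue w \<and> (\<forall>y. 0 \<le> w y) \<and>
     (\<forall>y. sq_mass (K y) \<le> ennreal (w y))"

definition kernel_op :: "('b::euclidean_space \<Rightarrow> 'a::euclidean_space \<Rightarrow> complex) \<Rightarrow> 'a L2 \<Rightarrow> 'b L2" where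
  "kernel_op K u = to_L2 (\<lambda>y. pairing (K y) u)"

lemma LINT_le_of_nn_integral_le:
  assumes "f \<in> borel_measurable M" "\<And>x. 0 \<le> f x" "0 \<le> c" "(\<integral>\<^sup>+x. ennreal (f x) \<partial>M) \<le> ennreal c"
  shows "(LINT x|M. f x) \<le> c"
  using assms by (simp add: integral_eq_nn_integral enn2real_leI)

lemma hs_kernel_row:
  assumes "hs_kernel K w"
  shows "square_integrable (K y)" "(LINT x|lebesgue. (norm (K y x))^2) \<le> w y"
proof -
  have K: "(\<lambda>(y, x). K y x) \<in> borel_measurable lebesgue2"
    using assms by (simp add: hs_kernel_def)
  have pair: "(\<lambda>x. (y, x)) \<in> lebesgue \<rightarrow>\<^sub>M lebesgue2" by simp
  have meas [measurable]: "K y \<in> borel_measurable lebesgue"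
    using measurable_compose[OF pair K] by simp
  have le: "sq_mass (K y) \<le> ennreal (w y)"
    using assms by (simp add: hs_kernel_def)
  show "square_integrable (K y)"
    unfolding square_integrable_iff_nn_integral[OF meas] using le by (auto intro: le_less_trans)
  show "(LINT x|lebesgue. (norm (K y x))^2) \<le> w y"
    by (rule LINT_le_of_nn_integral_le[OF _ _ _ le]) (use assms in \<open>auto simp: hs_kernel_def\<close>)
qed

lemma hs_kernel_pairing_measurable:
  assumes "hs_kernel K w"
  shows "(\<lambda>y. pairing (K y) u) \<in> borel_measurable lebesgue"
proof -
  have [measurable]: "(\<lambda>(y, x). K y x) \<in> borel_measurable lebesgue2"
    using assms by (simp add: hs_kernel_def)
  have "(\<lambda>p. (\<lambda>(y, x). K y x) p * rep_L2 u (snd p)) \<in> borel_measurable lebesgue2"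
    by measurable
  then have "(\<lambda>(y, x). K y x * rep_L2 u x) \<in> borel_measurable lebesgue2"
    by (simp add: case_prod_unfold)
  then show ?thesis
    unfolding pairing_def by (rule lebesgue.borel_measurable_lebesgue_integral)
qed

lemma hs_kernel_pairing_square_integrable:
  assumes "hs_kernel K w"
  shows "square_integrable (\<lambda>y. pairing (K y) u)"
  unfolding square_integrable_def
proof
  show meas [measurable]: "(\<lambda>y. pairing (K y) u) \<in> borel_measurable lebesgue"
    by (rule hs_kernel_pairing_measurable[OF assms])
  have int: "integrable lebesgue (\<lambda>y. 2 * w y * (norm u)^2)"
    using assms by (simp add: hs_kernel_def)
  show "integrable lebesgue (\<lambda>y. (norm (pairing (K y) u))^2)"
  proof (rule Bochner_Integration.integrable_bound[OF int])
    have "(norm (pairing (K y) u))^2 \<le> 2 * w y * (norm u)^2" for y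
      by (rule order_trans[OF norm_pairing_le[OF hs_kernel_row(1)[OF assms]]])
         (intro mult_right_mono mult_left_mono hs_kernel_row(2)[OF assms], auto)
    then show "AE y in lebesgue. norm ((norm (pairing (K y) u))^2) \<le> norm (2 * w y * (norm u)^2)"
      by (auto intro!: always_eventually intro: order_trans[OF _ abs_ge_self])
  qed measurable
qed

lemma rep_kernel_op:
  assumes "hs_kernel K w"
  shows "AE y in lebesgue. rep_L2 (kernel_op K u) y = pairing (K y) u"
  unfolding kernel_op_def by (rule rep_to_L2[OF hs_kernel_pairing_square_integrable[OF assms]])

lemma integral_operator_kernel_op:
  assumes "hs_kernel K w"
  shows "integral_operator K (kernel_op K)"
  unfolding integral_operator_def
  using rep_kernel_op[OF assms] pairing_integrable[OF hs_kernel_row(1)[OF assms]]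
  by (auto simp: pairing_def[symmetric])

lemma kernel_op_add:
  assumes "hs_kernel K w"
  shows "kernel_op K (u + v) = kernel_op K u + kernel_op K v"
proof -
  note sq = hs_kernel_pairing_square_integrable[OF assms]
  show ?thesis
    unfolding kernel_op_def using plus_L2.abs_eq[of "\<lambda>y. pairing (K y) u" "\<lambda>y. pairing (K y) v"]
    by (simp add: sq pairing_add[OF hs_kernel_row(1)[OF assms]])
qed

lemma kernel_op_scaleC:
  assumes "hs_kernel K w"
  shows "kernel_op K (scaleC c u) = scaleC c (kernel_op K u)"
proof -
  note sq = hs_kernel_pairing_square_integrable[OF assms]
  show ?thesis
    unfolding kernel_op_def using scaleC.abs_eq[of "\<lambda>y. pairing (K y) u" c]
    by (simp add: sq pairing_scaleC[OF hs_kernel_row(1)[OF assms]])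
qed

lemma linear_kernel_op:
  assumes "hs_kernel K w"
  shows "linear (kernel_op K)"
  by (rule linearI) (simp_all add: kernel_op_add[OF assms] kernel_op_scaleC[OF assms] scaleR_eq_scaleC)

lemma inner_kernel_op:
  assumes "hs_kernel K w"
  shows "inner (kernel_op K u) v = Re (LINT y|lebesgue. LINT x|lebesgue. K y x * rep_L2 u x * cnj (rep_L2 v y))"
proof -
  note sq = hs_kernel_pairing_square_integrable[OF assms]
  have "inner (kernel_op K u) (to_L2 (rep_L2 v)) = Re (LINT y|lebesgue. pairing (K y) u * cnj (rep_L2 v y))"
    unfolding kernel_op_def by (rule inner_to_L2[OF sq square_integrable_rep_L2])
  then show ?thesis by (simp add: to_L2_rep_L2 pairing_def)
qed

text \<open>The two integrals may be exchanged. This exhibits the formal adjoint that the lemmas on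
  singular values take as an assumption.\<close>

lemma kernel_op_adjoint:
  fixes K :: "'b::euclidean_space \<Rightarrow> 'a::euclidean_space \<Rightarrow> complex"
  assumes K: "hs_kernel K w" and K': "hs_kernel (\<lambda>x y. cnj (K y x)) w'"
  shows "inner (kernel_op K u) v = inner u (kernel_op (\<lambda>x y. cnj (K y x)) v)"
proof -
  have mK [measurable]: "(\<lambda>(y, x). K y x) \<in> borel_measurable lebesgue2"
    using K by (simp add: hs_kernel_def)
  \<comment> \<open>With \<open>a = |K|\<close> and \<open>b = |u| |v|\<close> the integrand is at
    most \<open>|K|^2 + |u|^2 |v|^2\<close>, and both terms are integrable over the product.\<close>
  have ab: "a * b \<le> a^2 + b^2" if "0 \<le> a" "0 \<le> b" for a b :: real
    using sum_squares_bound[of a b] mult_nonneg_nonneg[OF that] by simp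
  let ?f = "\<lambda>y x. K y x * rep_L2 u x * cnj (rep_L2 v y)"
  let ?k = "\<lambda>p. ennreal ((norm ((\<lambda>(y, x). K y x) p))^2)"
    and ?w = "\<lambda>p. ennreal ((norm (rep_L2 v (fst p)))^2) * ennreal ((norm (rep_L2 u (snd p)))^2)"
  have meas: "(\<lambda>p. (\<lambda>(y, x). K y x) p * rep_L2 u (snd p) * cnj (rep_L2 v (fst p)))
      \<in> borel_measurable lebesgue2" by measurable
  have n1: "(\<lambda>p. ?k p) \<in> borel_measurable lebesgue2"
    by (rule measurable_compose[OF mK, of "\<lambda>z. ennreal ((norm z)^2)"]) measurable
  have int: "integrable lebesgue2 (\<lambda>(y, x). ?f y x)"
  proof (rule integrableI_bounded)
    show "(\<lambda>(y, x). ?f y x) \<in> borel_measurable lebesgue2"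
      using meas by (simp add: case_prod_unfold)
    have "(\<integral>\<^sup>+p. ennreal (norm (case p of (y, x) \<Rightarrow> ?f y x)) \<partial>lebesgue2)
        \<le> (\<integral>\<^sup>+p. ?k p
             + ?w p \<partial>lebesgue2)"
    proof (rule nn_integral_mono)
      fix p :: "'b \<times> 'a"
      obtain y x where p: "p = (y, x)" by (cases p)
      have "norm (?f y x) \<le> (norm (K y x))^2 + (norm (rep_L2 v y) * norm (rep_L2 u x))^2"
        using ab[of "norm (K y x)" "norm (rep_L2 v y) * norm (rep_L2 u x)"]
        by (simp add: norm_mult ac_simps)
      then have "ennreal (norm (?f y x)) \<le> ennreal ((norm (K y x))^2 + (norm (rep_L2 v y))^2 * (norm (rep_L2 u x))^2)"
        by (intro ennreal_leI) (simp add: power_mult_distrib)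
      also have "\<dots> = ennreal ((norm (K y x))^2) + ennreal ((norm (rep_L2 v y))^2) * ennreal ((norm (rep_L2 u x))^2)"
        by (simp add: ennreal_plus ennreal_mult)
      finally show "ennreal (norm (case p of (y, x) \<Rightarrow> ?f y x)) \<le> ?k p
             + ?w p"
        by (simp add: p)
    qed
    also have "\<dots> = (\<integral>\<^sup>+p. ?k p \<partial>lebesgue2)
        + (\<integral>\<^sup>+p. ?w p \<partial>lebesgue2)"
      by (rule nn_integral_add[OF n1]) measurable
    also have "(\<integral>\<^sup>+p. ?k p \<partial>lebesgue2)
        = (\<integral>\<^sup>+y. \<integral>\<^sup>+x. ennreal ((norm (K y x))^2) \<partial>lebesgue \<partial>lebesgue)"
      by (subst lebesgue.nn_integral_fst[symmetric]) (rule n1, simp)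
    also have "\<dots> \<le> (\<integral>\<^sup>+y. ennreal (w y) \<partial>lebesgue)"
      using K by (intro nn_integral_mono) (simp add: hs_kernel_def)
    also have "\<dots> = ennreal (LINT y|lebesgue. w y)"
      using K by (intro nn_integral_eq_integral) (auto simp: hs_kernel_def)
    also have "(\<integral>\<^sup>+p. ?w p \<partial>lebesgue2)
        = (\<integral>\<^sup>+y. \<integral>\<^sup>+x. ennreal ((norm (rep_L2 v y))^2) * ennreal ((norm (rep_L2 u x))^2) \<partial>lebesgue \<partial>lebesgue)"
      by (subst lebesgue.nn_integral_fst[symmetric]) simp_all
    also have "\<dots> = ennreal ((norm v)^2) * ennreal ((norm u)^2)"
      by (simp add: nn_integral_cmult nn_integral_multc nn_integral_norm_L2_rep)
    finally show "(\<integral>\<^sup>+p. ennreal (norm (case p of (y, x) \<Rightarrow> ?f y x)) \<partial>lebesgue2) < \<infinity>"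
      by (auto simp: ennreal_mult[symmetric] intro: le_less_trans simp flip: ennreal_plus)
  qed
  have "inner (kernel_op K u) v = Re (LINT y|lebesgue. LINT x|lebesgue. ?f y x)"
    by (rule inner_kernel_op[OF K])
  also have "\<dots> = Re (LINT x|lebesgue. LINT y|lebesgue. ?f y x)"
    using lebesgue_pair.Fubini_integral[OF int] by simp
  also have "\<dots> = Re (cnj (LINT x|lebesgue. LINT y|lebesgue. ?f y x))" by simp
  also have "cnj (LINT x|lebesgue. LINT y|lebesgue. ?f y x)
      = (LINT x|lebesgue. LINT y|lebesgue. cnj (K y x) * rep_L2 v y * cnj (rep_L2 u x))"
    unfolding Bochner_Integration.integral_cnj[symmetric]
    by (intro Bochner_Integration.integral_cong refl) (simp add: ac_simps)
  also have "Re \<dots> = inner (kernel_op (\<lambda>x y. cnj (K y x)) v) u"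
    by (rule inner_kernel_op[OF K', symmetric])
  finally show ?thesis by (simp add: inner_commute)
qed

text \<open>A vector orthogonal to all exceptional vectors is annihilated by the functionals of all
  \<open>g i\<close>, so on it \<open>K\<close> acts like \<open>G\<close>. Bessel's inequality in
  each row, integrated over \<open>y\<close>, gives the bound.\<close>

lemma small_on_complement_kernel_op:
  fixes K G :: "'b::euclidean_space \<Rightarrow> 'a::euclidean_space \<Rightarrow> complex"
  assumes K: "hs_kernel K w" and I: "finite I"
    and g: "\<And>i. i \<in> I \<Longrightarrow> square_integrable (g i)"
    and diff: "\<And>y x. K y x = G y x + (\<Sum>i\<in>I. f i y * g i x)"
    and rows: "\<And>y. sq_mass (G y) \<le> ennreal (v y)"
    and v: "integrable lebesgue v" "\<And>y. 0 \<le> v y"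
  shows "\<exists>W. card W \<le> 2 * card I \<and> small_on_complement (kernel_op K) W (2 * (LINT y|lebesgue. v y))"
proof (intro exI conjI)
  let ?W1 = "(\<lambda>i. riesz (g i)) ` I" and ?W2 = "(\<lambda>i. riesz (\<lambda>x. - \<i> * g i x)) ` I"
  let ?W = "?W1 \<union> ?W2"
  show "card ?W \<le> 2 * card I"
    using card_Un_le[of ?W1 ?W2] card_image_le[OF I, of "\<lambda>i. riesz (g i)"]
      card_image_le[OF I, of "\<lambda>i. riesz (\<lambda>x. - \<i> * g i x)"] by linarith
  have sqF: "square_integrable (\<lambda>x. \<Sum>i\<in>J. f i y * g i x)" if "finite J" "J \<subseteq> I" for y J
    using that
  proof (induction J rule: finite_induct)
    case (insert j J)
    then show ?case
      using square_integrable_add[OF square_integrable_mult[OF g[of j], of "f j y"], of "\<lambda>x. \<Sum>i\<in>J. f i y * g i x"]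
      by simp
  qed (simp add: square_integrable_zero)
  have sqG: "square_integrable (G y)" for y
    using square_integrable_diff[OF hs_kernel_row(1)[OF K] sqF[OF I order_refl], of y y] diff by simp
  have Gle: "(LINT x|lebesgue. (norm (G y x))^2) \<le> v y" for y
    by (rule LINT_le_of_nn_integral_le[OF _ _ v(2) rows]) (use sqG in \<open>auto simp: square_integrable_def\<close>)
  have eq: "pairing (K y) e = pairing (G y) e" if e: "\<forall>w\<in>?W. inner e w = 0" for y e
  proof -
    have zero: "pairing (g i) e = 0" if "i \<in> I" for i
      using e that by (simp add: pairing_eq_inner[OF g[OF that]] complex_eq_iff)
    have "pairing (K y) e = (LINT x|lebesgue. G y x * rep_L2 e x + (\<Sum>i\<in>I. f i y * (g i x * rep_L2 e x)))"
      unfolding pairing_def by (simp add: diff distrib_right sum_distrib_right mult.assoc)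
    also have "\<dots> = pairing (G y) e + (\<Sum>i\<in>I. f i y * pairing (g i) e)"
      unfolding pairing_def using pairing_integrable[OF sqG] pairing_integrable[OF g]
      by (subst Bochner_Integration.integral_add)
         (auto intro!: Bochner_Integration.integrable_sum simp: Bochner_Integration.integral_sum)
    finally show ?thesis using zero by simp
  qed
  show "small_on_complement (kernel_op K) ?W (2 * (LINT y|lebesgue. v y))"
    unfolding small_on_complement_def
  proof (intro conjI allI impI)
    show "finite ?W" using I by simp
    fix E :: "'a L2 set" assume E: "orthonormal E" and W: "\<forall>e\<in>E. \<forall>w\<in>?W. inner e w = 0"
    have sq: "square_integrable (\<lambda>y. pairing (K y) e)" for e
      by (rule hs_kernel_pairing_square_integrable[OF K])
    have "(\<Sum>e\<in>E. (norm (kernel_op K e))^2) = (\<Sum>e\<in>E. (LINT y|lebesgue. (norm (pairing (K y) e))^2))"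
      unfolding kernel_op_def by (simp add: norm_to_L2[OF sq])
    also have "\<dots> = (LINT y|lebesgue. (\<Sum>e\<in>E. (norm (pairing (K y) e))^2))"
      by (rule Bochner_Integration.integral_sum[symmetric]) (use sq in \<open>auto simp: square_integrable_def\<close>)
    also have "\<dots> \<le> (LINT y|lebesgue. 2 * v y)"
    proof (rule integral_mono)
      show "integrable lebesgue (\<lambda>y. \<Sum>e\<in>E. (norm (pairing (K y) e))^2)"
        by (rule Bochner_Integration.integrable_sum) (use sq in \<open>auto simp: square_integrable_def\<close>)
      show "integrable lebesgue (\<lambda>y. 2 * v y)" using v by simp
      fix y
      have "(\<Sum>e\<in>E. (norm (pairing (K y) e))^2) = (\<Sum>e\<in>E. (norm (pairing (G y) e))^2)"
        using eq W by (intro sum.cong) auto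
      also have "\<dots> \<le> 2 * v y"
        using Bessel_pairing[OF sqG E, of y] Gle[of y] by linarith
      finally show "(\<Sum>e\<in>E. (norm (pairing (K y) e))^2) \<le> 2 * v y" .
    qed
    finally show "(\<Sum>e\<in>E. (norm (kernel_op K e))^2) \<le> 2 * (LINT y|lebesgue. v y)" by simp
  qed
qed

section \<open>Tensor product quadratic interpolation\<close>

text \<open>The increment is the integral of the derivative, which ignores finitely many points.
  They have to be allowed because a line through a cube may pass through coalescence points.\<close>

lemma increment_le_if_derivative_bounded:
  fixes g :: "real \<Rightarrow> complex"
  assumes S: "finite S" and ab: "a \<le> b" and cont: "continuous_on {a..b} g" and M: "0 \<le> M"
    and der: "\<And>t. t \<in> {a<..<b} - S \<Longrightarrow> (g has_vector_derivative g' t) (at t)"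
    and bound: "\<And>t. t \<in> {a<..<b} - S \<Longrightarrow> norm (g' t) \<le> M"
  shows "norm (g b - g a) \<le> M * (b - a)"
proof -
  define k where "k t = (if t \<in> {a<..<b} - S then g' t else 0)" for t
  have "(k has_integral (g b - g a)) {a..b}"
    by (rule fundamental_theorem_of_calculus_interior_strong[OF S ab _ cont]) (use der in \<open>simp add: k_def\<close>)
  moreover have "norm (k t) \<le> M" for t using bound M by (simp add: k_def)
  ultimately show ?thesis using has_integral_bound_real[OF M, of "{}" k "g b - g a" a b] ab by auto
qed

text \<open>Three mean value estimates on the unit interval, for the remainders of
  \<open>g2\<close>, \<open>g1\<close> and \<open>g\<close> in turn; the sharp factor 1/6 is given
  up.\<close>

lemma third_order_Taylor_bound:
  fixes g g1 g2 g3 :: "real \<Rightarrow> complex"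
  assumes g: "\<And>t. t \<in> {0..1} \<Longrightarrow> (g has_vector_derivative g1 t) (at t)"
    and g1: "\<And>t. t \<in> {0..1} \<Longrightarrow> (g1 has_vector_derivative g2 t) (at t)"
    and g2: "\<And>t. t \<in> {0..1} \<Longrightarrow> (g2 has_vector_derivative g3 t) (at t)"
    and g3: "\<And>t. t \<in> {0..1} \<Longrightarrow> norm (g3 t) \<le> M"
    and t: "t \<in> {0..1}"
  shows "norm (g t - (g 0 + of_real t * g1 0 + of_real (t^2) * (g2 0 / 2))) \<le> M"
proof -
  have M: "0 \<le> M" using g3[of 0] norm_ge_zero[of "g3 0"] by (simp del: norm_ge_zero)
  have step: "norm (r t) \<le> M"
    if r: "\<And>t. t \<in> {0..1} \<Longrightarrow> (r has_vector_derivative r' t) (at t)" "r 0 = 0"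
      and r': "\<And>t. t \<in> {0..1} \<Longrightarrow> norm (r' t) \<le> M" and t: "t \<in> {0..1}" for r r' :: "real \<Rightarrow> complex" and t
  proof -
    have "norm (r t - r 0) \<le> M * (t - 0)"
    proof (rule increment_le_if_derivative_bounded[of "{}" _ _ _ _ r'])
      show "continuous_on {0..t} r"
        using t by (intro continuous_at_imp_continuous_on ballI has_vector_derivative_continuous[OF r(1)]) auto
    qed (use r r' t M in auto)
    also have "\<dots> \<le> M" using t M mult_left_le[of t M] by simp
    finally show ?thesis using r(2) by simp
  qed
  have "norm (g2 t - g2 0) \<le> M" if "t \<in> {0..1}" for t
    by (rule step[of "\<lambda>t. g2 t - g2 0" g3]) (use g2 g3 that in \<open>auto intro!: derivative_eq_intros\<close>)
  then have "norm (g1 t - (g1 0 + of_real t * g2 0)) \<le> M" if "t \<in> {0..1}" for t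
    by (intro step[of "\<lambda>t. g1 t - (g1 0 + of_real t * g2 0)" "\<lambda>t. g2 t - g2 0"])
       (use g1 that in \<open>auto intro!: derivative_eq_intros\<close>)
  moreover have "((\<lambda>x. (complex_of_real x)^2) has_vector_derivative 2 * of_real t) (at t)" for t
    unfolding power2_eq_square by (auto intro!: derivative_eq_intros)
  ultimately show ?thesis
    by (intro step[of "\<lambda>t. g t - (g 0 + of_real t * g1 0 + of_real (t^2) * (g2 0 / 2))" "\<lambda>t. g1 t - (g1 0 + of_real t * g2 0)"])
       (use g t in \<open>auto intro!: derivative_eq_intros simp: scaleR_conv_of_real mult.commute\<close>)
qed

text \<open>The Lagrange basis for the nodes \<^term>\<open>0\<close>, \<^term>\<open>1/2\<close>, \<^term>\<open>1\<close>.\<close>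
definition lagrange :: "nat \<Rightarrow> real \<Rightarrow> real" where
  "lagrange s t = (if s = 0 then 2 * (t - 1/2) * (t - 1) else if s = 1 then 4 * t * (1 - t) else 2 * t * (t - 1/2))"

lemma abs_lagrange_le:
  assumes "t \<in> {0..1}"
  shows "\<bar>lagrange s t\<bar> \<le> 1"
proof -
  have t: "0 \<le> t * (1 - t)" "0 \<le> (1 - t) * (1 - t)" "0 \<le> t * t" "0 \<le> t" "t \<le> 1"
    using assms by auto
  moreover have "0 \<le> (2 * t - 1) * (2 * t - 1)" by simp
  ultimately show ?thesis
    unfolding lagrange_def by (simp add: abs_le_iff algebra_simps)
qed

lemma lagrange_reproduces_quadratics:
  fixes a b c :: complex
  shows "(\<Sum>s<3. of_real (lagrange s t) * (a + of_real (real s / 2) * b + of_real ((real s / 2)^2) * c))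
    = a + of_real t * b + of_real (t^2) * c"
proof -
  have "(\<Sum>s<3. of_real (lagrange s t) * (a + of_real (real s / 2) * b + of_real ((real s / 2)^2) * c))
    = of_real (lagrange 0 t + lagrange 1 t + lagrange 2 t) * a
      + of_real (lagrange 1 t / 2 + lagrange 2 t) * b + of_real (lagrange 1 t / 4 + lagrange 2 t) * c"
    by (simp add: eval_nat_numeral algebra_simps add_divide_distrib)
  moreover have "lagrange 0 t + lagrange 1 t + lagrange 2 t = 1"
    "lagrange 1 t / 2 + lagrange 2 t = t" "lagrange 1 t / 4 + lagrange 2 t = t^2"
    by (simp_all add: lagrange_def power2_eq_square field_simps)
  ultimately show ?thesis by (simp only: of_real_1 mult_1_left)
qed

text \<open>Interpolation reproduces the quadratic, and its three weights are at most 1 in modulus,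
  so the deviation \<rho> enters once directly and three times through the nodes.\<close>

lemma interpolation_error:
  fixes g :: "real \<Rightarrow> complex"
  assumes near: "\<And>t. t \<in> {0..1} \<Longrightarrow> norm (g t - (a + of_real t * b + of_real (t^2) * c)) \<le> \<rho>"
    and t: "t \<in> {0..1}"
  shows "norm (g t - (\<Sum>s<3. of_real (lagrange s t) * g (real s / 2))) \<le> 4 * \<rho>"
proof -
  let ?q = "\<lambda>t. a + of_real t * b + of_real (t^2) * c"
  have "g t - (\<Sum>s<3. of_real (lagrange s t) * g (real s / 2))
      = (g t - ?q t) - (\<Sum>s<3. of_real (lagrange s t) * (g (real s / 2) - ?q (real s / 2)))"
    unfolding right_diff_distrib sum_subtractf lagrange_reproduces_quadratics by simp
  also have "norm \<dots> \<le> norm (g t - ?q t) + (\<Sum>s<3. norm (of_real (lagrange s t) * (g (real s / 2) - ?q (real s / 2))))"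
    by (intro order_trans[OF norm_triangle_ineq4] add_left_mono norm_sum)
  also have "\<dots> \<le> \<rho> + (\<Sum>s<3::nat. \<rho>)"
  proof (intro add_mono sum_mono near t)
    fix s :: nat assume "s \<in> {..<3}"
    then have "norm (g (real s / 2) - ?q (real s / 2)) \<le> \<rho>" by (intro near) auto
    then have "\<bar>lagrange s t\<bar> * norm (g (real s / 2) - ?q (real s / 2)) \<le> 1 * \<rho>"
      by (intro mult_mono abs_lagrange_le t) auto
    then show "norm (of_real (lagrange s t) * (g (real s / 2) - ?q (real s / 2))) \<le> \<rho>"
      by (simp add: norm_mult)
  qed
  finally show ?thesis by simp
qed

section \<open>Interpolation on cubes in three variables\<close>

definition closed_cube :: "real^3 \<Rightarrow> real \<Rightarrow> (real^3) set" where
  "closed_cube c h = {x. \<forall>i. c $ i \<le> x $ i \<and> x $ i \<le> c $ i + h}"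

definition upd :: "real^3 \<Rightarrow> 3 \<Rightarrow> real \<Rightarrow> real^3" where
  "upd x i v = (\<chi> k. if k = i then v else x $ k)"

lemma upd_nth [simp]: "upd x i v $ k = (if k = i then v else x $ k)"
  by (simp add: upd_def)

text \<open>Acting in one variable at a time reduces all errors to one dimension and involves pure
  derivatives only.\<close>

definition interp :: "real^3 \<Rightarrow> real \<Rightarrow> 3 \<Rightarrow> (real^3 \<Rightarrow> complex) \<Rightarrow> real^3 \<Rightarrow> complex" where
  "interp c h i f x = (\<Sum>s<3. of_real (lagrange s ((x $ i - c $ i) / h)) * f (upd x i (c $ i + h * (real s / 2))))"

definition interp3 :: "real^3 \<Rightarrow> real \<Rightarrow> (real^3 \<Rightarrow> complex) \<Rightarrow> real^3 \<Rightarrow> complex" where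
  "interp3 c h f = interp c h 1 (interp c h 2 (interp c h 3 f))"

lemma closed_cube_scaled:
  assumes "0 < h" "x \<in> closed_cube c h"
  shows "(x $ i - c $ i) / h \<in> {0..1}"
  using assms by (auto simp: closed_cube_def field_simps)

lemma upd_in_closed_cube:
  assumes "0 < h" "x \<in> closed_cube c h" "t \<in> {0..1}"
  shows "upd x i (c $ i + h * t) \<in> closed_cube c h"
  using assms by (auto simp: closed_cube_def mult_left_le)

lemma interp_diff: "interp c h i (\<lambda>x. f x - g x) x = interp c h i f x - interp c h i g x"
  by (simp add: interp_def right_diff_distrib sum_subtractf)

lemma norm_interp_le:
  assumes "0 < h" "\<And>x. x \<in> closed_cube c h \<Longrightarrow> norm (f x) \<le> \<eta>" "x \<in> closed_cube c h"
  shows "norm (interp c h i f x) \<le> 3 * \<eta>"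
proof -
  have "norm (interp c h i f x) \<le> (\<Sum>s<3::nat. \<eta>)"
    unfolding interp_def
  proof (rule sum_norm_le)
    fix s :: nat assume "s \<in> {..<3}"
    then have "norm (f (upd x i (c $ i + h * (real s / 2)))) \<le> \<eta>"
      by (intro assms(2)[OF upd_in_closed_cube[OF assms(1,3)]]) auto
    then have "\<bar>lagrange s ((x $ i - c $ i) / h)\<bar> * norm (f (upd x i (c $ i + h * (real s / 2)))) \<le> 1 * \<eta>"
      by (intro mult_mono abs_lagrange_le closed_cube_scaled assms(1,3)) auto
    then show "norm (of_real (lagrange s ((x $ i - c $ i) / h)) * f (upd x i (c $ i + h * (real s / 2)))) \<le> \<eta>"
      by (simp add: norm_mult)
  qed
  then show ?thesis by simp
qed

text \<open>Telescoping \<open>1 - I1 I2 I3 = (1 - I1) + I1 (1 - I2) + I1 I2 (1 - I3)\<close>. Each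
  interpolation multiplies a sup bound on the cube by at most 3, and
  \<open>13 = 1 + 3 + 9\<close>.\<close>

lemma interp3_error:
  assumes h: "0 < h" and err: "\<And>i x. x \<in> closed_cube c h \<Longrightarrow> norm (f x - interp c h i f x) \<le> \<eta>"
    and x: "x \<in> closed_cube c h"
  shows "norm (f x - interp3 c h f x) \<le> 13 * \<eta>"
proof -
  let ?I = "interp c h"
  have "f x - interp3 c h f x = (f x - ?I 1 f x) + ?I 1 (\<lambda>x. f x - ?I 2 f x) x
      + ?I 1 (?I 2 (\<lambda>x. f x - ?I 3 f x)) x"
    unfolding interp3_def by (simp add: interp_diff[abs_def])
  also have "norm \<dots> \<le> \<eta> + 3 * \<eta> + 3 * (3 * \<eta>)"
    by (intro order_trans[OF norm_triangle_ineq] add_mono err norm_interp_le h x)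
  finally show ?thesis by simp
qed

type_synonym node = "nat \<times> nat \<times> nat"

definition interp_nodes :: "node set" where
  "interp_nodes = {..<3} \<times> {..<3} \<times> {..<3}"

definition interp_node :: "real^3 \<Rightarrow> real \<Rightarrow> node \<Rightarrow> real^3" where
  "interp_node c h = (\<lambda>(r, s, t). upd (upd (upd c 1 (c $ 1 + h * (real r / 2))) 2 (c $ 2 + h * (real s / 2))) 3 (c $ 3 + h * (real t / 2)))"

definition interp_weight :: "real^3 \<Rightarrow> real \<Rightarrow> node \<Rightarrow> real^3 \<Rightarrow> real" where
  "interp_weight c h = (\<lambda>(r, s, t) x. lagrange r ((x $ 1 - c $ 1) / h) * lagrange s ((x $ 2 - c $ 2) / h) * lagrange t ((x $ 3 - c $ 3) / h))"

lemma card_interp_nodes: "card interp_nodes = 27" and finite_interp_nodes: "finite interp_nodes"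
  by (simp_all add: interp_nodes_def)

text \<open>In this form \<open>x\<close> occurs only in the weights and \<open>f\<close> only
  through its values at the nodes, which separates \<open>x\<close> from \<open>y\<close> when
  \<open>f\<close> is \<open>\<psi> (y, x)\<close> as a function of \<open>x\<close>.\<close>

lemma interp3_eq_sum:
  "interp3 c h f x = (\<Sum>p\<in>interp_nodes. of_real (interp_weight c h p x) * f (interp_node c h p))"
proof -
  \<comment> \<open>All three coordinates are overwritten, so the base point may be replaced by the
    corner.\<close>
  have node: "upd (upd (upd x 1 u) 2 v) 3 w = upd (upd (upd c 1 u) 2 v) 3 w" for u v w
    by (simp add: vec_eq_iff forall_3)
  have ne: "(1::3) \<noteq> 2" "(1::3) \<noteq> 3" "(2::3) \<noteq> 3" "(2::3) \<noteq> 1" "(3::3) \<noteq> 1" "(3::3) \<noteq> 2" by simp_all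
  show ?thesis
    unfolding interp3_def interp_def interp_nodes_def sum.cartesian_product' interp_node_def interp_weight_def
    by (simp add: sum_distrib_left ne node mult.assoc)
qed

lemma partial_has_vector_derivative:
  fixes f :: "real^3 \<Rightarrow> complex"
  assumes "f differentiable (at (b + (h * t) *\<^sub>R e))"
  shows "((\<lambda>t. f (b + (h * t) *\<^sub>R e)) has_vector_derivative of_real h * partial e f (b + (h * t) *\<^sub>R e)) (at t)"
proof -
  let ?x = "b + (h * t) *\<^sub>R e"
  let ?D = "frechet_derivative f (at ?x)"
  have f: "(f has_derivative ?D) (at ?x)" using assms by (simp add: frechet_derivative_works)
  have g: "((\<lambda>t. b + (h * t) *\<^sub>R e) has_derivative (\<lambda>s. (h * s) *\<^sub>R e)) (at t)"
    by (auto intro!: derivative_eq_intros)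
  have "((\<lambda>t. f (b + (h * t) *\<^sub>R e)) has_derivative (\<lambda>s. ?D ((h * s) *\<^sub>R e))) (at t)"
    using diff_chain_at[OF g f] by (simp add: o_def)
  moreover have "?D ((h * s) *\<^sub>R e) = s *\<^sub>R (of_real h * partial e f ?x)" for s
    using linear_scale[OF has_derivative_linear[OF f], of "h * s" e]
    by (simp add: partial_def scaleR_conv_of_real mult.assoc mult.commute mult.left_commute)
  ultimately show ?thesis by (simp add: has_vector_derivative_def)
qed

lemma upd_line: "upd x i (v + s) = upd x i v + s *\<^sub>R axis i 1"
  by (simp add: vec_eq_iff axis_def)

lemma interp_error_of_line:
  fixes f :: "real^3 \<Rightarrow> complex"
  assumes h: "0 < h" and x: "x \<in> closed_cube c h"
    and near: "\<And>t. t \<in> {0..1} \<Longrightarrow> norm (f (upd x i (c $ i + h * t)) - (a + of_real t * b + of_real (t^2) * d)) \<le> \<rho>"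
  shows "norm (f x - interp c h i f x) \<le> 4 * \<rho>"
proof -
  let ?t = "(x $ i - c $ i) / h"
  have "upd x i (c $ i + h * ?t) = x" using h by (simp add: vec_eq_iff)
  then show ?thesis
    using interpolation_error[OF near closed_cube_scaled[OF h x, of i]] by (simp add: interp_def)
qed

text \<open>Comparison with a constant instead of a genuine quadratic. \<open>P\<close> collects the
  cusps, where \<open>f\<close> is merely continuous.\<close>

lemma interp_error_Lipschitz:
  fixes f :: "real^3 \<Rightarrow> complex"
  assumes h: "0 < h" and x: "x \<in> closed_cube c h" and P: "finite P" and f: "continuous_on UNIV f"
    and diff: "\<And>x. x \<in> closed_cube c h - P \<Longrightarrow> f differentiable (at x)" and B: "0 \<le> B"
    and bound: "\<And>x. x \<in> closed_cube c h - P \<Longrightarrow> norm (partial (axis i 1) f x) \<le> B"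
  shows "norm (f x - interp c h i f x) \<le> 4 * (h * B)"
proof (rule interp_error_of_line[OF h x, of _ _ "f (upd x i (c $ i))" 0 0])
  fix t :: real assume t: "t \<in> {0..1}"
  let ?b = "upd x i (c $ i)"
  define g where "g t = f (?b + (h * t) *\<^sub>R axis i 1)" for t
  have line: "?b + (h * t) *\<^sub>R axis i 1 = upd x i (c $ i + h * t)" for t by (simp add: upd_line)
  have inj: "inj (\<lambda>t. ?b + (h * t) *\<^sub>R axis i (1::real))"
    using h by (auto simp: inj_on_def vec_eq_iff axis_def)
  define S where "S = (\<lambda>t. ?b + (h * t) *\<^sub>R axis i (1::real)) -` P"
  have S: "finite S" unfolding S_def by (rule finite_vimageI[OF P inj])
  have "norm (g t - g 0) \<le> (h * B) * (t - 0)"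
  proof (rule increment_le_if_derivative_bounded[OF S])
    show "continuous_on {0..t} g"
      unfolding g_def by (intro continuous_on_compose2[OF f] continuous_intros) auto
    fix s assume s: "s \<in> {0<..<t} - S"
    then have in_cube: "?b + (h * s) *\<^sub>R axis i 1 \<in> closed_cube c h - P"
      using upd_in_closed_cube[OF h x, of s i] t by (auto simp: line[symmetric] S_def)
    show "(g has_vector_derivative of_real h * partial (axis i 1) f (?b + (h * s) *\<^sub>R axis i 1)) (at s)"
      unfolding g_def by (rule partial_has_vector_derivative[OF diff[OF in_cube]])
    show "norm (of_real h * partial (axis i 1) f (?b + (h * s) *\<^sub>R axis i 1)) \<le> h * B"
      using bound[OF in_cube] h by (simp add: norm_mult mult_left_mono)
  qed (use t h B in auto)
  also have "\<dots> \<le> h * B" using t h B mult_left_le[of t "h * B"] by simp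
  finally show "norm (f (upd x i (c $ i + h * t)) - (f (upd x i (c $ i)) + of_real t * 0 + of_real (t^2) * 0)) \<le> h * B"
    by (simp add: g_def line)
qed

text \<open>Rescaled to the unit interval, the function on a line parallel to an axis gains a factor
  \<open>h\<close> with every derivative.\<close>

lemma interp_error_third_derivative:
  fixes f :: "real^3 \<Rightarrow> complex"
  assumes h: "0 < h" and x: "x \<in> closed_cube c h"
    and diff: "\<And>x k. x \<in> closed_cube c h \<Longrightarrow> k < 3 \<Longrightarrow> (partial (axis i 1) ^^ k) f differentiable (at x)"
    and bound: "\<And>x. x \<in> closed_cube c h \<Longrightarrow> norm ((partial (axis i 1) ^^ 3) f x) \<le> M"
  shows "norm (f x - interp c h i f x) \<le> 4 * (h ^ 3 * M)"
proof -
  let ?e = "axis i (1::real)" and ?b = "upd x i (c $ i)"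
  define G where "G k t = of_real (h ^ k) * (partial ?e ^^ k) f (?b + (h * t) *\<^sub>R ?e)" for k t
  have line: "?b + (h * t) *\<^sub>R ?e = upd x i (c $ i + h * t)" for t by (simp add: upd_line)
  have in_cube: "?b + (h * t) *\<^sub>R ?e \<in> closed_cube c h" if "t \<in> {0..1}" for t
    unfolding line by (rule upd_in_closed_cube[OF h x that])
  have der: "(G k has_vector_derivative G (Suc k) t) (at t)" if "k < 3" "t \<in> {0..1}" for k t
  proof -
    from partial_has_vector_derivative[OF diff[OF in_cube[OF that(2)] that(1)]]
    have "((\<lambda>t. of_real (h ^ k) * (partial ?e ^^ k) f (?b + (h * t) *\<^sub>R ?e)) has_vector_derivative
        of_real (h ^ k) * (of_real h * partial ?e ((partial ?e ^^ k) f) (?b + (h * t) *\<^sub>R ?e))) (at t)"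
      by (rule has_vector_derivative_mult_right)
    then show ?thesis unfolding G_def by (simp add: mult.assoc mult.left_commute[of "of_real h"])
  qed
  show ?thesis
  proof (rule interp_error_of_line[OF h x, of _ _ "G 0 0" "G 1 0" "G 2 0 / 2"])
    fix t :: real assume t: "t \<in> {0..1}"
    have "norm (G 0 t - (G 0 0 + of_real t * G 1 0 + of_real (t^2) * (G 2 0 / 2))) \<le> h ^ 3 * M"
    proof (rule third_order_Taylor_bound[of _ _ _ "G 3"])
      fix s :: real assume s: "s \<in> {0..1}"
      show "(G 0 has_vector_derivative G 1 s) (at s)" using der[of 0 s] s by simp
      show "(G 1 has_vector_derivative G 2 s) (at s)" using der[of 1 s] s by (simp add: numeral_2_eq_2)
      show "(G 2 has_vector_derivative G 3 s) (at s)" using der[of 2 s] s by (simp add: numeral_3_eq_3 numeral_2_eq_2)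
      show "norm (G 3 s) \<le> h ^ 3 * M"
        unfolding G_def using bound[OF in_cube[OF s]] h by (simp add: norm_mult norm_power)
    qed (rule t)
    then show "norm (f (upd x i (c $ i + h * t)) - (G 0 0 + of_real t * G 1 0 + of_real (t^2) * (G 2 0 / 2))) \<le> h ^ 3 * M"
      by (simp add: G_def line)
  qed
qed

section \<open>Stopping families of dyadic cubes\<close>

definition dyadic_index :: "nat \<Rightarrow> real^3 \<Rightarrow> int^3" where
  "dyadic_index j x = (\<chi> i. \<lfloor>2 ^ j * x $ i\<rfloor>)"

text \<open>Half-open, so that the cubes of one level partition the space and nesting becomes
  integer division of indices.\<close>

definition dyadic_cube :: "nat \<Rightarrow> int^3 \<Rightarrow> (real^3) set" where
  "dyadic_cube j m = {x. dyadic_index j x = m}"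

abbreviation cell :: "int^3 \<Rightarrow> (real^3) set" where "cell \<equiv> dyadic_cube 0"

definition dyadic_corner :: "nat \<Rightarrow> int^3 \<Rightarrow> real^3" where
  "dyadic_corner j m = (\<chi> i. of_int (m $ i) / 2 ^ j)"

lemma dyadic_index_in_cube [simp]: "x \<in> dyadic_cube j (dyadic_index j x)"
  by (simp add: dyadic_cube_def)

lemma dyadic_cube_iff:
  "x \<in> dyadic_cube j m \<longleftrightarrow> (\<forall>i. of_int (m $ i) \<le> 2 ^ j * x $ i \<and> 2 ^ j * x $ i < of_int (m $ i) + 1)"
  by (auto simp: dyadic_cube_def dyadic_index_def vec_eq_iff floor_eq_iff)

lemma dyadic_cube_subset_closed_cube: "dyadic_cube j m \<subseteq> closed_cube (dyadic_corner j m) (1 / 2 ^ j)"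
  by (auto simp: dyadic_cube_iff closed_cube_def dyadic_corner_def field_simps intro: less_imp_le)

lemma dyadic_cube_measurable: "dyadic_cube j m \<in> sets borel"
proof -
  have "dyadic_cube j m = (\<Inter>i\<in>UNIV. {x. of_int (m $ i) \<le> 2 ^ j * x $ i} \<inter> {x. 2 ^ j * x $ i < of_int (m $ i) + 1})"
    by (auto simp: dyadic_cube_iff)
  also have "\<dots> \<in> sets borel"
    by (intro sets.finite_INT sets.Int borel_closed borel_open closed_Collect_le open_Collect_less continuous_intros) auto
  finally show ?thesis .
qed

lemma dyadic_index_coarser:
  assumes "i \<le> j"
  shows "dyadic_index i x $ l = dyadic_index j x $ l div 2 ^ (j - i)"
proof -
  have "(2::real) ^ j = 2 ^ i * 2 ^ (j - i)" using assms by (simp flip: power_add)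
  then have "\<lfloor>2 ^ i * x $ l\<rfloor> = \<lfloor>2 ^ j * x $ l / real_of_int (2 ^ (j - i))\<rfloor>" by simp
  also have "\<dots> = \<lfloor>2 ^ j * x $ l\<rfloor> div 2 ^ (j - i)" by (rule floor_divide_real_eq_div) simp
  finally show ?thesis by (simp add: dyadic_index_def)
qed

lemma dyadic_index_coarser_eq:
  assumes "i \<le> j" "dyadic_index j x = dyadic_index j y"
  shows "dyadic_index i x = dyadic_index i y"
proof -
  have "dyadic_index i x $ l = dyadic_index i y $ l" for l
    unfolding dyadic_index_coarser[OF assms(1)] using assms(2) by simp
  then show ?thesis by (simp add: vec_eq_iff)
qed

lemma dyadic_cube_subset:
  assumes "i \<le> j" "x \<in> dyadic_cube i m"
  shows "dyadic_cube j (dyadic_index j x) \<subseteq> dyadic_cube i m"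
proof
  fix y assume "y \<in> dyadic_cube j (dyadic_index j x)"
  then have "dyadic_index j y = dyadic_index j x" by (simp add: dyadic_cube_def)
  from dyadic_index_coarser_eq[OF assms(1) this] show "y \<in> dyadic_cube i m"
    using assms(2) by (simp add: dyadic_cube_def)
qed

lemma finite_int_box: "finite {m :: int^3. \<forall>i. m $ i \<in> A i}" (is ?fin)
  and card_int_box: "card {m :: int^3. \<forall>i. m $ i \<in> A i} \<le> (\<Prod>i\<in>UNIV. card (A i))" (is ?card)
  if "\<And>i. finite (A i)" for A :: "3 \<Rightarrow> int set"
proof -
  have inj: "inj_on vec_nth {m :: int^3. \<forall>i. m $ i \<in> A i}"
    by (auto simp: inj_on_def vec_eq_iff)
  have sub: "vec_nth ` {m :: int^3. \<forall>i. m $ i \<in> A i} \<subseteq> PiE UNIV A" by auto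
  have fin: "finite (PiE UNIV A)" using that by (intro finite_PiE) auto
  show ?fin using finite_imageD[OF finite_subset[OF sub fin] inj] .
  show ?card using card_inj_on_le[OF inj sub fin] by (simp add: card_PiE)
qed

definition dyadic_level :: "nat \<Rightarrow> int^3 \<Rightarrow> (int^3) set" where
  "dyadic_level j n = dyadic_index j ` cell n"

lemma finite_dyadic_level: "finite (dyadic_level j n)"
  and card_dyadic_level: "card (dyadic_level j n) \<le> 8 ^ j"
proof -
  let ?A = "\<lambda>i. {2 ^ j * n $ i..<2 ^ j * n $ i + 2 ^ j}"
  have "dyadic_level j n \<subseteq> {m. \<forall>i. m $ i \<in> ?A i}"
  proof
    fix m assume "m \<in> dyadic_level j n"
    then obtain x where x: "m = dyadic_index j x" "x \<in> cell n" by (auto simp: dyadic_level_def)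
    have "n $ i = m $ i div 2 ^ j" for i
      using x dyadic_index_coarser[of 0 j x i] by (simp add: dyadic_cube_def)
    moreover have "m $ i = 2 ^ j * (m $ i div 2 ^ j) + m $ i mod 2 ^ j" for i by simp
    moreover have "0 \<le> m $ i mod 2 ^ j" "m $ i mod 2 ^ j < 2 ^ j" for i by simp_all
    ultimately show "m \<in> {m. \<forall>i. m $ i \<in> ?A i}" by (smt (verit) atLeastLessThan_iff mem_Collect_eq)
  qed
  note sub = this
  have fin: "finite {m :: int^3. \<forall>i. m $ i \<in> ?A i}" by (rule finite_int_box) simp
  show "finite (dyadic_level j n)" by (rule finite_subset[OF sub fin])
  have "card (dyadic_level j n) \<le> card {m :: int^3. \<forall>i. m $ i \<in> ?A i}" by (rule card_mono[OF fin sub])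
  also have "\<dots> \<le> (\<Prod>i\<in>UNIV. card (?A i))" by (rule card_int_box) simp
  also have "\<dots> = (2 ^ j) ^ 3" by (simp add: nat_power_eq)
  also have "\<dots> = 8 ^ j" by (simp add: power_mult[symmetric] mult.commute[of j]) (simp add: power_mult)
  finally show "card (dyadic_level j n) \<le> 8 ^ j" .
qed

lemma sum_half_powers_le:
  assumes "i \<le> j"
  shows "(\<Sum>l\<in>{i..<j}. (1/2::real) ^ l) \<le> 2 * (1/2) ^ i"
proof -
  have "(\<Sum>l\<in>{i..<j}. (1/2::real) ^ l) = 2 * (1/2) ^ i - 2 * (1/2) ^ j"
    using assms by (induction j rule: dec_induct) simp_all
  then show ?thesis by simp
qed

section \<open>Stopping cubes and their number\<close>

text \<open>The inequality says that mass times side is at most \<theta>. Starting at level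
  \<open>i\<close> keeps all sides at most \<open>1 / 2 ^ i\<close>.\<close>

definition stop_level :: "(real^3) measure \<Rightarrow> real \<Rightarrow> nat \<Rightarrow> real^3 \<Rightarrow> nat" where
  "stop_level \<nu> \<theta> i x = (LEAST j. i \<le> j \<and> measure \<nu> (dyadic_cube j (dyadic_index j x)) \<le> \<theta> * 2 ^ j)"

definition stop_cubes :: "(real^3) measure \<Rightarrow> real \<Rightarrow> nat \<Rightarrow> int^3 \<Rightarrow> (nat \<times> (int^3)) set" where
  "stop_cubes \<nu> \<theta> i n =
     (\<lambda>x. (stop_level \<nu> \<theta> i x, dyadic_index (stop_level \<nu> \<theta> i x) x)) ` cell n"

text \<open>\<theta> is derived from \<open>q\<close> and not conversely, so that a cell without
  mass is included: then \<theta> is 0 and the initial cubes already satisfy the stopping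
  condition.\<close>

locale dyadic_stopping = finite_measure \<nu> for \<nu> :: "(real^3) measure" +
  fixes n :: "int^3" and q :: real and i :: nat and \<theta> :: real
  assumes cubes: "\<And>j m. dyadic_cube j m \<in> sets \<nu>" and q: "1 \<le> q"
  defines "\<theta> \<equiv> measure \<nu> (cell n) / q"
begin

abbreviation level :: "real^3 \<Rightarrow> nat" where "level \<equiv> stop_level \<nu> \<theta> i"

abbreviation family :: "(nat \<times> (int^3)) set" where "family \<equiv> stop_cubes \<nu> \<theta> i n"

lemma theta_nonneg: "0 \<le> \<theta>"
  using q by (simp add: \<theta>_def)

lemma measure_eq: "measure \<nu> (cell n) = \<theta> * q"
  using q by (simp add: \<theta>_def)

text \<open>A level by which every point of the cell has stopped: a subcube has at most the mass
  \<open>\<theta> * q\<close> of the cell, and \<open>q \<le> 2 ^ max_level\<close>. It makes the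
  family finite.\<close>

definition max_level :: nat where
  "max_level = (SOME j. i \<le> j \<and> q \<le> 2 ^ j)"

lemma max_level: "i \<le> max_level" "q \<le> 2 ^ max_level"
proof -
  obtain j where "q < 2 ^ j" using real_arch_pow[of 2 q] by auto
  moreover have "(2::real) ^ j \<le> 2 ^ max i j" by (rule power_increasing) auto
  ultimately have "q \<le> 2 ^ max i j" by linarith
  then have "i \<le> max i j \<and> q \<le> 2 ^ max i j" by simp
  then have "i \<le> max_level \<and> q \<le> 2 ^ max_level" unfolding max_level_def by (rule someI)
  then show "i \<le> max_level" "q \<le> 2 ^ max_level" by auto
qed

abbreviation mass :: "nat \<Rightarrow> real^3 \<Rightarrow> real" where "mass j x \<equiv> measure \<nu> (dyadic_cube j (dyadic_index j x))"

lemma measure_subcube_le: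
  assumes "x \<in> cell n"
  shows "mass j x \<le> \<theta> * q"
  unfolding measure_eq[symmetric]
  by (rule finite_measure_mono[OF dyadic_cube_subset[OF _ assms] cubes]) simp

lemma max_level_good:
  assumes "x \<in> cell n"
  shows "mass max_level x \<le> \<theta> * 2 ^ max_level"
  using measure_subcube_le[OF assms, of max_level] mult_left_mono[OF max_level(2) theta_nonneg] by linarith

lemma stop_level:
  assumes "x \<in> cell n"
  shows "i \<le> level x"
    "mass (level x) x \<le> \<theta> * 2 ^ level x"
    "level x \<le> max_level"
proof -
  let ?P = "\<lambda>j. i \<le> j \<and> mass j x \<le> \<theta> * 2 ^ j"
  have P: "?P max_level" using max_level(1) max_level_good[OF assms] by simp
  have "?P (level x)" unfolding stop_level_def by (rule LeastI[of ?P, OF P])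
  then show "i \<le> level x"
    "mass (level x) x \<le> \<theta> * 2 ^ level x"
    by auto
  show "level x \<le> max_level" unfolding stop_level_def by (rule Least_le[of ?P, OF P])
qed

text \<open>Up to level \<open>level x\<close> the dyadic cubes around \<open>x\<close> and
  \<open>y\<close> coincide, and with them all tests made before stopping. Hence the stopping cubes
  partition the cell.\<close>

lemma stop_level_cong:
  assumes x: "x \<in> cell n" and y: "dyadic_index (level x) y = dyadic_index (level x) x"
  shows "level y = level x"
proof -
  let ?P = "\<lambda>x j. i \<le> j \<and> mass j x \<le> \<theta> * 2 ^ j"
  have eq: "dyadic_index j y = dyadic_index j x" if "j \<le> level x" for j
    by (rule dyadic_index_coarser_eq[OF that y])
  show ?thesis
    unfolding stop_level_def[of \<nu> \<theta> i y]
  proof (rule Least_equality)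
    show "?P y (level x)" using stop_level(1,2)[OF x] y by simp
    fix j assume j: "?P y j"
    show "level x \<le> j"
    proof (rule ccontr)
      assume "\<not> level x \<le> j"
      then have "?P x j" using j eq[of j] by simp
      then have "level x \<le> j" unfolding stop_level_def by (rule Least_le)
      then show False using \<open>\<not> level x \<le> j\<close> by simp
    qed
  qed
qed

lemma stop_cubes_level:
  assumes "(j, m) \<in> family"
  shows "i \<le> j" "j \<le> max_level" "m \<in> dyadic_level j n" "measure \<nu> (dyadic_cube j m) \<le> \<theta> * 2 ^ j"
    "dyadic_cube j m \<subseteq> cell n"
proof -
  obtain x where x: "x \<in> cell n" "j = level x" "m = dyadic_index j x"
    using assms by (auto simp: stop_cubes_def)
  show "i \<le> j" "j \<le> max_level" "measure \<nu> (dyadic_cube j m) \<le> \<theta> * 2 ^ j"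
    using stop_level[OF x(1)] x by simp_all
  show "m \<in> dyadic_level j n" "dyadic_cube j m \<subseteq> cell n"
    using x dyadic_cube_subset[OF _ x(1), of j] by (auto simp: dyadic_level_def)
qed

lemma finite_stop_cubes: "finite (family)"
proof -
  have "family \<subseteq> (SIGMA j:{..max_level}. dyadic_level j n)"
    using stop_cubes_level by auto
  then show ?thesis by (rule finite_subset) (simp add: finite_dyadic_level)
qed

lemma stop_cubes_unique:
  assumes "(j, m) \<in> family" "x \<in> dyadic_cube j m"
  shows "(j, m) = (level x, dyadic_index (level x) x)"
proof -
  obtain z where z: "z \<in> cell n" "j = level z" "m = dyadic_index j z"
    using assms(1) by (auto simp: stop_cubes_def)
  then have "dyadic_index (level z) x = dyadic_index (level z) z"
    using assms(2) by (simp add: dyadic_cube_def)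
  from stop_level_cong[OF z(1) this] show ?thesis using z assms(2) by (simp add: dyadic_cube_def)
qed

lemma sum_stop_cubes_indicator:
  fixes f :: "nat \<times> (int^3) \<Rightarrow> 'v::real_vector"
  assumes x: "x \<in> cell n"
  shows "(\<Sum>Q\<in>family. indicator (dyadic_cube (fst Q) (snd Q)) x *\<^sub>R f Q)
    = f (level x, dyadic_index (level x) x)"
proof -
  let ?Q = "(level x, dyadic_index (level x) x)"
  have "(\<Sum>Q\<in>family. indicator (dyadic_cube (fst Q) (snd Q)) x *\<^sub>R f Q)
      = (\<Sum>Q\<in>family. if Q = ?Q then f Q else 0)"
  proof (rule sum.cong[OF refl])
    fix Q assume "Q \<in> family"
    then have "x \<in> dyadic_cube (fst Q) (snd Q) \<longleftrightarrow> Q = ?Q"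
      using stop_cubes_unique[of "fst Q" "snd Q" x] by auto
    then show "indicator (dyadic_cube (fst Q) (snd Q)) x *\<^sub>R f Q = (if Q = ?Q then f Q else 0)" by auto
  qed
  also have "?Q \<in> family" using x by (auto simp: stop_cubes_def)
  then have "(\<Sum>Q\<in>family. if Q = ?Q then f Q else 0) = f ?Q"
    using finite_stop_cubes by simp
  finally show ?thesis .
qed

definition bad :: "nat \<Rightarrow> (int^3) set" where
  "bad j = {m \<in> dyadic_level j n. \<theta> * 2 ^ j < measure \<nu> (dyadic_cube j m)}"

text \<open>The cubes of one level are disjoint, so their measures add up to at most \<^term>\<open>\<theta> * q\<close>.\<close>
lemma card_bad: "real (card (bad j)) \<le> q * (1/2) ^ j"
\<comment> \<open>If \<theta> is 0, no subcube has positive mass and none is bad; otherwise \<theta>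
  can be cancelled at the end.\<close>
proof (cases "\<theta> = 0")
  case True
  have "bad j = {}"
    using measure_subcube_le[of _ j] True by (auto simp: bad_def dyadic_level_def not_less)
  then show ?thesis using q by simp
next
  case False
  then have pos: "0 < \<theta>" using theta_nonneg by simp
  have fin: "finite (bad j)" using finite_dyadic_level by (simp add: bad_def)
  have "real (card (bad j)) * (\<theta> * 2 ^ j) = (\<Sum>m\<in>bad j. \<theta> * 2 ^ j)" by simp
  also have "\<dots> \<le> (\<Sum>m\<in>bad j. measure \<nu> (dyadic_cube j m))"
    by (rule sum_mono) (simp add: bad_def)
  also have "\<dots> = measure \<nu> (\<Union>m\<in>bad j. dyadic_cube j m)"
    by (rule finite_measure_finite_Union[symmetric])
       (use fin cubes in \<open>auto simp: disjoint_family_on_def dyadic_cube_def\<close>)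
  also have "\<dots> \<le> \<theta> * q"
    unfolding measure_eq[symmetric]
    by (rule finite_measure_mono[OF _ cubes])
       (use dyadic_cube_subset[of 0 j _ n] in \<open>auto simp: bad_def dyadic_level_def\<close>)
  finally have "real (card (bad j)) * 2 ^ j \<le> q" using pos by (simp add: mult.left_commute)
  then show ?thesis by (simp add: field_simps power_divide)
qed

text \<open>A stopping cube has the initial level or is one of the eight children of a bad cube one
  level coarser. The factor 16 is 8 children times the 2 of the geometric series.\<close>

lemma card_stop_cubes: "real (card (family)) \<le> 8 ^ i + 16 * q * (1/2) ^ i"
proof -
  let ?L = "{i..<max_level}"
  let ?D = "{d :: int^3. \<forall>l. d $ l \<in> {0, 1}}"
  let ?f = "\<lambda>j (m, d). (Suc j, 2 * m + d)"
  let ?B = "\<Union>j\<in>?L. ?f j ` (bad j \<times> ?D)"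
  have finD: "finite ?D" and cardD: "card ?D \<le> 8"
    using finite_int_box[of "\<lambda>_. {0, 1}"] card_int_box[of "\<lambda>_. {0, 1}"] by (simp_all add: power3_eq_cube)
  have finbad: "finite (bad j)" for j using finite_dyadic_level by (simp add: bad_def)
  have sub: "family \<subseteq> Pair i ` dyadic_level i n \<union> ?B"
  proof
    fix Q assume "Q \<in> family"
    then obtain x where x: "x \<in> cell n" and Q: "Q = (level x, dyadic_index (level x) x)"
      by (auto simp: stop_cubes_def)
    show "Q \<in> Pair i ` dyadic_level i n \<union> ?B"
    proof (cases "level x = i")
      case True then show ?thesis using Q x by (auto simp: dyadic_level_def)
    next
      case False
      then obtain j where j: "level x = Suc j" "i \<le> j"
        using stop_level(1)[OF x] by (cases "level x") auto
      have notgood: "\<not> mass j x \<le> \<theta> * 2 ^ j"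
      proof
        assume "mass j x \<le> \<theta> * 2 ^ j"
        then have "level x \<le> j" unfolding stop_level_def using j(2) by (intro Least_le) simp
        then show False using j(1) by simp
      qed
      then have bad: "dyadic_index j x \<in> bad j" using x by (auto simp: bad_def dyadic_level_def)
      \<comment> \<open>The position of the child inside its parent, a vector of zeros and ones by
        division with remainder.\<close>
      define d where "d = dyadic_index (Suc j) x - 2 * dyadic_index j x"
      have d: "d \<in> ?D"
      proof -
        have "d $ l = dyadic_index (Suc j) x $ l mod 2" for l
          using dyadic_index_coarser[of j "Suc j" x l] by (simp add: d_def minus_mult_div_eq_mod)
        then show ?thesis by (auto simp: mod_2_eq_odd)
      qed
      have "j \<in> ?L" using stop_level(3)[OF x] j by simp
      moreover have "Q \<in> ?f j ` (bad j \<times> ?D)"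
        by (rule image_eqI[of _ _ "(dyadic_index j x, d)"]) (use bad d in \<open>auto simp: Q j(1) d_def\<close>)
      ultimately have "Q \<in> ?B" by (rule UN_I)
      then show ?thesis by (rule UnI2)
    qed
  qed
  have "card (family) \<le> card (Pair i ` dyadic_level i n \<union> ?B)"
    by (rule card_mono[OF _ sub]) (use finite_dyadic_level finbad finD in auto)
  also have "\<dots> \<le> card (Pair i ` dyadic_level i n) + card ?B" by (rule card_Un_le)
  also have "\<dots> \<le> 8 ^ i + (\<Sum>j\<in>?L. card (bad j) * 8)"
  proof (rule add_mono)
    show "card (Pair i ` dyadic_level i n) \<le> 8 ^ i"
      using card_image_le[OF finite_dyadic_level, of "Pair i" i n] card_dyadic_level[of i n] by linarith
    have "card ?B \<le> (\<Sum>j\<in>?L. card (?f j ` (bad j \<times> ?D)))" by (rule card_UN_le) simp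
    also have "\<dots> \<le> (\<Sum>j\<in>?L. card (bad j) * 8)"
    proof (rule sum_mono)
      fix j
      have "card (?f j ` (bad j \<times> ?D)) \<le> card (bad j) * card ?D"
        using card_image_le[of "bad j \<times> ?D" "?f j"] finbad finD by (simp add: card_cartesian_product)
      also have "\<dots> \<le> card (bad j) * 8" using cardD by simp
      finally show "card (?f j ` (bad j \<times> ?D)) \<le> card (bad j) * 8" .
    qed
    finally show "card ?B \<le> (\<Sum>j\<in>?L. card (bad j) * 8)" .
  qed
  finally have "real (card (family)) \<le> real (8 ^ i + (\<Sum>j\<in>?L. card (bad j) * 8))"
    by (rule of_nat_mono)
  also have "\<dots> = 8 ^ i + 8 * (\<Sum>j\<in>?L. real (card (bad j)))"
    by (simp add: sum_distrib_left mult.commute)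
  also have "\<dots> \<le> 8 ^ i + 8 * (\<Sum>j\<in>?L. q * (1/2) ^ j)"
    by (intro add_left_mono mult_left_mono sum_mono card_bad) simp
  also have "\<dots> = 8 ^ i + 8 * q * (\<Sum>j\<in>?L. (1/2) ^ j)" by (simp add: sum_distrib_left mult.assoc)
  also have "\<dots> \<le> 8 ^ i + 8 * q * (2 * (1/2) ^ i)"
    using q by (intro add_left_mono mult_left_mono sum_half_powers_le max_level) auto
  finally show ?thesis by simp
qed

text \<open>Within one level the indices \<open>m\<close> are distinct, so the values of \<omega>
  add up to at most \<open>c\<close>; the sides then form a geometric series comparable with the
  initial side. In the application \<omega> adds up lattice weights around the centers.\<close>

lemma sum_stop_cubes_le:
  fixes \<omega> :: "nat \<Rightarrow> int^3 \<Rightarrow> real"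
  assumes c: "\<And>j M. finite M \<Longrightarrow> (\<Sum>m\<in>M. \<omega> j m) \<le> c" and nn: "\<And>j m. 0 \<le> \<omega> j m"
  shows "(\<Sum>Q\<in>family. (1/2) ^ fst Q * \<omega> (fst Q) (snd Q)) \<le> 2 * (1/2) ^ i * c"
proof -
  let ?L = "{i..<Suc max_level}"
  have c0: "0 \<le> c" using c[of "{}"] by simp
  have "(\<Sum>Q\<in>family. (1/2) ^ fst Q * \<omega> (fst Q) (snd Q))
      \<le> (\<Sum>Q\<in>(SIGMA j:?L. dyadic_level j n). (1/2) ^ fst Q * \<omega> (fst Q) (snd Q))"
  proof (rule sum_mono2)
    show "family \<subseteq> (SIGMA j:?L. dyadic_level j n)"
      using stop_cubes_level by (auto simp: less_Suc_eq_le)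
  qed (use nn finite_dyadic_level in auto)
  also have "\<dots> = (\<Sum>j\<in>?L. \<Sum>m\<in>dyadic_level j n. (1/2) ^ j * \<omega> j m)"
    by (subst sum.Sigma) (auto simp: finite_dyadic_level split_def)
  also have "\<dots> = (\<Sum>j\<in>?L. (1/2) ^ j * (\<Sum>m\<in>dyadic_level j n. \<omega> j m))"
    by (simp add: sum_distrib_left)
  also have "\<dots> \<le> (\<Sum>j\<in>?L. (1/2) ^ j * c)"
    by (intro sum_mono mult_left_mono c finite_dyadic_level) simp
  also have "\<dots> = (\<Sum>j\<in>?L. (1/2) ^ j) * c" by (rule sum_distrib_right[symmetric])
  also have "\<dots> \<le> 2 * (1/2) ^ i * c"
    using max_level(1) by (intro mult_right_mono sum_half_powers_le c0) simp
  finally show ?thesis .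
qed

end

section \<open>A lattice sum\<close>

text \<open>A product over the coordinates, so that lattice sums factorize. The exponent
  \<open>4/3 > 1\<close> is summable over the integers, and three such factors dominate the inverse
  fourth power of 1 plus the sup norm.\<close>

definition lattice_weight :: "int^3 \<Rightarrow> real" where
  "lattice_weight v = (\<Prod>i\<in>UNIV. (1 + \<bar>of_int (v $ i)\<bar>) powr (- 4/3))"

lemma lattice_weight_nonneg: "0 \<le> lattice_weight v"
  by (simp add: lattice_weight_def prod_nonneg)

lemma int_sum_bounded:
  "\<exists>c. \<forall>V. finite V \<longrightarrow> (\<Sum>v\<in>V. (1 + \<bar>real_of_int v\<bar>) powr (- 4/3)) \<le> c"
proof -
  let ?f = "\<lambda>k::nat. (1 + real k) powr (- 4/3)"
  have "summable (\<lambda>k. real (Suc k) powr (- 4/3))"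
    by (subst summable_Suc_iff) (simp add: summable_real_powr_iff)
  then have f: "summable ?f" by (simp add: add.commute)
  have half: "(\<Sum>v\<in>V. (1 + \<bar>real_of_int v\<bar>) powr (- 4/3)) \<le> suminf ?f"
    if "finite V" "inj_on (\<lambda>v. nat \<bar>v\<bar>) V" for V
  proof -
    have "(\<Sum>v\<in>V. (1 + \<bar>real_of_int v\<bar>) powr (- 4/3)) = (\<Sum>k\<in>(\<lambda>v. nat \<bar>v\<bar>) ` V. ?f k)"
      using that by (simp add: sum.reindex)
    also have "\<dots> \<le> suminf ?f" by (rule sum_le_suminf[OF f]) (use that in auto)
    finally show ?thesis .
  qed
  have "(\<Sum>v\<in>V. (1 + \<bar>real_of_int v\<bar>) powr (- 4/3)) \<le> suminf ?f + suminf ?f" if V: "finite V" for V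
  proof -
    have "(\<Sum>v\<in>V. (1 + \<bar>real_of_int v\<bar>) powr (- 4/3))
        = (\<Sum>v\<in>{v \<in> V. 0 \<le> v}. (1 + \<bar>real_of_int v\<bar>) powr (- 4/3)) + (\<Sum>v\<in>{v \<in> V. v < 0}. (1 + \<bar>real_of_int v\<bar>) powr (- 4/3))"
      using V by (subst sum.union_disjoint[symmetric]) (auto intro!: sum.cong)
    also have "\<dots> \<le> suminf ?f + suminf ?f"
      by (intro add_mono half) (use V in \<open>auto simp: inj_on_def\<close>)
    finally show ?thesis .
  qed
  then show ?thesis by blast
qed

text \<open>Enlarging the translated set to a box turns the sum into a product of three
  one-dimensional sums. Independence of the translation \<open>q\<close> is the source of uniformity
  in the positions of the electrons.\<close>

lemma lattice_sum_bounded: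
  "\<exists>c. \<forall>M q. finite M \<longrightarrow> (\<Sum>m\<in>M. lattice_weight (m - q)) \<le> c"
proof -
  let ?g = "\<lambda>v. (1 + \<bar>real_of_int v\<bar>) powr (- 4/3)"
  obtain c where c: "\<And>V. finite V \<Longrightarrow> (\<Sum>v\<in>V. ?g v) \<le> c" using int_sum_bounded by blast
  have "(\<Sum>m\<in>M. lattice_weight (m - q)) \<le> c ^ 3" if M: "finite M" for M and q :: "int^3"
  proof -
    let ?V = "\<lambda>i. (\<lambda>m. m $ i - q $ i) ` M"
    have "(\<Sum>m\<in>M. lattice_weight (m - q)) = (\<Sum>p\<in>(\<lambda>m. vec_nth (m - q)) ` M. \<Prod>i\<in>UNIV. ?g (p i))"
      by (subst sum.reindex) (auto simp: inj_on_def vec_eq_iff lattice_weight_def fun_eq_iff)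
    also have "\<dots> \<le> (\<Sum>p\<in>PiE UNIV ?V. \<Prod>i\<in>UNIV. ?g (p i))"
      by (rule sum_mono2) (use M in \<open>auto intro!: finite_PiE prod_nonneg\<close>)
    also have "\<dots> = (\<Prod>i\<in>UNIV. \<Sum>v\<in>?V i. ?g v)" using M by (subst prod_sum_PiE) auto
    also have "\<dots> \<le> (\<Prod>i\<in>(UNIV::3 set). c)" using M by (intro prod_mono conjI sum_nonneg c) auto
    finally show ?thesis by simp
  qed
  then show ?thesis by blast
qed

lemma inverse_fourth_power_le_lattice_weight:
  assumes "\<And>i. \<bar>v $ i\<bar> \<le> D"
  shows "1 / (1 + real_of_int D) ^ 4 \<le> lattice_weight v"
proof -
  have D: "0 \<le> D" using assms[of 1] by linarith
  have "1 / (1 + real_of_int D) ^ 4 = (1 + real_of_int D) powr (- 4)"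
    using D by (simp add: powr_minus_divide flip: powr_numeral)
  also have "\<dots> = ((1 + real_of_int D) powr (- 4/3)) ^ 3"
    using D by (simp add: powr_powr flip: powr_numeral)
  also have "\<dots> = (\<Prod>i\<in>(UNIV::3 set). (1 + real_of_int D) powr (- 4/3))" by simp
  also have "\<dots> \<le> lattice_weight v"
    unfolding lattice_weight_def
  proof (intro prod_mono conjI)
    fix i
    have "\<bar>real_of_int (v $ i)\<bar> \<le> real_of_int D" using assms[of i] by linarith
    then show "(1 + real_of_int D) powr (- 4/3) \<le> (1 + \<bar>real_of_int (v $ i)\<bar>) powr (- 4/3)"
      by (intro powr_mono2') auto
  qed simp
  finally show ?thesis .
qed

section \<open>Approximation of functions with cusps\<close>

lemma Basis_real_vec: "(Basis :: (real^3) set) = range (\<lambda>i. axis i 1)"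
  by (auto simp: Basis_vec_def)

lemma l1_norm_vec3: "l1_norm (x :: real^3) = (\<Sum>i\<in>UNIV. \<bar>x $ i\<bar>)"
proof -
  have "inj (\<lambda>i::3. axis i (1::real))" by (auto simp: inj_on_def axis_eq_axis)
  then show ?thesis
    unfolding l1_norm_def Basis_real_vec by (subst sum.reindex) (auto simp: inner_axis)
qed

lemma l1_norm_Pair:
  fixes y :: "'a::euclidean_space" and x :: "'b::euclidean_space"
  shows "l1_norm (y, x) = l1_norm y + l1_norm x"
proof -
  have "inj_on (\<lambda>u. (u, 0::'b)) (Basis :: 'a set)" "inj_on (\<lambda>u. (0::'a, u)) (Basis :: 'b set)"
    by (auto simp: inj_on_def)
  then show ?thesis
    unfolding l1_norm_def Basis_prod_def
    by (subst sum.union_disjoint) (auto simp: sum.reindex)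
qed

lemma l1_norm_nonneg: "0 \<le> l1_norm x"
  by (simp add: l1_norm_def sum_nonneg)

definition index_norm :: "int^3 \<Rightarrow> real" where
  "index_norm n = (\<Sum>i\<in>UNIV. \<bar>of_int (n $ i)\<bar>)"

text \<open>Interpolation nodes lie on the closed cube, which may leave the half-open cell, though
  only onto its upper faces.\<close>

lemma closed_cube_in_unit_cell:
  assumes sub: "dyadic_cube j m \<subseteq> cell n"
    and x: "x \<in> closed_cube (dyadic_corner j m) (1 / 2 ^ j)"
  shows "of_int (n $ i) \<le> x $ i \<and> x $ i \<le> of_int (n $ i) + 1"
proof -
  have "dyadic_corner j m \<in> cell n"
    using sub by (rule subsetD) (simp add: dyadic_cube_iff dyadic_corner_def)
  then have c: "real_of_int (n $ i) \<le> of_int (m $ i) / 2 ^ j" "of_int (m $ i) / 2 ^ j < real_of_int (n $ i) + 1"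
    by (auto simp: dyadic_cube_iff dyadic_corner_def)
  \<comment> \<open>Strict inequality between integers gains one full side of the subcube.\<close>
  have "real_of_int (m $ i) < real_of_int ((n $ i + 1) * 2 ^ j)" using c(2) by (simp add: field_simps)
  then have "m $ i + 1 \<le> (n $ i + 1) * 2 ^ j" by linarith
  then have "real_of_int (m $ i + 1) \<le> real_of_int ((n $ i + 1) * 2 ^ j)" by linarith
  then have "(real_of_int (m $ i) + 1) / 2 ^ j \<le> real_of_int (n $ i) + 1" by (simp add: field_simps)
  moreover have "of_int (m $ i) / 2 ^ j \<le> x $ i" "x $ i \<le> of_int (m $ i) / 2 ^ j + 1 / 2 ^ j"
    using x by (auto simp: closed_cube_def dyadic_corner_def)
  ultimately show ?thesis using c(1) by (simp add: add_divide_distrib)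
qed

lemma index_norm_le_l1_norm:
  fixes x :: "real^3"
  assumes "\<And>i. of_int (n $ i) \<le> x $ i \<and> x $ i \<le> of_int (n $ i) + 1"
  shows "index_norm n - 3 \<le> l1_norm x"
proof -
  have "index_norm n \<le> (\<Sum>i\<in>UNIV. \<bar>x $ i\<bar> + 1)"
    unfolding index_norm_def by (rule sum_mono) (use assms in \<open>smt (verit)\<close>)
  then show ?thesis by (simp add: l1_norm_vec3 sum.distrib)
qed

section \<open>Distances from cubes to the coalescence points\<close>

text \<open>Here \<open>None\<close> is the nucleus, whereas in \<open>electron\<close> it is the
  last electron; the option type indexes all possible cusps in the last variable.\<close>

definition center :: "(real^3)^'n::finite \<Rightarrow> 'n option \<Rightarrow> real^3" where
  "center y p = (case p of None \<Rightarrow> 0 | Some j \<Rightarrow> y $ j)"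

lemma coalescence_dist_eq: "coalescence_dist y x = Min (range (\<lambda>p. norm (x - center y p)))"
proof -
  have "range (\<lambda>p. norm (x - center y p)) = insert (norm x) (range (\<lambda>j. norm (x - y $ j)))"
    by (auto simp: UNIV_option_conv center_def image_iff)
  then show ?thesis by (simp add: coalescence_dist_def)
qed

lemma coalescence_dist_pos_iff: "coalescence_dist y x > 0 \<longleftrightarrow> (\<forall>p. x \<noteq> center y p)"
  unfolding coalescence_dist_eq by (subst Min_gr_iff) auto

lemma coalescence_dist_attained: "\<exists>p. coalescence_dist y x = norm (x - center y p)"
proof -
  have "Min (range (\<lambda>p. norm (x - center y p))) \<in> range (\<lambda>p. norm (x - center y p))"
    by (rule Min_in) auto
  then show ?thesis unfolding coalescence_dist_eq by (elim rangeE) (rule exI)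
qed

text \<open>The sup-norm distance, counted in sides, between the cube and the dyadic cube containing
  \<open>p\<close>. It depends only on a lattice difference, the form in which
  \<open>lattice_sum_bounded\<close> applies.\<close>

definition index_dist :: "nat \<Rightarrow> int^3 \<Rightarrow> real^3 \<Rightarrow> int" where
  "index_dist j m p = Max (range (\<lambda>i. \<bar>(m - dyadic_index j p) $ i\<bar>))"

lemma index_dist_ge: "\<bar>(m - dyadic_index j p) $ i\<bar> \<le> index_dist j m p"
  unfolding index_dist_def by (rule Max_ge) auto

lemma index_dist_nonneg: "0 \<le> index_dist j m p"
  using index_dist_ge[of m j p 1] by linarith

lemma index_dist_attained: "\<exists>i. index_dist j m p = \<bar>(m - dyadic_index j p) $ i\<bar>"
proof -
  have "index_dist j m p \<in> range (\<lambda>i. \<bar>(m - dyadic_index j p) $ i\<bar>)"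
    unfolding index_dist_def by (rule Max_in) auto
  then show ?thesis by auto
qed

text \<open>The loss of 1 accounts for the positions of \<open>x\<close> and \<open>p\<close> inside
  their cubes.\<close>

lemma dist_closed_cube_ge:
  assumes "x \<in> closed_cube (dyadic_corner j m) (1 / 2 ^ j)"
  shows "(of_int (index_dist j m p) - 1) / 2 ^ j \<le> norm (x - p)"
proof -
  obtain i where i: "index_dist j m p = \<bar>(m - dyadic_index j p) $ i\<bar>" using index_dist_attained by blast
  have x: "of_int (m $ i) \<le> 2 ^ j * x $ i" "2 ^ j * x $ i \<le> of_int (m $ i) + 1"
    using assms by (auto simp: closed_cube_def dyadic_corner_def field_simps)
  have p: "of_int (dyadic_index j p $ i) \<le> 2 ^ j * p $ i" "2 ^ j * p $ i \<le> of_int (dyadic_index j p $ i) + 1"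
    using of_int_floor_le[of "2 ^ j * p $ i"] real_of_int_floor_add_one_ge[of "2 ^ j * p $ i"]
    by (simp_all add: dyadic_index_def)
  have "of_int (index_dist j m p) - 1 \<le> \<bar>2 ^ j * x $ i - 2 ^ j * p $ i\<bar>"
    using x p unfolding i by simp
  also have "\<dots> = 2 ^ j * \<bar>(x - p) $ i\<bar>" by (simp add: abs_mult right_diff_distrib[symmetric])
  also have "\<dots> \<le> 2 ^ j * norm (x - p)" by (intro mult_left_mono component_le_norm_cart) simp
  finally show ?thesis by (simp add: field_simps)
qed

lemma partial_power_eq_partials: "(partial e ^^ k) f = partials (replicate k e) f"
  by (induction k) (simp_all add: partials_def)

section \<open>Interpolation error for a function with cusps\<close>

text \<open>One rate and one constant serve all orders; the instance is \<open>\<kappa> 3\<close>,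
  the slowest decay among orders 0, 1 and 3. Pure derivatives suffice since interpolation proceeds
  one variable at a time.\<close>

locale cusp_function =
  fixes \<psi> :: "'n::finite config \<Rightarrow> complex" and \<kappa> C :: real
  assumes kappa: "0 < \<kappa>" and C: "0 < C"
    and cont: "continuous_on UNIV \<psi>"
    and decay: "\<And>z. norm (\<psi> z) \<le> C * exp (- \<kappa> * l1_norm z)"
    and smooth: "\<And>y. smooth_on {x. coalescence_dist y x > 0} (\<lambda>x. \<psi> (y, x))"
    and first: "\<And>y x i. coalescence_dist y x > 0 \<Longrightarrow>
      norm (partial (axis i 1) (\<lambda>x. \<psi> (y, x)) x) \<le> C * exp (- \<kappa> * l1_norm (y, x))"
    and third: "\<And>y x i. coalescence_dist y x > 0 \<Longrightarrow>
      norm ((partial (axis i 1) ^^ 3) (\<lambda>x. \<psi> (y, x)) x) \<le> C * exp (- \<kappa> * l1_norm (y, x)) / (coalescence_dist y x)^2"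
begin

lemma differentiable_off_centers:
  assumes "coalescence_dist y x > 0"
  shows "(partial (axis i 1) ^^ k) (\<lambda>x. \<psi> (y, x)) differentiable (at x)"
proof -
  have "set (replicate k (axis i (1::real))) \<subseteq> Basis" by (auto simp: Basis_real_vec)
  then show ?thesis
    unfolding partial_power_eq_partials using smooth[of y] assms unfolding smooth_on_def by blast
qed

lemma continuous_section: "continuous_on UNIV (\<lambda>x. \<psi> (y, x))"
  by (rule continuous_on_compose2[OF cont]) (auto intro!: continuous_intros)

text \<open>A cube whose index distance to all centers is at least \<open>2\<close> is treated by the third derivative,
  all other cubes by the Lipschitz bound.\<close>
lemma cube_error:
  fixes y :: "(real^3)^'n"
  assumes L: "\<And>x. x \<in> closed_cube (dyadic_corner j m) (1 / 2 ^ j) \<Longrightarrow> L \<le> l1_norm x"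
    and x: "x \<in> closed_cube (dyadic_corner j m) (1 / 2 ^ j)"
  shows "norm (\<psi> (y, x) - interp3 (dyadic_corner j m) (1 / 2 ^ j) (\<lambda>x. \<psi> (y, x)) x)
    \<le> 468 * C * exp (- \<kappa> * (l1_norm y + L)) * (1 / 2 ^ j) *
      (\<Sum>p\<in>UNIV. 1 / (1 + real_of_int (index_dist j m (center y p)))^2)"
proof -
  let ?c = "dyadic_corner j m"
  let ?Q = "closed_cube (?c) (1 / 2 ^ j)" and ?D = "\<lambda>p. real_of_int (index_dist j m (center y p))"
  define h :: real where "h = 1 / 2 ^ j"
  have h: "0 < h" by (simp add: h_def)
  define B where "B = C * exp (- \<kappa> * (l1_norm y + L))"
  have B: "0 < B" using C by (simp add: B_def)
  have eB: "C * exp (- \<kappa> * l1_norm (y, x)) \<le> B" if "x \<in> ?Q" for x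
    unfolding B_def using L[OF that] kappa C by (intro mult_left_mono) (auto simp: l1_norm_Pair)
  let ?e = "\<lambda>x. \<psi> (y, x) - interp3 (?c) h (\<lambda>x. \<psi> (y, x)) x"
  have D0: "0 \<le> ?D p" for p using index_dist_nonneg by simp
  define \<Sigma> where "\<Sigma> = (\<Sum>p\<in>UNIV. 1 / (1 + ?D p)^2)"
  have member: "1 / (1 + ?D p)^2 \<le> \<Sigma>" for p
    unfolding \<Sigma>_def by (rule member_le_sum) auto
  have "norm (?e x) \<le> 468 * B * h * \<Sigma>"
  proof (cases "\<exists>p. index_dist j m (center y p) \<le> 1")
    case True
    then obtain p where "?D p \<le> 1" by auto
    then have "(1 + ?D p)^2 \<le> 2^2" using D0[of p] by (intro power_mono) auto
    then have "1 / 4 \<le> 1 / (1 + ?D p)^2" using D0[of p] by (intro divide_left_mono) auto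
    then have S: "1 / 4 \<le> \<Sigma>" using member[of p] by linarith
    have "norm (?e x) \<le> 13 * (4 * (h * B))"
    proof (rule interp3_error[OF h])
      fix i x assume x: "x \<in> closed_cube (?c) h"
      show "norm (\<psi> (y, x) - interp (?c) h i (\<lambda>x. \<psi> (y, x)) x) \<le> 4 * (h * B)"
      proof (rule interp_error_Lipschitz[OF h x _ continuous_section])
        show "finite (range (center y))" by simp
        fix x assume x: "x \<in> closed_cube (?c) h - range (center y)"
        then have pos: "coalescence_dist y x > 0" by (auto simp: coalescence_dist_pos_iff)
        show "(\<lambda>x. \<psi> (y, x)) differentiable (at x)" using differentiable_off_centers[OF pos, where k = 0] by simp
        show "norm (partial (axis i 1) (\<lambda>x. \<psi> (y, x)) x) \<le> B"
          using first[OF pos, of i] eB[of x] x by (auto simp: h_def)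
      qed (use B in simp)
    qed (use x in \<open>simp add: h_def\<close>)
    \<comment> \<open>\<open>13 * 4 = 208 / 4\<close>, prepared for the lower bound 1/4 of \<Sigma>;
      208 stays below the constant 468 of the other case.\<close>
    also have "\<dots> = 208 * (B * h) * (1 / 4)" by simp
    also have "\<dots> \<le> 468 * (B * h) * \<Sigma>" using B h S by (intro mult_mono) auto
    finally show ?thesis by (simp add: mult.assoc)
  next
    case False
    then have D2: "2 \<le> ?D p" for p by (metis not_less of_int_le_iff of_int_numeral one_less_numeral_iff semiring_norm(76) zle_add1_eq_le one_add_one linorder_not_le)
    define M where "M = B * (9 / h^2 * \<Sigma>)"
    have far: "coalescence_dist y x > 0" "1 / (coalescence_dist y x)^2 \<le> 9 / h^2 * \<Sigma>" if "x \<in> ?Q" for x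
    proof -
      obtain p where p: "coalescence_dist y x = norm (x - center y p)" using coalescence_dist_attained by blast
      have ge: "(?D p - 1) * h \<le> coalescence_dist y x"
        unfolding p using dist_closed_cube_ge[OF that, of "center y p"] by (simp add: h_def)
      \<comment> \<open>For \<open>D \<ge> 2\<close> the number \<open>D - 1\<close> is at least a
        third of \<open>1 + D\<close>; squared, this is the 9 in
        \<open>468 = 13 * 4 * 9\<close>.\<close>
      have third: "(1 + ?D p) / 3 * h \<le> (?D p - 1) * h" using D2[of p] h by (intro mult_right_mono) auto
      have pos: "0 < (1 + ?D p) / 3 * h" using D0[of p] h by (intro mult_pos_pos) auto
      have r: "(1 + ?D p) / 3 * h \<le> coalescence_dist y x" using ge third by linarith
      show posc: "coalescence_dist y x > 0" using r pos by linarith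
      have "1 / (coalescence_dist y x)^2 \<le> 1 / ((1 + ?D p) / 3 * h)^2"
        by (rule divide_left_mono[OF power_mono[OF r less_imp_le[OF pos]] _
              mult_pos_pos[OF zero_less_power[OF posc] zero_less_power[OF pos]]]) simp
      also have "\<dots> = 9 / h^2 * (1 / (1 + ?D p)^2)" by (simp add: power_mult_distrib power_divide)
      also have "\<dots> \<le> 9 / h^2 * \<Sigma>" by (intro mult_left_mono member) simp
      finally show "1 / (coalescence_dist y x)^2 \<le> 9 / h^2 * \<Sigma>" .
    qed
    have "norm (?e x) \<le> 13 * (4 * (h ^ 3 * M))"
    proof (rule interp3_error[OF h])
      fix i x assume x: "x \<in> closed_cube (?c) h"
      show "norm (\<psi> (y, x) - interp (?c) h i (\<lambda>x. \<psi> (y, x)) x) \<le> 4 * (h ^ 3 * M)"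
      proof (rule interp_error_third_derivative[OF h x])
        fix x assume "x \<in> closed_cube (?c) h"
        then have xQ: "x \<in> ?Q" by (simp add: h_def)
        show "(partial (axis i 1) ^^ k) (\<lambda>x. \<psi> (y, x)) differentiable (at x)" for k
          by (rule differentiable_off_centers[OF far(1)[OF xQ]])
        have "norm ((partial (axis i 1) ^^ 3) (\<lambda>x. \<psi> (y, x)) x)
            \<le> C * exp (- \<kappa> * l1_norm (y, x)) * (1 / (coalescence_dist y x)^2)"
          using third[OF far(1)[OF xQ], of i] by simp
        also have "\<dots> \<le> M" unfolding M_def using eB[OF xQ] far(2)[OF xQ] B by (intro mult_mono) auto
        finally show "norm ((partial (axis i 1) ^^ 3) (\<lambda>x. \<psi> (y, x)) x) \<le> M" .
      qed
    qed (use x in \<open>simp add: h_def\<close>)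
    also have "\<dots> = 468 * B * h * \<Sigma>" using h by (simp add: M_def power2_eq_square power3_eq_cube)
    finally show ?thesis .
  qed
  then show ?thesis by (simp add: B_def h_def \<Sigma>_def mult.assoc)
qed

text \<open>The Cauchy-Schwarz inequality over the centers produces inverse fourth powers and the
  factor \<open>CARD('n option)\<close>. Replacing \<open>l1_norm x\<close> by the index of the cell
  loses at most 1 per coordinate, hence \<open>exp (3 * \<kappa>)\<close> before squaring.\<close>

lemma cube_error_squared:
  fixes y :: "(real^3)^'n"
  assumes sub: "dyadic_cube j m \<subseteq> cell n" and x: "x \<in> dyadic_cube j m"
  shows "(norm (\<psi> (y, x) - interp3 (dyadic_corner j m) (1 / 2 ^ j) (\<lambda>x. \<psi> (y, x)) x))^2
    \<le> (468 * C * exp (3 * \<kappa>))^2 * CARD('n option) * exp (- 2 * \<kappa> * (l1_norm y + index_norm n)) * (1 / 2 ^ j)^2 *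
      (\<Sum>p\<in>UNIV. lattice_weight (m - dyadic_index j (center y p)))"
proof -
  let ?N = "real CARD('n option)"
  let ?D = "\<lambda>p. real_of_int (index_dist j m (center y p))"
  have "norm (\<psi> (y, x) - interp3 (dyadic_corner j m) (1 / 2 ^ j) (\<lambda>x. \<psi> (y, x)) x)
      \<le> 468 * C * exp (- \<kappa> * (l1_norm y + (index_norm n - 3))) * (1 / 2 ^ j) * (\<Sum>p\<in>UNIV. 1 / (1 + ?D p)^2)"
    by (rule cube_error[OF index_norm_le_l1_norm[OF closed_cube_in_unit_cell[OF sub]]])
       (use x dyadic_cube_subset_closed_cube in auto)
  then have "(norm (\<psi> (y, x) - interp3 (dyadic_corner j m) (1 / 2 ^ j) (\<lambda>x. \<psi> (y, x)) x))^2
      \<le> (468 * C * exp (- \<kappa> * (l1_norm y + (index_norm n - 3))) * (1 / 2 ^ j) * (\<Sum>p\<in>UNIV. 1 / (1 + ?D p)^2))^2"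
    by (rule power_mono) simp
  also have "\<dots> = (468 * C * exp (3 * \<kappa>))^2 * exp (- 2 * \<kappa> * (l1_norm y + index_norm n)) * (1 / 2 ^ j)^2 * (\<Sum>p\<in>UNIV. 1 / (1 + ?D p)^2)^2"
  proof -
    define E where "E = exp (- \<kappa> * (l1_norm y + index_norm n))"
    have 1: "exp (- \<kappa> * (l1_norm y + (index_norm n - 3))) = exp (3 * \<kappa>) * E"
      by (simp add: E_def exp_add[symmetric] algebra_simps)
    have 2: "exp (- 2 * \<kappa> * (l1_norm y + index_norm n)) = E^2"
      by (simp add: E_def exp_double[symmetric] algebra_simps)
    show ?thesis unfolding 1 2 by (simp only: power_mult_distrib mult.assoc)
  qed
  also have "\<dots> \<le> (468 * C * exp (3 * \<kappa>))^2 * exp (- 2 * \<kappa> * (l1_norm y + index_norm n)) * (1 / 2 ^ j)^2 *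
      (CARD('n option) * (\<Sum>p\<in>UNIV. lattice_weight (m - dyadic_index j (center y p))))"
  proof (intro mult_left_mono)
    have "(\<Sum>p\<in>UNIV. 1 / (1 + ?D p)^2)^2 \<le> (\<Sum>p\<in>UNIV. (1 / (1 + ?D p)^2)^2) * ?N"
      by (rule sum_squared_le_sum_of_squares)
    also have "\<dots> \<le> (\<Sum>p\<in>UNIV. lattice_weight (m - dyadic_index j (center y p))) * ?N"
    proof (intro mult_right_mono sum_mono)
      fix p
      have "(1 / (1 + ?D p)^2)^2 = 1 / (1 + ?D p) ^ 4" by (simp add: power_divide flip: power_mult)
      also have "\<dots> \<le> lattice_weight (m - dyadic_index j (center y p))"
        by (rule inverse_fourth_power_le_lattice_weight[OF index_dist_ge])
      finally show "(1 / (1 + ?D p)^2)^2 \<le> lattice_weight (m - dyadic_index j (center y p))" .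
    qed simp
    finally show "(\<Sum>p\<in>UNIV. 1 / (1 + ?D p)^2)^2 \<le> ?N * (\<Sum>p\<in>UNIV. lattice_weight (m - dyadic_index j (center y p)))"
      by (simp add: mult.commute)
  qed simp_all
  finally show ?thesis by (simp add: ac_simps)
qed

end

section \<open>Weights\<close>

lemma borel_imp_lebesgue_measurable: "f \<in> borel_measurable borel \<Longrightarrow> f \<in> borel_measurable lebesgue"
  by (simp add: measurable_completion)

lemma dyadic_cube_lebesgue [measurable]: "dyadic_cube j m \<in> sets lebesgue"
  using dyadic_cube_measurable[of j m] by (auto simp: sets_completionI_sets)

lemma nn_integral_exp_abs_finite:
  assumes c: "0 < c"
  shows "(\<integral>\<^sup>+t. ennreal (exp (- c * \<bar>t\<bar>)) \<partial>lborel) < \<infinity>"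
proof -
  let ?f = "\<lambda>t::real. ennreal (exp (- c * t)) * indicator {0..} t"
  have "(\<integral>\<^sup>+t. ?f t \<partial>lborel) = ennreal (0 - (- exp (- c * 0) / c))"
  proof (rule nn_integral_FTC_atLeast)
    show "((\<lambda>t. - exp (- c * t) / c) \<longlongrightarrow> 0) at_top"
      using c by real_asymp
  qed (use c in \<open>auto intro!: derivative_eq_intros\<close>)
  then have fin: "(\<integral>\<^sup>+t. ?f t \<partial>lborel) < \<infinity>" by simp
  have "(\<integral>\<^sup>+t. ?f t \<partial>lborel) = ennreal \<bar>-1\<bar> * (\<integral>\<^sup>+t. ?f (0 + (-1) * t) \<partial>lborel)"
    by (rule nn_integral_real_affine) auto
  then have fin': "(\<integral>\<^sup>+t. ?f (- t) \<partial>lborel) < \<infinity>" using fin by simp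
  have "(\<integral>\<^sup>+t. ennreal (exp (- c * \<bar>t\<bar>)) \<partial>lborel) \<le> (\<integral>\<^sup>+t. ?f t + ?f (- t) \<partial>lborel)"
    by (intro nn_integral_mono) (auto simp: indicator_def abs_if)
  also have "\<dots> = (\<integral>\<^sup>+t. ?f t \<partial>lborel) + (\<integral>\<^sup>+t. ?f (- t) \<partial>lborel)"
    by (rule nn_integral_add) auto
  also have "\<dots> < \<infinity>" using fin fin' by simp
  finally show ?thesis .
qed

lemma integrable_exp_l1_norm:
  assumes c: "0 < c"
  shows "integrable lebesgue (\<lambda>y::'a::euclidean_space. exp (- c * l1_norm y))"
proof -
  have meas: "(\<lambda>y::'a. exp (- c * l1_norm y)) \<in> borel_measurable borel"
    unfolding l1_norm_def by measurable
  have "(\<integral>\<^sup>+y. ennreal (exp (- c * l1_norm (y::'a))) \<partial>lborel)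
      = (\<integral>\<^sup>+y. (\<Prod>b\<in>Basis. ennreal (exp (- c * \<bar>(y::'a) \<bullet> b\<bar>))) \<partial>lborel)"
    by (intro nn_integral_cong) (simp add: l1_norm_def sum_distrib_left exp_sum prod_ennreal flip: sum_negf)
  also have "\<dots> = (\<Prod>b\<in>(Basis::'a set). (\<integral>\<^sup>+t. ennreal (exp (- c * \<bar>t\<bar>)) \<partial>lborel))"
    by (rule nn_integral_lborel_prod) auto
  also have "\<dots> < \<infinity>"
    using nn_integral_exp_abs_finite[OF c] by (simp add: power_less_top_ennreal)
  finally have "integrable lborel (\<lambda>y::'a. exp (- c * l1_norm y))"
    using meas by (intro integrableI_bounded) auto
  then show ?thesis using meas by (simp add: integrable_completion)
qed

lemma l1_norm_measurable [measurable]: "l1_norm \<in> borel_measurable borel"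
  unfolding l1_norm_def[abs_def] by measurable

lemma unit_cube_AE: "AE x in lebesgue. x \<in> cell n \<longleftrightarrow> x \<in> unit_cube n"
proof -
  have "negligible {x :: real^3. x $ i = of_int (n $ i)}" for i
  proof -
    have "{x :: real^3. x $ i = of_int (n $ i)} = {x. x \<bullet> axis i 1 = of_int (n $ i)}" by (simp add: inner_axis)
    also have "negligible \<dots>" by (rule negligible_standard_hyperplane) (simp add: Basis_real_vec)
    finally show ?thesis .
  qed
  then have "negligible (\<Union>i\<in>UNIV. {x :: real^3. x $ i = of_int (n $ i)})" by (intro negligible_Union) auto
  then have "(\<Union>i\<in>UNIV. {x :: real^3. x $ i = of_int (n $ i)}) \<in> null_sets lebesgue" by (simp add: negligible_iff_null_sets)
  then show ?thesis
  proof (rule AE_I')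
    show "{x \<in> space lebesgue. \<not> (x \<in> cell n \<longleftrightarrow> x \<in> unit_cube n)} \<subseteq> (\<Union>i\<in>UNIV. {x :: real^3. x $ i = of_int (n $ i)})"
      by (auto simp: dyadic_cube_iff unit_cube_def intro: less_imp_le) (metis order.not_eq_order_implies_strict)
  qed
qed

section \<open>Masses of unit cells\<close>

abbreviation density_on :: "int^3 \<Rightarrow> (real^3 \<Rightarrow> complex) \<Rightarrow> real^3 \<Rightarrow> ennreal" where
  "density_on n a x \<equiv> ennreal ((norm (a x))^2) * indicator (cell n) x"

abbreviation weight_sq :: "real \<Rightarrow> ('a::euclidean_space \<Rightarrow> complex) \<Rightarrow> 'a \<Rightarrow> real" where
  "weight_sq \<kappa> b y \<equiv> (norm (b y))^2 * exp (- 2 * \<kappa> * l1_norm y)"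

definition cell_mass :: "(real^3 \<Rightarrow> complex) \<Rightarrow> int^3 \<Rightarrow> real" where
  "cell_mass a n = (LINT x:unit_cube n|lebesgue. (norm (a x))^2)"

lemma cell_mass_nonneg: "0 \<le> cell_mass a n"
  unfolding cell_mass_def set_lebesgue_integral_def by (rule integral_nonneg_AE) simp

lemma nn_integral_cell:
  assumes a: "a \<in> L2_loc"
  shows "(\<integral>\<^sup>+x. density_on n a x \<partial>lebesgue) = ennreal (cell_mass a n)"
proof -
  have [measurable]: "a \<in> borel_measurable lebesgue" using a by (simp add: L2_loc_def)
  let ?K = "cbox (\<chi> i. of_int (n $ i)) (\<chi> i. of_int (n $ i) + 1) :: (real^3) set"
  have "set_integrable lebesgue ?K (\<lambda>x. (norm (a x))^2)" using a by (simp add: L2_loc_def)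
  then have int: "set_integrable lebesgue (cell n) (\<lambda>x. (norm (a x))^2)"
    by (rule set_integrable_subset) (auto simp: mem_box_cart dyadic_cube_iff less_imp_le)
  have "(\<integral>\<^sup>+x. density_on n a x \<partial>lebesgue)
      = (\<integral>\<^sup>+x. ennreal (indicator (cell n) x *\<^sub>R (norm (a x))^2) \<partial>lebesgue)"
    by (intro nn_integral_cong) (simp add: indicator_def)
  also have "\<dots> = ennreal (LINT x|lebesgue. indicator (cell n) x *\<^sub>R (norm (a x))^2)"
    by (rule nn_integral_eq_integral) (use int in \<open>auto simp: set_integrable_def\<close>)
  also have "(LINT x|lebesgue. indicator (cell n) x *\<^sub>R (norm (a x))^2) = cell_mass a n"
    unfolding cell_mass_def set_lebesgue_integral_def
  proof (rule integral_cong_AE)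
    show "AE x in lebesgue. indicator (cell n) x *\<^sub>R (norm (a x))^2 = indicat_real (unit_cube n) x *\<^sub>R (norm (a x))^2"
      using unit_cube_AE[of n] by (rule eventually_mono) (simp add: indicator_def)
    have "unit_cube n = box (\<chi> i. of_int (n $ i)) (\<chi> i. of_int (n $ i) + 1)"
      by (auto simp: unit_cube_def mem_box_cart)
    then have [measurable]: "unit_cube n \<in> sets lebesgue" by simp
    show "(\<lambda>x. indicat_real (unit_cube n) x *\<^sub>R (norm (a x))^2) \<in> borel_measurable lebesgue" by measurable
  qed measurable
  finally show ?thesis .
qed

lemma S_term_nonneg: "0 \<le> S_term q \<kappa> a n"
  by (simp add: S_term_def)

text \<open>\<open>8/3 = 2 / (3/4)\<close>: this power undoes the exponent 3/4 and leaves the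
  squared mass with its exponential factor.\<close>

lemma S_term_power:
  "S_term (3/4) \<kappa> a n powr (8/3) = exp (- 2 * \<kappa> * index_norm n) * cell_mass a n"
proof -
  have "S_term (3/4) \<kappa> a n = exp (- (3/4) * \<kappa> * index_norm n) * sqrt (cell_mass a n) powr (3/4)"
    by (simp add: S_term_def index_norm_def cell_mass_def)
  also have "\<dots> powr (8/3) = exp (- (3/4) * \<kappa> * index_norm n) powr (8/3) * (sqrt (cell_mass a n) powr (3/4)) powr (8/3)"
    by (rule powr_mult)
  also have "exp (- (3/4) * \<kappa> * index_norm n) powr (8/3) = exp (- 2 * \<kappa> * index_norm n)"
    by (simp add: powr_def)
  also have "(sqrt (cell_mass a n) powr (3/4)) powr (8/3) = sqrt (cell_mass a n) powr 2"
    by (simp add: powr_powr)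
  also have "\<dots> = cell_mass a n" using cell_mass_nonneg[of a n] by simp
  finally show ?thesis .
qed

lemma S_term_mono: "\<kappa>' \<le> \<kappa> \<Longrightarrow> 0 \<le> q \<Longrightarrow> S_term q \<kappa> a n \<le> S_term q \<kappa>' a n"
  unfolding S_term_def by (intro mult_right_mono) (auto intro!: mult_right_mono mult_left_mono sum_nonneg)

lemma nn_integral_count_space_infsum:
  fixes \<sigma> :: "'i \<Rightarrow> real"
  assumes "\<sigma> summable_on UNIV" "\<And>n. 0 \<le> \<sigma> n"
  shows "(\<integral>\<^sup>+n. ennreal (\<sigma> n) \<partial>count_space UNIV) = ennreal (infsum \<sigma> UNIV)"
proof -
  have "(\<lambda>n. norm (\<sigma> n)) summable_on UNIV" using assms by simp
  then have abs: "Infinite_Set_Sum.abs_summable_on \<sigma> UNIV" by (simp only: abs_summable_equivalent)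
  then have "(\<integral>\<^sup>+n. ennreal (\<sigma> n) \<partial>count_space UNIV) = ennreal (infsetsum \<sigma> UNIV)"
    unfolding infsetsum_def
    by (intro nn_integral_eq_integral) (use assms(2) in \<open>auto simp: Infinite_Set_Sum.abs_summable_on_def\<close>)
  then show ?thesis using infsetsum_infsum[OF abs] by simp
qed

text \<open>The cells partition the space, so the decomposition is Tonelli's theorem with the
  counting measure.\<close>

lemma nn_integral_le_sum_cells:
  fixes G :: "real^3 \<Rightarrow> ennreal" and \<sigma> :: "int^3 \<Rightarrow> real"
  assumes G [measurable]: "G \<in> borel_measurable lebesgue"
    and cell: "\<And>n. (\<integral>\<^sup>+x. G x * indicator (cell n) x \<partial>lebesgue) \<le> ennreal (X * \<sigma> n)"
    and \<sigma>: "\<sigma> summable_on UNIV" "\<And>n. 0 \<le> \<sigma> n" and X: "0 \<le> X"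
  shows "(\<integral>\<^sup>+x. G x \<partial>lebesgue) \<le> ennreal (X * infsum \<sigma> UNIV)"
proof -
  have ind: "(\<integral>\<^sup>+n. indicator (cell n) x \<partial>count_space UNIV) = (1::ennreal)" for x
  proof -
    have "(\<integral>\<^sup>+n. indicator (cell n) x \<partial>count_space UNIV)
        = (\<integral>\<^sup>+n. indicator {dyadic_index 0 x} n \<partial>count_space UNIV)"
      by (intro nn_integral_cong) (auto simp: dyadic_cube_def indicator_def)
    then show ?thesis by simp
  qed
  have "(\<integral>\<^sup>+x. G x \<partial>lebesgue) = (\<integral>\<^sup>+x. (\<integral>\<^sup>+n. G x * indicator (cell n) x \<partial>count_space UNIV) \<partial>lebesgue)"
    by (intro nn_integral_cong) (simp add: nn_integral_cmult ind)
  also have "\<dots> = (\<integral>\<^sup>+n. (\<integral>\<^sup>+x. G x * indicator (cell n) x \<partial>lebesgue) \<partial>count_space UNIV)"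
    by (rule nn_integral_count_space_nn_integral) (simp, measurable)
  also have "\<dots> \<le> (\<integral>\<^sup>+n. ennreal (X * \<sigma> n) \<partial>count_space UNIV)" by (intro nn_integral_mono cell)
  also have "\<dots> = ennreal (infsum (\<lambda>n. X * \<sigma> n) UNIV)"
    by (rule nn_integral_count_space_infsum) (use \<sigma> X in \<open>auto intro: summable_on_cmult_right\<close>)
  also have "infsum (\<lambda>n. X * \<sigma> n) UNIV = X * infsum \<sigma> UNIV"
    by (rule infsum_cmult_right) (use \<sigma> in auto)
  finally show ?thesis .
qed

section \<open>Weights on the remaining electrons\<close>

lemma Linf_norm_nonneg: "0 \<le> Linf_norm (b :: 'a::euclidean_space \<Rightarrow> complex)"
proof (cases "(\<lambda>y. ereal (norm (b y))) \<in> borel_measurable lebesgue")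
  case True
  have "esssup (lebesgue :: 'a measure) (\<lambda>y. 0::ereal) \<le> esssup lebesgue (\<lambda>y. ereal (norm (b y)))"
    by (rule esssup_mono) auto
  moreover have "esssup (lebesgue :: 'a measure) (\<lambda>y. 0::ereal) = 0"
    by (rule esssup_const) (simp add: emeasure_lborel_UNIV)
  ultimately show ?thesis by (simp add: Linf_norm_def)
next
  case False
  \<comment> \<open>\<open>esssup\<close> is infinite for functions that are not measurable.\<close>
  then show ?thesis by (simp add: Linf_norm_def esssup_non_measurable)
qed

lemma Linf_bound:
  assumes "b \<in> Linf"
  obtains B where "Linf_norm b = ereal B" "0 \<le> B" "AE y in lebesgue. norm (b y) \<le> B"
proof -
  obtain B where B: "Linf_norm b = ereal B" "0 \<le> B"
    using assms Linf_norm_nonneg[of b] by (cases "Linf_norm b") (auto simp: Linf_def)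
  have "AE y in lebesgue. ereal (norm (b y)) \<le> Linf_norm b" unfolding Linf_norm_def by (rule esssup_AE)
  then show ?thesis using that B by simp
qed

lemma Linf_weight_integrable:
  fixes b :: "(real^3)^'n::finite \<Rightarrow> complex"
  assumes b: "b \<in> Linf" and \<kappa>: "0 < \<kappa>"
  shows "integrable lebesgue (\<lambda>y. weight_sq \<kappa> b y)"
proof -
  obtain B where B: "0 \<le> B" "AE y in lebesgue. norm (b y) \<le> B" using Linf_bound[OF b] by metis
  have [measurable]: "b \<in> borel_measurable lebesgue" using b by (simp add: Linf_def)
  have e: "integrable lebesgue (\<lambda>y::(real^3)^'n. B^2 * exp (- 2 * \<kappa> * l1_norm y))"
    using integrable_exp_l1_norm[of "2 * \<kappa>", where 'a = "(real^3)^'n"] \<kappa> by simp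
  have [measurable]: "(\<lambda>y::(real^3)^'n. exp (- 2 * \<kappa> * l1_norm y)) \<in> borel_measurable lebesgue"
    by (rule borel_imp_lebesgue_measurable) measurable
  show ?thesis
  proof (rule Bochner_Integration.integrable_bound[OF e])
    show "AE y in lebesgue. norm (weight_sq \<kappa> b y) \<le> norm (B^2 * exp (- 2 * \<kappa> * l1_norm y))"
      using B(2) by (rule eventually_mono) (auto intro!: mult_right_mono power_mono)
  qed measurable
qed

lemma M_weight_nonneg: "0 \<le> M_weight \<kappa> b"
  by (simp add: M_weight_def integral_nonneg_AE)

lemma M_weight_power2: "(M_weight \<kappa> b)^2 = (LINT y|lebesgue. weight_sq \<kappa> b y)"
  by (simp add: M_weight_def integral_nonneg_AE)

lemma M_weight_mono:
  fixes b :: "(real^3)^'n::finite \<Rightarrow> complex"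
  assumes b: "b \<in> Linf" and "0 < \<kappa>'" "\<kappa>' \<le> \<kappa>"
  shows "M_weight \<kappa> b \<le> M_weight \<kappa>' b"
  unfolding M_weight_def
proof (intro real_sqrt_le_mono integral_mono Linf_weight_integrable b)
  fix y :: "(real^3)^'n"
  show "weight_sq \<kappa> b y \<le> weight_sq \<kappa>' b y"
    using assms(3) l1_norm_nonneg[of y] by (intro mult_left_mono) (auto intro: mult_right_mono)
qed (use assms in auto)

lemma M_weight_le_Linf_norm:
  fixes b :: "(real^3)^'n::finite \<Rightarrow> complex"
  assumes b: "b \<in> Linf" and \<kappa>: "0 < \<kappa>"
  shows "ereal (M_weight \<kappa> b) \<le> Linf_norm b * ereal (sqrt (LINT y|lebesgue. exp (- 2 * \<kappa> * l1_norm (y::(real^3)^'n))))"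
proof -
  obtain B where B: "Linf_norm b = ereal B" "0 \<le> B" "AE y in lebesgue. norm (b y) \<le> B" using Linf_bound[OF b] by metis
  have e: "integrable lebesgue (\<lambda>y::(real^3)^'n. exp (- 2 * \<kappa> * l1_norm y))"
    using integrable_exp_l1_norm[of "2 * \<kappa>", where 'a = "(real^3)^'n"] \<kappa> by simp
  have "(LINT y|lebesgue. weight_sq \<kappa> b y) \<le> (LINT y|lebesgue. B^2 * exp (- 2 * \<kappa> * l1_norm (y::(real^3)^'n)))"
    by (rule integral_mono_AE[OF Linf_weight_integrable[OF b \<kappa>]])
       (use e B(3) in \<open>auto elim!: eventually_mono intro!: mult_right_mono power_mono\<close>)
  also have "\<dots> = B^2 * (LINT y|lebesgue. exp (- 2 * \<kappa> * l1_norm (y::(real^3)^'n)))" by simp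
  finally have "M_weight \<kappa> b \<le> sqrt (B^2 * (LINT y|lebesgue. exp (- 2 * \<kappa> * l1_norm (y::(real^3)^'n))))"
    unfolding M_weight_def by (rule real_sqrt_le_mono)
  then show ?thesis using B by (simp add: real_sqrt_mult)
qed

section \<open>Approximation on a unit cell\<close>

text \<open>The level at which cubes have side about \<open>k powr (-1/3)\<close>. With
  \<open>q = k powr (4/3)\<close> both terms of \<open>card_stop_cubes\<close> are then of order
  \<open>k\<close>.\<close>

lemma ex_power_8:
  assumes "(1::real) \<le> k"
  obtains i where "8 ^ i \<le> 8 * k" "k powr (4/3) * (1/2) ^ i \<le> k" "(1/2) ^ i \<le> k powr (- 1/3)"
proof -
  obtain j where j: "k < 8 ^ j" using real_arch_pow[of 8 k] by auto
  define i where "i = (LEAST i. k \<le> 8 ^ i)"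
  have i: "k \<le> 8 ^ i" unfolding i_def by (rule LeastI[of "\<lambda>i. k \<le> 8 ^ i" j]) (use j in simp)
  have "8 ^ i \<le> 8 * k"
  proof (cases i)
    case 0 then show ?thesis using assms by simp
  next
    case (Suc l)
    then have "\<not> k \<le> 8 ^ l" using not_less_Least[of l "\<lambda>i. k \<le> 8 ^ i"] by (simp add: i_def)
    then show ?thesis using Suc by simp
  qed
  moreover have half: "(1/2) ^ i \<le> k powr (- 1/3)"
  proof -
    have "k powr (1/3) \<le> (8 ^ i) powr (1/3)" using i assms by (intro powr_mono2) auto
    also have "(8::real) ^ i = (2 ^ i) ^ 3"
      by (simp add: power_mult[symmetric] mult.commute[of i]) (simp add: power_mult)
    also have "((2::real) ^ i) ^ 3 = (2 ^ i) powr 3" by (simp add: powr_numeral)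
    also have "((2 ^ i) powr 3) powr (1/3) = (2 ^ i :: real)" by (subst powr_powr) simp
    finally have "1 / 2 ^ i \<le> 1 / k powr (1/3)" using assms by (intro divide_left_mono) auto
    then show ?thesis using assms by (simp add: powr_minus_divide power_divide)
  qed
  moreover have "k powr (4/3) * (1/2) ^ i \<le> k"
  proof -
    have "k powr (4/3) * (1/2) ^ i \<le> k powr (4/3) * k powr (- 1/3)" by (intro mult_left_mono half) simp
    also have "\<dots> = k" using assms by (simp flip: powr_add)
    finally show ?thesis .
  qed
  ultimately show ?thesis using that by blast
qed

lemma interp_weight_measurable [measurable]: "(\<lambda>x. interp_weight c h p x) \<in> borel_measurable borel"
proof -
  have lagrange: "continuous_on UNIV (lagrange s)" for s
    unfolding lagrange_def by (cases "s = 0"; cases "s = 1") (auto intro!: continuous_intros)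
  show ?thesis
    unfolding interp_weight_def case_prod_unfold divide_inverse
    by (intro borel_measurable_continuous_onI continuous_intros continuous_on_compose2[OF lagrange]) auto
qed

lemma abs_interp_weight_le:
  assumes "0 < h" "x \<in> closed_cube c h"
  shows "\<bar>interp_weight c h p x\<bar> \<le> 1"
proof -
  have "\<bar>a * b * d\<bar> \<le> 1" if "\<bar>a\<bar> \<le> 1" "\<bar>b\<bar> \<le> 1" "\<bar>d\<bar> \<le> 1" for a b d :: real
    using that by (simp add: abs_mult mult_le_one)
  then show ?thesis
    unfolding interp_weight_def case_prod_unfold using abs_lagrange_le[OF closed_cube_scaled[OF assms]] by blast
qed

context cusp_function
begin

text \<open>The functions \<open>g i\<close> do not depend on \<open>y\<close>, and the error bound
  holds for every \<open>y\<close> rather than on average. \<open>648 = 27 * 24\<close> counts 27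
  nodes in each of at most \<open>24 * k\<close> cubes.\<close>

definition cell_approximant ::
    "real \<Rightarrow> real \<Rightarrow> (real^3 \<Rightarrow> complex) \<Rightarrow> int^3 \<Rightarrow> ((nat \<times> (int^3)) \<times> node) set \<Rightarrow>
     ((nat \<times> (int^3)) \<times> node \<Rightarrow> (real^3)^'n \<Rightarrow> complex) \<Rightarrow>
     ((nat \<times> (int^3)) \<times> node \<Rightarrow> real^3 \<Rightarrow> complex) \<Rightarrow> bool" where
  "cell_approximant A k a n I f g \<longleftrightarrow> finite I \<and> real (card I) \<le> 648 * k \<and>
     (\<forall>i\<in>I. g i \<in> borel_measurable borel \<and> (\<forall>x. norm (g i x) \<le> indicator (cell n) x)) \<and>
     (\<forall>y. (\<integral>\<^sup>+x. ennreal ((norm (\<psi> (y, x) - (\<Sum>i\<in>I. f i y * g i x)))^2) * density_on n a x \<partial>lebesgue)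
        \<le> ennreal (A * exp (- 2 * \<kappa> * (l1_norm y + index_norm n)) * k powr (- 5/3) * cell_mass a n))"

text \<open>The piecewise interpolant lives on the stopping cubes at which mass times side drops below
  \<open>k powr (-4/3)\<close> times the mass of the cell, starting from side about \<open>k powr (-1/3)\<close>.\<close>
lemma cell_approximation:
  "\<exists>A>0. \<forall>n k a. 1 \<le> k \<longrightarrow> a \<in> L2_loc \<longrightarrow> (\<exists>I f g. cell_approximant A k a n I f g)"
proof -
  let ?N = "real CARD('n option)"
  obtain c where c: "\<And>M q. finite M \<Longrightarrow> (\<Sum>m\<in>M. lattice_weight (m - q)) \<le> c"
    using lattice_sum_bounded by blast
  define A0 where "A0 = (468 * C * exp (3 * \<kappa>))^2 * ?N"
  have A0: "0 \<le> A0" by (simp add: A0_def)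
  have c0: "0 \<le> c" using c[of "{}"] by simp
  \<comment> \<open>\<open>A0\<close> comes from the squared error on one cube,
    \<open>?N * c\<close> from the lattice sums around all centers, 2 from the geometric series;
    adding 1 ensures positivity.\<close>
  define A where "A = A0 * (?N * (2 * c)) + 1"
  have A: "0 < A" using A0 c0 by (simp add: A_def add_nonneg_pos)
  have "\<exists>I f g. cell_approximant A k a n I f g" if k: "1 \<le> k" and loc: "a \<in> L2_loc"
    for n and k :: real and a :: "real^3 \<Rightarrow> complex"
  proof -
    define tot where "tot = cell_mass a n"
    have tot: "0 \<le> tot" by (simp add: tot_def cell_mass_nonneg)
    have a [measurable]: "a \<in> borel_measurable lebesgue" using loc by (simp add: L2_loc_def)
    have int: "(\<integral>\<^sup>+x. density_on n a x \<partial>lebesgue) = ennreal tot" unfolding tot_def by (rule nn_integral_cell[OF loc])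
    obtain i where i: "8 ^ i \<le> 8 * k" "k powr (4/3) * (1/2) ^ i \<le> k" "(1/2) ^ i \<le> k powr (- 1/3)"
      using ex_power_8[OF k] by blast
    define w where "w x = density_on n a x" for x
    have w [measurable]: "w \<in> borel_measurable lebesgue" unfolding w_def by measurable
    \<comment> \<open>Against this measure an error bound that is constant on each cube integrates
      to a finite sum of cube masses.\<close>
    define \<nu> where "\<nu> = density lebesgue w"
    have sets [measurable_cong]: "sets \<nu> = sets lebesgue" by (simp add: \<nu>_def)
    have em_cube: "emeasure \<nu> (cell n) = ennreal tot"
    proof -
      have "emeasure \<nu> (cell n) = (\<integral>\<^sup>+x. w x * indicator (cell n) x \<partial>lebesgue)"
        unfolding \<nu>_def by (rule emeasure_density) measurable
      also have "\<dots> = (\<integral>\<^sup>+x. w x \<partial>lebesgue)"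
        by (intro nn_integral_cong) (simp add: w_def indicator_def)
      finally show ?thesis using int by (simp add: w_def[abs_def])
    qed
    interpret \<nu>: finite_measure \<nu>
    proof
      have "emeasure \<nu> (space \<nu>) = (\<integral>\<^sup>+x. w x \<partial>lebesgue)"
        unfolding \<nu>_def by (subst emeasure_density) (measurable, auto intro!: nn_integral_cong)
      then show "emeasure \<nu> (space \<nu>) \<noteq> \<infinity>" using int by (simp add: w_def[abs_def])
    qed
    define q where "q = k powr (4/3)"
    define \<theta> where "\<theta> = measure \<nu> (cell n) / q"
    have q: "1 \<le> q" unfolding q_def using k by (intro ge_one_powr_ge_zero) auto
    interpret dyadic_stopping \<nu> n q i \<theta>
      by unfold_locales (use q in \<open>simp_all add: sets \<theta>_def\<close>)
    have mtot: "measure \<nu> (cell n) = tot" using em_cube tot by (simp add: measure_def)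
    have finG: "finite family" by (rule finite_stop_cubes)
    let ?h = "\<lambda>Q::nat \<times> (int^3). 1 / 2 ^ fst Q :: real" and ?c = "\<lambda>Q. dyadic_corner (fst Q) (snd Q)"
    define I where "I = family \<times> interp_nodes"
    define f where "f = (\<lambda>(Q, p) y. \<psi> (y, interp_node (?c Q) (?h Q) p))"
    define g where "g = (\<lambda>(Q, p) x. indicator (dyadic_cube (fst Q) (snd Q)) x *\<^sub>R complex_of_real (interp_weight (?c Q) (?h Q) p x))"
    have finI: "finite I" by (simp add: I_def finG finite_interp_nodes)
    have cardI: "real (card I) \<le> 648 * k"
    proof -
      have "real (card family) \<le> 8 ^ i + 16 * q * (1/2) ^ i" by (rule card_stop_cubes)
      also have "\<dots> \<le> 8 * k + 16 * k" using i(1,2) unfolding q_def by (intro add_mono) auto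
      finally show ?thesis by (simp add: I_def card_cartesian_product card_interp_nodes)
    qed
    have gprop: "g e \<in> borel_measurable borel \<and> (\<forall>x. norm (g e x) \<le> indicator (cell n) x)" if "e \<in> I" for e
    proof
      obtain Q p where e: "e = (Q, p)" by (cases e)
      have Q: "(fst Q, snd Q) \<in> family" using that by (simp add: I_def e)
      note [measurable] = dyadic_cube_measurable
      show "g e \<in> borel_measurable borel" unfolding g_def e by simp
      show "\<forall>x. norm (g e x) \<le> indicator (cell n) x"
      proof
        fix x
        show "norm (g e x) \<le> indicator (cell n) x"
        proof (cases "x \<in> dyadic_cube (fst Q) (snd Q)")
          case True
          then have "x \<in> cell n" using stop_cubes_level(5)[OF Q] by blast
          moreover have "\<bar>interp_weight (?c Q) (?h Q) p x\<bar> \<le> 1"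
            using True dyadic_cube_subset_closed_cube by (intro abs_interp_weight_le) auto
          ultimately show ?thesis using True by (simp add: g_def e)
        qed (simp add: g_def e)
      qed
    qed
    have F: "(\<Sum>e\<in>I. f e y * g e x) = interp3 (?c Q) (?h Q) (\<lambda>x. \<psi> (y, x)) x"
      if "x \<in> cell n" "Q = (level x, dyadic_index (level x) x)" for y x Q
    proof -
      have "(\<Sum>e\<in>I. f e y * g e x)
          = (\<Sum>Q\<in>family. indicator (dyadic_cube (fst Q) (snd Q)) x *\<^sub>R interp3 (?c Q) (?h Q) (\<lambda>x. \<psi> (y, x)) x)"
        unfolding I_def interp3_eq_sum sum.cartesian_product'
        by (simp add: f_def g_def scaleR_sum_right mult.commute mult.left_commute)
      also have "\<dots> = interp3 (?c Q) (?h Q) (\<lambda>x. \<psi> (y, x)) x"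
        unfolding that(2) by (rule sum_stop_cubes_indicator[OF that(1)])
      finally show ?thesis .
    qed
    have main: "(\<integral>\<^sup>+x. ennreal ((norm (\<psi> (y, x) - (\<Sum>e\<in>I. f e y * g e x)))^2) * w x \<partial>lebesgue)
          \<le> ennreal (A * exp (- 2 * \<kappa> * (l1_norm y + index_norm n)) * k powr (- 5/3) * tot)" for y
    proof -
      let ?m = "\<lambda>Q. measure \<nu> (dyadic_cube (fst Q) (snd Q))" and ?i = "\<lambda>Q. indicator (dyadic_cube (fst Q) (snd Q)) :: real^3 \<Rightarrow> ennreal"
      let ?e = "\<lambda>x. \<psi> (y, x) - (\<Sum>e\<in>I. f e y * g e x)"
      define E where "E = exp (- 2 * \<kappa> * (l1_norm y + index_norm n))"
      define \<omega> where "\<omega> j m = (\<Sum>p\<in>UNIV. lattice_weight (m - dyadic_index j (center y p)))" for j m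
      have \<omega>: "0 \<le> \<omega> j m" for j m unfolding \<omega>_def by (intro sum_nonneg lattice_weight_nonneg)
      have \<omega>_sum: "(\<Sum>m\<in>M. \<omega> j m) \<le> ?N * c" if "finite M" for j M
        unfolding \<omega>_def by (subst sum.swap) (rule sum_bounded_above, rule c[OF that])
      define e2 where "e2 Q = A0 * E * (?h Q)^2 * \<omega> (fst Q) (snd Q)" for Q
      have e2: "0 \<le> e2 Q" for Q unfolding e2_def E_def using A0 \<omega> by simp
      \<comment> \<open>All cubes are summed although only one contains \<open>x\<close>: a finite
        sum of indicators is evidently measurable, and measurability of \<open>level\<close> need
        not be discussed.\<close>
      have ptw: "ennreal ((norm (?e x))^2) * w x
          \<le> w x * (\<Sum>Q\<in>family. ennreal (e2 Q) * ?i Q x)" for x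
      proof (cases "x \<in> cell n")
        case True
        define Q where "Q = (level x, dyadic_index (level x) x)"
        have QG: "Q \<in> family" using True by (auto simp: stop_cubes_def Q_def)
        have xQ: "x \<in> dyadic_cube (fst Q) (snd Q)" by (simp add: Q_def)
        have "(norm (?e x))^2 \<le> e2 Q"
          unfolding F[OF True Q_def] e2_def A0_def E_def \<omega>_def
          by (rule cube_error_squared[OF stop_cubes_level(5) xQ]) (use QG in simp)
        then have "ennreal ((norm (?e x))^2) \<le> ennreal (e2 Q) * ?i Q x"
          using xQ by (simp add: ennreal_leI)
        also have "\<dots> \<le> (\<Sum>Q\<in>family. ennreal (e2 Q) * ?i Q x)"
          by (rule member_le_sum[OF QG]) (use finG in auto)
        finally show ?thesis by (subst mult.commute) (rule mult_left_mono, auto)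
      qed (simp add: w_def)
      have "(\<integral>\<^sup>+x. ennreal ((norm (?e x))^2) * w x \<partial>lebesgue)
          \<le> (\<integral>\<^sup>+x. w x * (\<Sum>Q\<in>family. ennreal (e2 Q) * ?i Q x) \<partial>lebesgue)"
        by (rule nn_integral_mono) (rule ptw)
      also have "\<dots> = (\<integral>\<^sup>+x. (\<Sum>Q\<in>family. ennreal (e2 Q) * ?i Q x) \<partial>\<nu>)"
        unfolding \<nu>_def by (rule nn_integral_density[symmetric]) measurable
      also have "\<dots> = (\<Sum>Q\<in>family. ennreal (e2 Q) * emeasure \<nu> (dyadic_cube (fst Q) (snd Q)))"
        by (subst nn_integral_sum) (measurable, auto intro!: sum.cong nn_integral_cmult_indicator simp: sets)
      also have "\<dots> = ennreal (\<Sum>Q\<in>family. e2 Q * ?m Q)"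
        by (simp add: \<nu>.emeasure_eq_measure ennreal_mult[symmetric] e2 sum_ennreal)
      also have "\<dots> \<le> ennreal (A * E * k powr (- 5/3) * tot)"
      proof (rule ennreal_leI)
        have "(\<Sum>Q\<in>family. e2 Q * ?m Q)
            \<le> (\<Sum>Q\<in>family. A0 * E * \<theta> * ((1/2) ^ fst Q * \<omega> (fst Q) (snd Q)))"
        proof (rule sum_mono)
          fix Q assume "Q \<in> family"
          then have "?m Q \<le> \<theta> * 2 ^ fst Q"
            using stop_cubes_level(4)[of "fst Q" "snd Q"] by simp
          then have "e2 Q * ?m Q \<le> e2 Q * (\<theta> * 2 ^ fst Q)"
            by (rule mult_left_mono) (rule e2)
          \<comment> \<open>The squared side in \<open>e2\<close> times the mass bound
            \<open>\<theta> * 2 ^ j\<close> leaves \<theta> times one side.\<close>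
          also have "\<dots> = A0 * E * \<theta> * ((1/2) ^ fst Q * \<omega> (fst Q) (snd Q))"
            by (simp add: e2_def power2_eq_square power_divide)
          finally show "e2 Q * ?m Q \<le> A0 * E * \<theta> * ((1/2) ^ fst Q * \<omega> (fst Q) (snd Q))" .
        qed
        also have "\<dots> = A0 * E * \<theta> * (\<Sum>Q\<in>family. (1/2) ^ fst Q * \<omega> (fst Q) (snd Q))"
          by (rule sum_distrib_left[symmetric])
        also have "\<dots> \<le> A0 * E * \<theta> * (2 * (1/2) ^ i * (?N * c))"
          using A0 theta_nonneg by (intro mult_left_mono sum_stop_cubes_le \<omega>_sum \<omega>) (simp_all add: E_def)
        also have "\<dots> \<le> A0 * E * \<theta> * (2 * k powr (- 1/3) * (?N * c))"
          using A0 theta_nonneg c0 i(3) by (intro mult_left_mono mult_right_mono) (simp_all add: E_def)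
        \<comment> \<open>The exponent \<open>-4/3\<close> comes from \<theta>, the exponent
          \<open>-1/3\<close> from the initial side.\<close>
        also have "\<dots> = (A0 * (?N * (2 * c))) * (E * (k powr (- 4/3) * k powr (- 1/3)) * tot)"
          using k by (simp add: \<theta>_def mtot q_def powr_minus_divide)
        also have "k powr (- 4/3) * k powr (- 1/3) = k powr (- 5/3)" by (simp flip: powr_add)
        also have "(A0 * (?N * (2 * c))) * (E * k powr (- 5/3) * tot) \<le> A * (E * k powr (- 5/3) * tot)"
          using tot by (intro mult_right_mono) (simp_all add: A_def E_def)
        finally show "(\<Sum>Q\<in>family. e2 Q * ?m Q) \<le> A * E * k powr (- 5/3) * tot"
          by (simp add: mult.assoc)
      qed
      finally show ?thesis by (simp add: E_def)
    qed
    show ?thesis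
      unfolding cell_approximant_def using finI cardI gprop main unfolding w_def tot_def
      by (intro exI[of _ I] exI[of _ f] exI[of _ g]) blast
  qed
  then show ?thesis using A by (intro exI[of _ A]) blast
qed

end

section \<open>The singular value estimate\<close>

context cusp_function
begin

section \<open>The weighted kernel as a Hilbert-Schmidt kernel\<close>

definition weighted_kernel :: "((real^3)^'n \<Rightarrow> complex) \<Rightarrow> (real^3 \<Rightarrow> complex) \<Rightarrow> (real^3)^'n \<Rightarrow> real^3 \<Rightarrow> complex" where
  "weighted_kernel b a y x = b y * \<psi> (y, x) * a x"

lemma psi_measurable: "\<psi> \<in> borel_measurable borel"
  by (rule borel_measurable_continuous_onI[OF cont])

lemma weighted_kernel_measurable:
  assumes [measurable]: "b \<in> borel_measurable lebesgue" "a \<in> borel_measurable lebesgue"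
  shows "(\<lambda>(y, x). weighted_kernel b a y x) \<in> borel_measurable lebesgue2"
    "(\<lambda>(x, y). cnj (weighted_kernel b a y x)) \<in> borel_measurable lebesgue2"
proof -
  \<comment> \<open>\<psi> is Borel, while \<open>a\<close> and \<open>b\<close> are only Lebesgue
    measurable; these identity maps let \<psi> be composed with the coordinates without leaving the
    product sigma-algebra \<open>lebesgue2\<close>.\<close>
  have id1 [measurable]: "(\<lambda>x. x) \<in> lebesgue \<rightarrow>\<^sub>M (borel :: ((real^3)^'n) measure)"
    and id2 [measurable]: "(\<lambda>x. x) \<in> lebesgue \<rightarrow>\<^sub>M (borel :: (real^3) measure)"
    by (simp_all add: borel_imp_lebesgue_measurable)
  note [measurable] = psi_measurable measurable_compose[OF measurable_fst id1] measurable_compose[OF measurable_snd id2]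
    measurable_compose[OF measurable_snd id1] measurable_compose[OF measurable_fst id2]
  have "(\<lambda>p. b (fst p) * \<psi> (fst p, snd p) * a (snd p)) \<in> borel_measurable lebesgue2"
    by measurable
  then show "(\<lambda>(y, x). weighted_kernel b a y x) \<in> borel_measurable lebesgue2"
    by (simp add: weighted_kernel_def case_prod_unfold)
  have "(\<lambda>p. cnj (b (snd p) * \<psi> (snd p, fst p) * a (fst p))) \<in> borel_measurable lebesgue2"
    by measurable
  then show "(\<lambda>(x, y). cnj (weighted_kernel b a y x)) \<in> borel_measurable lebesgue2"
    by (simp add: weighted_kernel_def case_prod_unfold)
qed

lemma exp_l1_norm_on_cell:
  assumes "x \<in> cell n"
  shows "exp (- 2 * \<kappa> * l1_norm x) \<le> exp (6 * \<kappa>) * exp (- 2 * \<kappa> * index_norm n)"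
proof -
  have "index_norm n - 3 \<le> l1_norm x"
    by (rule index_norm_le_l1_norm) (use assms in \<open>auto simp: dyadic_cube_iff less_imp_le\<close>)
  then have "2 * \<kappa> * (index_norm n - 3) \<le> 2 * \<kappa> * l1_norm x" using kappa by (intro mult_left_mono) auto
  then show ?thesis by (simp add: exp_add[symmetric] algebra_simps)
qed

lemma norm_weighted_kernel_power2:
  "(norm (weighted_kernel b a y x))^2
    \<le> C^2 * (weight_sq \<kappa> b y) * (weight_sq \<kappa> a x)"
proof -
  have "(norm (\<psi> (y, x)))^2 \<le> (C * exp (- \<kappa> * l1_norm (y, x)))^2"
    by (intro power_mono decay) simp
  also have "\<dots> = C^2 * (exp (- 2 * \<kappa> * l1_norm y) * exp (- 2 * \<kappa> * l1_norm x))"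
    by (simp add: power_mult_distrib l1_norm_Pair exp_add[symmetric] exp_double[symmetric] algebra_simps)
  finally have "(norm (b y))^2 * (norm (\<psi> (y, x)))^2 * (norm (a x))^2
      \<le> (norm (b y))^2 * (C^2 * (exp (- 2 * \<kappa> * l1_norm y) * exp (- 2 * \<kappa> * l1_norm x))) * (norm (a x))^2"
    by (intro mult_right_mono mult_left_mono) auto
  then show ?thesis by (simp add: weighted_kernel_def norm_mult power_mult_distrib ac_simps)
qed

lemma S_term_le_infsum:
  assumes "S_finite q \<kappa> a"
  shows "S_term q \<kappa> a n \<le> infsum (S_term q \<kappa> a) UNIV"
  using finite_sum_le_infsum[of "S_term q \<kappa> a" UNIV "{n}"] assms S_term_nonneg[of q \<kappa> a]
  by (simp add: S_finite_def)

text \<open>\<open>8/3 = 5/3 + 1\<close>, and one power is kept so that the bound can be summed over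
  the cells. The value \<open>s\<close> will be the whole sum, for integrability, and the whole sum
  divided by \<open>k\<close>, for discarded cells.\<close>

lemma S_term_power_le:
  assumes "S_term (3/4) \<kappa> a n \<le> s"
  shows "S_term (3/4) \<kappa> a n powr (8/3) \<le> s powr (5/3) * S_term (3/4) \<kappa> a n"
proof -
  let ?\<sigma> = "S_term (3/4) \<kappa> a n"
  have "?\<sigma> powr (8/3) = ?\<sigma> powr (5/3) * ?\<sigma> powr 1" by (subst powr_add[symmetric]) simp
  also have "\<dots> \<le> s powr (5/3) * ?\<sigma>"
    using assms S_term_nonneg[of "3/4" \<kappa> a n] by (simp, intro mult_right_mono powr_mono2) auto
  finally show ?thesis .
qed

lemma nn_integral_weight_cell:
  assumes a: "a \<in> L2_loc"
  shows "(\<integral>\<^sup>+x. ennreal (weight_sq \<kappa> a x) * indicator (cell n) x \<partial>lebesgue)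
    \<le> ennreal (exp (6 * \<kappa>) * S_term (3/4) \<kappa> a n powr (8/3))"
proof -
  let ?X = "exp (6 * \<kappa>) * exp (- 2 * \<kappa> * index_norm n)"
  have [measurable]: "a \<in> borel_measurable lebesgue" using a by (simp add: L2_loc_def)
  have "ennreal (weight_sq \<kappa> a x) * indicator (cell n) x \<le> ennreal ?X * density_on n a x" for x
  proof (cases "x \<in> cell n")
    case True
    have "weight_sq \<kappa> a x \<le> (norm (a x))^2 * ?X"
      by (intro mult_left_mono exp_l1_norm_on_cell[OF True]) simp
    then show ?thesis using True by (simp add: ennreal_leI ennreal_mult[symmetric] ac_simps)
  qed simp
  then have "(\<integral>\<^sup>+x. ennreal (weight_sq \<kappa> a x) * indicator (cell n) x \<partial>lebesgue)
      \<le> (\<integral>\<^sup>+x. ennreal ?X * density_on n a x \<partial>lebesgue)"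
    by (intro nn_integral_mono)
  also have "\<dots> = ennreal ?X * ennreal (cell_mass a n)"
    by (subst nn_integral_cmult) (measurable, simp add: nn_integral_cell[OF a])
  also have "\<dots> = ennreal (?X * cell_mass a n)" by (simp add: ennreal_mult cell_mass_nonneg)
  finally show ?thesis by (simp add: S_term_power mult.assoc)
qed

lemma nn_integral_weighted_kernel_cell:
  assumes a: "a \<in> L2_loc"
  shows "(\<integral>\<^sup>+x. density_on n (weighted_kernel b a y) x \<partial>lebesgue)
    \<le> ennreal (C^2 * exp (6 * \<kappa>) * weight_sq \<kappa> b y * S_term (3/4) \<kappa> a n powr (8/3))"
proof -
  have [measurable]: "a \<in> borel_measurable lebesgue" using a by (simp add: L2_loc_def)
  have [measurable]: "(\<lambda>x::real^3. exp (- 2 * \<kappa> * l1_norm x)) \<in> borel_measurable lebesgue"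
    by (rule borel_imp_lebesgue_measurable) measurable
  have "(\<integral>\<^sup>+x. density_on n (weighted_kernel b a y) x \<partial>lebesgue)
      \<le> (\<integral>\<^sup>+x. ennreal (C^2 * weight_sq \<kappa> b y) * (ennreal (weight_sq \<kappa> a x) * indicator (cell n) x) \<partial>lebesgue)"
  proof (intro nn_integral_mono)
    fix x
    show "density_on n (weighted_kernel b a y) x
        \<le> ennreal (C^2 * weight_sq \<kappa> b y) * (ennreal (weight_sq \<kappa> a x) * indicator (cell n) x)"
      using ennreal_leI[OF norm_weighted_kernel_power2[of b a y x]]
      by (cases "x \<in> cell n") (simp_all add: ennreal_mult)
  qed
  also have "\<dots> = ennreal (C^2 * weight_sq \<kappa> b y) * (\<integral>\<^sup>+x. ennreal (weight_sq \<kappa> a x) * indicator (cell n) x \<partial>lebesgue)"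
    by (rule nn_integral_cmult) measurable
  also have "\<dots> \<le> ennreal (C^2 * weight_sq \<kappa> b y) * ennreal (exp (6 * \<kappa>) * S_term (3/4) \<kappa> a n powr (8/3))"
    by (intro mult_left_mono nn_integral_weight_cell[OF a]) simp
  also have "\<dots> = ennreal (C^2 * weight_sq \<kappa> b y * (exp (6 * \<kappa>) * S_term (3/4) \<kappa> a n powr (8/3)))"
    by (rule ennreal_mult[symmetric]) simp_all
  finally show ?thesis by (simp add: ac_simps)
qed

lemma weight_sq_integrable:
  assumes a: "a \<in> L2_loc" and S: "S_finite (3/4) \<kappa> a"
  shows "integrable lebesgue (weight_sq \<kappa> a)"
proof (rule integrableI_bounded)
  let ?S = "infsum (S_term (3/4) \<kappa> a) UNIV"
  have sum: "S_term (3/4) \<kappa> a summable_on UNIV" using S by (simp add: S_finite_def)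
  have [measurable]: "a \<in> borel_measurable lebesgue" using a by (simp add: L2_loc_def)
  have [measurable]: "(\<lambda>x::real^3. exp (- 2 * \<kappa> * l1_norm x)) \<in> borel_measurable lebesgue"
    by (rule borel_imp_lebesgue_measurable) measurable
  show meas: "weight_sq \<kappa> a \<in> borel_measurable lebesgue" by measurable
  have "(\<integral>\<^sup>+x. ennreal (weight_sq \<kappa> a x) \<partial>lebesgue) \<le> ennreal (exp (6 * \<kappa>) * ?S powr (5/3) * ?S)"
  proof (rule nn_integral_le_sum_cells[OF _ _ sum S_term_nonneg])
    fix n
    have "exp (6 * \<kappa>) * S_term (3/4) \<kappa> a n powr (8/3) \<le> exp (6 * \<kappa>) * (?S powr (5/3) * S_term (3/4) \<kappa> a n)"
      by (intro mult_left_mono S_term_power_le S_term_le_infsum[OF S]) simp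
    then show "(\<integral>\<^sup>+x. ennreal (weight_sq \<kappa> a x) * indicator (cell n) x \<partial>lebesgue)
        \<le> ennreal (exp (6 * \<kappa>) * ?S powr (5/3) * S_term (3/4) \<kappa> a n)"
      by (intro order_trans[OF nn_integral_weight_cell[OF a] ennreal_leI]) (simp add: mult.assoc)
  qed (use meas in simp_all)
  then show "(\<integral>\<^sup>+x. ennreal (norm (weight_sq \<kappa> a x)) \<partial>lebesgue) < \<infinity>"
    by (simp add: order.strict_trans1)
qed

lemma nn_integral_scaled:
  assumes "integrable M f" "\<And>x. 0 \<le> f x" "0 \<le> c" "\<And>x. h x \<le> c * f x"
  shows "(\<integral>\<^sup>+x. ennreal (h x) \<partial>M) \<le> ennreal (c * (LINT x|M. f x))"
proof -
  have "(\<integral>\<^sup>+x. ennreal (h x) \<partial>M) \<le> (\<integral>\<^sup>+x. ennreal (c * f x) \<partial>M)"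
    by (intro nn_integral_mono ennreal_leI assms(4))
  also have "\<dots> = ennreal (LINT x|M. c * f x)"
    by (rule nn_integral_eq_integral) (use assms in auto)
  finally show ?thesis by simp
qed

text \<open>The decay of \<psi> splits into factors in \<open>y\<close> and in \<open>x\<close>, so
  the kernel is dominated by a product of two integrable weights. The second kernel is that of the
  adjoint.\<close>

lemma hs_kernel_weighted_kernel:
  assumes b: "b \<in> Linf" and a: "a \<in> L2_loc" and S: "S_finite (3/4) \<kappa> a"
  shows "hs_kernel (weighted_kernel b a) (\<lambda>y. C^2 * weight_sq \<kappa> b y * (LINT x|lebesgue. weight_sq \<kappa> a x))"
    and "hs_kernel (\<lambda>x y. cnj (weighted_kernel b a y x)) (\<lambda>x. C^2 * weight_sq \<kappa> a x * (LINT y|lebesgue. weight_sq \<kappa> b y))"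
proof -
  have mb: "b \<in> borel_measurable lebesgue" and ma: "a \<in> borel_measurable lebesgue"
    using b a by (simp_all add: Linf_def L2_loc_def)
  note ia = weight_sq_integrable[OF a S] and ib = Linf_weight_integrable[OF b kappa]
  have le: "(norm (weighted_kernel b a y x))^2 \<le> C^2 * weight_sq \<kappa> a x * weight_sq \<kappa> b y" for x y
    using norm_weighted_kernel_power2[of b a y x] by (simp add: ac_simps)
  have "sq_mass (weighted_kernel b a y)
      \<le> ennreal (C^2 * weight_sq \<kappa> b y * (LINT x|lebesgue. weight_sq \<kappa> a x))" for y
    by (rule nn_integral_scaled[OF ia]) (use norm_weighted_kernel_power2 in auto)
  then show "hs_kernel (weighted_kernel b a) (\<lambda>y. C^2 * weight_sq \<kappa> b y * (LINT x|lebesgue. weight_sq \<kappa> a x))"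
    unfolding hs_kernel_def using weighted_kernel_measurable(1)[OF mb ma] ib
    by (auto intro!: mult_nonneg_nonneg integral_nonneg_AE)
  have "sq_mass (\<lambda>y. cnj (weighted_kernel b a y x))
      \<le> ennreal (C^2 * weight_sq \<kappa> a x * (LINT y|lebesgue. weight_sq \<kappa> b y))" for x
    by (rule nn_integral_scaled[OF ib]) (use le in auto)
  then show "hs_kernel (\<lambda>x y. cnj (weighted_kernel b a y x)) (\<lambda>x. C^2 * weight_sq \<kappa> a x * (LINT y|lebesgue. weight_sq \<kappa> b y))"
    unfolding hs_kernel_def using weighted_kernel_measurable(2)[OF mb ma] ia
    by (auto intro!: mult_nonneg_nonneg integral_nonneg_AE)
qed

section \<open>Distribution of the rank over the unit cells\<close>

text \<open>A cell with term \<sigma> receives the parameter \<open>k * \<sigma> / S\<close> if this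
  is at least 1, and is approximated by zero otherwise; the parameters add up to at most
  \<open>k\<close>. Up to constants a kept cell has the error \<open>(k * \<sigma> / S) powr (-5/3)
  * \<sigma> powr (8/3) = (S / k) powr (5/3) * \<sigma>\<close>, and a discarded one, where
  \<open>\<sigma> \<le> S / k\<close>, obeys the same bound. Summation over the cells gives
  \<open>S powr (8/3) * k powr (-5/3)\<close>. Rank \<open>648 * k\<close> costs
  \<open>1296 * k\<close> exceptional vectors.\<close>

lemma weighted_kernel_approximation:
  "\<exists>A>0. \<forall>b a k. b \<in> Linf \<longrightarrow> a \<in> L2_loc \<longrightarrow> S_finite (3/4) \<kappa> a \<longrightarrow> 0 < k \<longrightarrow>
     (\<exists>W. real (card W) \<le> 1296 * k \<and> small_on_complement (kernel_op (weighted_kernel b a)) W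
        (A * infsum (S_term (3/4) \<kappa> a) UNIV powr (8/3) * k powr (- 5/3) * (M_weight \<kappa> b)^2))"
proof -
  obtain A1 where A1: "0 < A1" and cells: "\<And>n k a. 1 \<le> k \<Longrightarrow> a \<in> L2_loc \<Longrightarrow> \<exists>I f g. cell_approximant A1 k a n I f g"
    using cell_approximation by blast
  \<comment> \<open>\<open>A1\<close> serves the kept cells; the other summand serves the discarded
    ones, where only the decay of \<psi> enters.\<close>
  define A' where "A' = A1 + C^2 * exp (6 * \<kappa>)"
  have A': "0 < A'" using A1 by (simp add: A'_def add_pos_nonneg)
  have "\<exists>W. real (card W) \<le> 1296 * k \<and> small_on_complement (kernel_op (weighted_kernel b a)) W
        (2 * A' * infsum (S_term (3/4) \<kappa> a) UNIV powr (8/3) * k powr (- 5/3) * (M_weight \<kappa> b)^2)"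
    if b: "b \<in> Linf" and a: "a \<in> L2_loc" and Sfin: "S_finite (3/4) \<kappa> a" and k: "0 < k" for b a k
  proof -
    define \<sigma> where "\<sigma> = S_term (3/4) \<kappa> a"
    define S where "S = infsum \<sigma> UNIV"
    define w where "w y = weight_sq \<kappa> b y" for y
    have w0: "0 \<le> w y" for y by (simp add: w_def)
    have \<sigma>0: "0 \<le> \<sigma> n" for n by (simp add: \<sigma>_def S_term_nonneg)
    have sum: "\<sigma> summable_on UNIV" using Sfin by (simp add: S_finite_def \<sigma>_def)
    have S0: "0 \<le> S" unfolding S_def by (rule infsum_nonneg) (simp add: \<sigma>0)
    have \<sigma>S: "\<sigma> n \<le> S" for n unfolding \<sigma>_def S_def by (rule S_term_le_infsum[OF Sfin])
    have partial_sum: "sum \<sigma> F \<le> S" if "finite F" for F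
      unfolding S_def by (rule finite_sum_le_infsum[OF sum that]) (auto simp: \<sigma>0)
    have ma [measurable]: "a \<in> borel_measurable lebesgue" using a by (simp add: L2_loc_def)
    \<comment> \<open>Positivity of the term makes a difference only if \<open>S = 0\<close>, where
      it makes \<open>B\<close> empty.\<close>
    define B where "B = {n. 0 < \<sigma> n \<and> S \<le> k * \<sigma> n}"
    have Spos: "0 < S" if "n \<in> B" for n using that \<sigma>S[of n] by (simp add: B_def)
    \<comment> \<open>More than \<open>k\<close> such cells would have terms adding up to more than
      \<open>S\<close>.\<close>
    have finB: "finite B"
    proof (rule ccontr)
      assume "infinite B"
      then obtain F where F: "finite F" "card F = nat \<lceil>k\<rceil> + 1" "F \<subseteq> B"
        using infinite_arbitrarily_large by blast
      then obtain n where "n \<in> F" by fastforce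
      then have pos: "0 < S" using F(3) Spos by blast
      have "real (card F) * S = (\<Sum>n\<in>F. S)" by simp
      also have "\<dots> \<le> (\<Sum>n\<in>F. k * \<sigma> n)" by (rule sum_mono) (use F(3) in \<open>auto simp: B_def\<close>)
      also have "\<dots> = k * sum \<sigma> F" by (rule sum_distrib_left[symmetric])
      also have "\<dots> \<le> k * S" using k partial_sum[OF F(1)] by (intro mult_left_mono) auto
      finally have "real (card F) \<le> k" using pos by simp
      then show False unfolding F(2) by linarith
    qed
    have "\<forall>n\<in>B. \<exists>I f g. cell_approximant A1 (k * \<sigma> n / S) a n I f g"
    proof
      fix n assume n: "n \<in> B"
      show "\<exists>I f g. cell_approximant A1 (k * \<sigma> n / S) a n I f g"
        by (rule cells[OF _ a]) (use n Spos[OF n] in \<open>simp add: B_def\<close>)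
    qed
    then obtain I f g where P: "\<And>n. n \<in> B \<Longrightarrow> cell_approximant A1 (k * \<sigma> n / S) a n (I n) (f n) (g n)" by metis
    have finI: "finite (I n)" and cardI: "real (card (I n)) \<le> 648 * (k * \<sigma> n / S)" if "n \<in> B" for n
      using P[OF that] by (simp_all add: cell_approximant_def)
    have g_meas: "g n i \<in> borel_measurable lebesgue" and g_le: "norm (g n i x) \<le> indicator (cell n) x"
      if "n \<in> B" "i \<in> I n" for n i x
      using P[OF that(1)] that(2) by (auto simp: cell_approximant_def intro: borel_imp_lebesgue_measurable)
    define II where "II = (SIGMA n:B. I n)"
    define ff where "ff = (\<lambda>(n, i) y. b y * f n i y)"
    define gg where "gg = (\<lambda>(n, i) x. g n i x * a x)"
    have finII: "finite II" unfolding II_def using finB finI by (rule finite_SigmaI)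
    have cardII: "real (card II) \<le> 648 * k"
    proof (cases "B = {}")
      case True then show ?thesis using k by (simp add: II_def)
    next
      case False
      then have pos: "0 < S" using Spos by blast
      have "real (card II) = (\<Sum>n\<in>B. real (card (I n)))"
        unfolding II_def using finB finI by (subst card_SigmaI) auto
      also have "\<dots> \<le> (\<Sum>n\<in>B. 648 * k / S * \<sigma> n)" by (rule sum_mono) (use cardI in \<open>simp add: mult.assoc\<close>)
      also have "\<dots> = 648 * k / S * sum \<sigma> B" by (rule sum_distrib_left[symmetric])
      also have "\<dots> \<le> 648 * k / S * S" using k pos partial_sum[OF finB] by (intro mult_left_mono) auto
      finally show ?thesis using pos by simp
    qed
    have gg_sq: "square_integrable (gg e)" if "e \<in> II" for e
    proof -
      have "e \<in> Sigma B I" using that by (simp only: II_def)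
      then obtain n i where e: "e = (n, i)" "n \<in> B" "i \<in> I n" by blast
      note [measurable] = g_meas[OF e(2,3)]
      have "sq_mass (\<lambda>x. g n i x * a x)
          \<le> (\<integral>\<^sup>+x. density_on n a x \<partial>lebesgue)"
      proof (rule nn_integral_mono)
        fix x
        show "ennreal ((norm (g n i x * a x))^2) \<le> density_on n a x"
          using g_le[OF e(2,3), of x]
          by (cases "x \<in> cell n") (auto simp: norm_mult power_mult_distrib intro!: ennreal_leI mult_left_le_one_le power_le_one)
      qed
      also have "\<dots> < \<infinity>" by (simp add: nn_integral_cell[OF a])
      finally show ?thesis
        unfolding gg_def e(1) by (subst square_integrable_iff_nn_integral) auto
    qed
    define G where "G y x = weighted_kernel b a y x - (\<Sum>e\<in>II. ff e y * gg e x)" for y x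
    note hs = hs_kernel_weighted_kernel(1)[OF b a Sfin]
    have G_meas [measurable]: "G y \<in> borel_measurable lebesgue" for y
    proof -
      have [measurable]: "weighted_kernel b a y \<in> borel_measurable lebesgue"
        using hs_kernel_row(1)[OF hs, of y] by (simp add: square_integrable_def)
      have "(\<lambda>x. \<Sum>e\<in>II. ff e y * gg e x) \<in> borel_measurable lebesgue"
      proof (intro borel_measurable_sum borel_measurable_times borel_measurable_const)
        show "gg e \<in> borel_measurable lebesgue" if "e \<in> II" for e
          using gg_sq[OF that] by (simp only: square_integrable_def)
      qed
      then show ?thesis unfolding G_def by measurable
    qed
    have sum_II: "(\<Sum>e\<in>II. ff e y * gg e x) = (if n \<in> B then b y * a x * (\<Sum>i\<in>I n. f n i y * g n i x) else 0)"
      if x: "x \<in> cell n" for y x n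
    proof -
      have "g m i x = 0" if "m \<in> B" "i \<in> I m" "m \<noteq> n" for m i
      proof -
        have "x \<notin> dyadic_cube 0 m" using x that(3) by (simp add: dyadic_cube_def)
        then show ?thesis using g_le[OF that(1,2), of x] by simp
      qed
      note zero = this
      have "(\<Sum>e\<in>II. ff e y * gg e x) = (\<Sum>(m, i)\<in>Sigma B I. b y * f m i y * (g m i x * a x))"
        unfolding II_def by (intro sum.cong refl) (simp add: ff_def gg_def case_prod_unfold)
      also have "\<dots> = (\<Sum>m\<in>B. \<Sum>i\<in>I m. b y * f m i y * (g m i x * a x))"
        by (rule sum.Sigma[symmetric]) (use finB finI in auto)
      also have "\<dots> = (\<Sum>m\<in>B. if m = n then (\<Sum>i\<in>I n. b y * f n i y * (g n i x * a x)) else 0)"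
      proof (rule sum.cong[OF refl])
        fix m assume "m \<in> B"
        then show "(\<Sum>i\<in>I m. b y * f m i y * (g m i x * a x))
            = (if m = n then (\<Sum>i\<in>I n. b y * f n i y * (g n i x * a x)) else 0)"
          using zero by (cases "m = n") simp_all
      qed
      also have "\<dots> = (if n \<in> B then (\<Sum>i\<in>I n. b y * f n i y * (g n i x * a x)) else 0)"
        using finB by simp
      also have "(\<Sum>i\<in>I n. b y * f n i y * (g n i x * a x)) = b y * a x * (\<Sum>i\<in>I n. f n i y * g n i x)"
        by (simp add: sum_distrib_left ac_simps)
      finally show ?thesis .
    qed
    let ?r = "(S / k) powr (5/3)"
    have rows: "sq_mass (G y) \<le> ennreal (A' * ?r * w y * S)" for y
    proof (rule nn_integral_le_sum_cells[OF _ _ sum \<sigma>0, folded S_def])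
      show "0 \<le> A' * ?r * w y" using A' w0 by simp
      fix n
      have "(\<integral>\<^sup>+x. density_on n (G y) x \<partial>lebesgue)
          \<le> ennreal (A' * w y * (?r * \<sigma> n))"
      proof (cases "n \<in> B")
        case True
        let ?e = "\<lambda>x. \<psi> (y, x) - (\<Sum>i\<in>I n. f n i y * g n i x)"
        have kn: "0 < k * \<sigma> n / S" and sn: "0 < \<sigma> n" using True Spos[OF True] k by (simp_all add: B_def)
        have [measurable]: "g n i \<in> borel_measurable lebesgue" if "i \<in> I n" for i
          by (rule g_meas[OF True that])
        have "(\<integral>\<^sup>+x. density_on n (G y) x \<partial>lebesgue)
            = (\<integral>\<^sup>+x. ennreal ((norm (b y))^2) * (ennreal ((norm (?e x))^2) *
                (density_on n a x)) \<partial>lebesgue)"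
        proof (rule nn_integral_cong)
          fix x
          show "density_on n (G y) x
            = ennreal ((norm (b y))^2) * (ennreal ((norm (?e x))^2) *
                (density_on n a x))"
          proof (cases "x \<in> cell n")
            case x: True
            have "G y x = b y * (?e x) * a x"
              unfolding G_def weighted_kernel_def sum_II[OF x] using True by (simp add: algebra_simps)
            then show ?thesis using x by (simp add: norm_mult power_mult_distrib ennreal_mult mult.assoc)
          qed simp
        qed
        also have "\<dots> = ennreal ((norm (b y))^2) * (\<integral>\<^sup>+x. ennreal ((norm (?e x))^2) *
                (density_on n a x) \<partial>lebesgue)"
        proof (rule nn_integral_cmult)
          have [measurable]: "(\<lambda>x. \<psi> (y, x)) \<in> borel_measurable lebesgue"
            by (intro borel_imp_lebesgue_measurable borel_measurable_continuous_onI continuous_section)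
          have [measurable]: "(\<lambda>x. \<Sum>i\<in>I n. f n i y * g n i x) \<in> borel_measurable lebesgue"
            by (rule borel_measurable_sum) measurable
          show "(\<lambda>x. ennreal ((norm (?e x))^2) *
                (density_on n a x)) \<in> borel_measurable lebesgue"
            by measurable
        qed
        also have "\<dots> \<le> ennreal ((norm (b y))^2) *
            ennreal (A1 * exp (- 2 * \<kappa> * (l1_norm y + index_norm n)) * (k * \<sigma> n / S) powr (- 5/3) * cell_mass a n)"
          using P[OF True] by (intro mult_left_mono) (auto simp: cell_approximant_def)
        also have "\<dots> = ennreal ((norm (b y))^2 *
            (A1 * exp (- 2 * \<kappa> * (l1_norm y + index_norm n)) * (k * \<sigma> n / S) powr (- 5/3) * cell_mass a n))"
          using A1 cell_mass_nonneg[of a n] by (simp add: ennreal_mult)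
        also have "(norm (b y))^2 * (A1 * exp (- 2 * \<kappa> * (l1_norm y + index_norm n)) * (k * \<sigma> n / S) powr (- 5/3) * cell_mass a n)
            = A1 * w y * ((k * \<sigma> n / S) powr (- 5/3) * \<sigma> n powr (8/3))"
          unfolding \<sigma>_def S_term_power w_def distrib_left exp_add by (simp only: ac_simps)
        also have "(k * \<sigma> n / S) powr (- 5/3) * \<sigma> n powr (8/3) = ?r * \<sigma> n"
        proof -
          have "(k * \<sigma> n / S) powr (- 5/3) = (S / k / \<sigma> n) powr (5/3)"
            by (simp add: powr_minus_divide powr_divide powr_mult)
          also have "\<dots> = ?r * \<sigma> n powr (- 5/3)"
              by (simp add: powr_divide powr_mult powr_minus_divide)
          also have "\<dots> * \<sigma> n powr (8/3) = ?r * \<sigma> n powr 1"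
            by (simp add: mult.assoc flip: powr_add)
          finally show ?thesis using sn by simp
        qed
        also have "ennreal (A1 * w y * (?r * \<sigma> n)) \<le> ennreal (A' * w y * (?r * \<sigma> n))"
          using w0 \<sigma>0 by (intro ennreal_leI mult_right_mono) (simp_all add: A'_def)
        finally show ?thesis .
      next
        case False
        have "\<sigma> n \<le> S / k \<or> \<sigma> n = 0" using False \<sigma>0[of n] k by (auto simp: B_def field_simps)
        then have "\<sigma> n powr (8/3) \<le> ?r * \<sigma> n"
          using S_term_power_le[of a n "S / k"] by (auto simp: \<sigma>_def)
        then have le: "C^2 * exp (6 * \<kappa>) * w y * \<sigma> n powr (8/3) \<le> C^2 * exp (6 * \<kappa>) * w y * (?r * \<sigma> n)"
          using w0 by (intro mult_left_mono) auto
        have "(\<integral>\<^sup>+x. density_on n (G y) x \<partial>lebesgue)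
            = (\<integral>\<^sup>+x. density_on n (weighted_kernel b a y) x \<partial>lebesgue)"
          by (intro nn_integral_cong) (use False in \<open>auto simp: G_def sum_II indicator_def\<close>)
        also have "\<dots> \<le> ennreal (C^2 * exp (6 * \<kappa>) * w y * \<sigma> n powr (8/3))"
          unfolding w_def \<sigma>_def by (rule nn_integral_weighted_kernel_cell[OF a])
        also have "\<dots> \<le> ennreal (C^2 * exp (6 * \<kappa>) * w y * (?r * \<sigma> n))" by (rule ennreal_leI[OF le])
        also have "\<dots> \<le> ennreal (A' * w y * (?r * \<sigma> n))"
          using w0 \<sigma>0 A1 by (intro ennreal_leI mult_right_mono) (simp_all add: A'_def)
        finally show ?thesis .
      qed
      then show "(\<integral>\<^sup>+x. density_on n (G y) x \<partial>lebesgue)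
          \<le> ennreal (A' * ?r * w y * \<sigma> n)" by (simp add: ac_simps)
    qed measurable
    have wint: "integrable lebesgue w" unfolding w_def by (rule Linf_weight_integrable[OF b kappa])
    have "\<exists>W. card W \<le> 2 * card II \<and> small_on_complement (kernel_op (weighted_kernel b a)) W
        (2 * (LINT y|lebesgue. A' * ?r * w y * S))"
    proof (rule small_on_complement_kernel_op[OF hs finII gg_sq _ rows])
      show "weighted_kernel b a y x = G y x + (\<Sum>e\<in>II. ff e y * gg e x)" for y x by (simp add: G_def)
      show "integrable lebesgue (\<lambda>y. A' * ?r * w y * S)"
        using wint by (intro integrable_mult_left integrable_mult_right)
      show "0 \<le> A' * ?r * w y * S" for y using A' w0 S0 by simp
    qed
    then obtain W where W: "card W \<le> 2 * card II" "small_on_complement (kernel_op (weighted_kernel b a)) W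
        (2 * (LINT y|lebesgue. A' * ?r * w y * S))" by blast
    have "(LINT y|lebesgue. A' * ?r * w y * S) = A' * (?r * S) * (LINT y|lebesgue. w y)"
      by (simp add: mult.assoc)
    also have "(LINT y|lebesgue. w y) = (M_weight \<kappa> b)^2" by (simp add: M_weight_power2 w_def)
    also have "?r * S = S powr (8/3) * k powr (- 5/3)"
    proof -
      have "?r * S = S powr (5/3) * S powr 1 * k powr (- 5/3)"
        using S0 k by (simp add: powr_divide powr_minus_divide)
      also have "S powr (5/3) * S powr 1 = S powr (8/3)" by (subst powr_add[symmetric]) simp
      finally show ?thesis .
    qed
    finally have eq: "2 * (LINT y|lebesgue. A' * ?r * w y * S)
        = 2 * A' * S powr (8/3) * k powr (- 5/3) * (M_weight \<kappa> b)^2" by (simp add: ac_simps)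
    have "real (card W) \<le> 1296 * k" using W(1) cardII by linarith
    then show ?thesis by (intro exI[of _ W] conjI W(2)[unfolded eq, unfolded S_def \<sigma>_def])
  qed
  note approx = this
  show ?thesis
    by (intro exI[of _ "2 * A'"] conjI allI impI approx) (use A' in simp)
qed

end

section \<open>Decay of the singular values\<close>

context cusp_function
begin

text \<open>With \<open>k = K / 2592\<close> there are at most \<open>K / 2\<close> exceptional
  vectors, so \<open>sing_val_le\<close> gives the square root of a multiple of
  \<open>K powr (-5/3) / K\<close>, which is of order \<open>K powr (-4/3)\<close>. Compactness
  follows from the same approximation as \<open>k\<close> tends to infinity.\<close>

lemma singular_value_bound:
  "\<exists>A>0. \<forall>b a. b \<in> Linf \<longrightarrow> a \<in> L2_loc \<longrightarrow> S_finite (3/4) \<kappa> a \<longrightarrow>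
     (\<exists>T. integral_operator (weighted_kernel b a) T \<and> compact_operator T \<and>
       (\<forall>K\<ge>1. 0 \<le> sing_val T K \<and>
         real K powr (1 / (3/4)) * sing_val T K \<le> A * (M_weight \<kappa> b * S_weight (3/4) \<kappa> a)))"
proof -
  obtain A where A: "0 < A" and approx: "\<And>b a k. b \<in> Linf \<Longrightarrow> a \<in> L2_loc \<Longrightarrow> S_finite (3/4) \<kappa> a \<Longrightarrow> 0 < k \<Longrightarrow>
     \<exists>W. real (card W) \<le> 1296 * k \<and> small_on_complement (kernel_op (weighted_kernel b a)) W
        (A * infsum (S_term (3/4) \<kappa> a) UNIV powr (8/3) * k powr (- 5/3) * (M_weight \<kappa> b)^2)"
    using weighted_kernel_approximation by blast
  \<comment> \<open>The 2 is lost in \<open>K - card W \<ge> K / 2\<close>, the power of 2592 in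
    rescaling \<open>k = K / 2592\<close>.\<close>
  define A2 where "A2 = sqrt (2 * A * 2592 powr (5/3))"
  have A2: "0 < A2" using A by (simp add: A2_def)
  have A2_sq: "A2^2 = 2 * A * 2592 powr (5/3)" using A by (simp add: A2_def)
  have "\<exists>T. integral_operator (weighted_kernel b a) T \<and> compact_operator T \<and>
       (\<forall>K\<ge>1. 0 \<le> sing_val T K \<and>
         real K powr (1 / (3/4)) * sing_val T K \<le> A2 * (M_weight \<kappa> b * S_weight (3/4) \<kappa> a))"
    if b: "b \<in> Linf" and a: "a \<in> L2_loc" and S: "S_finite (3/4) \<kappa> a" for b a
  proof -
    let ?T = "kernel_op (weighted_kernel b a)" and ?s = "infsum (S_term (3/4) \<kappa> a) UNIV" and ?M = "M_weight \<kappa> b"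
    have s0: "0 \<le> ?s" by (rule infsum_nonneg) (simp add: S_term_nonneg)
    note hs = hs_kernel_weighted_kernel(1)[OF b a S] and hs' = hs_kernel_weighted_kernel(2)[OF b a S]
    note lin = linear_kernel_op[OF hs] and adj = kernel_op_adjoint[OF hs hs']
    have "compact (closure (?T ` cball 0 1))"
    proof (rule compact_closure_image_ball[OF lin])
      fix \<epsilon> :: real assume \<epsilon>: "0 < \<epsilon>"
      have "((\<lambda>k::real. k powr (- 5/3)) \<longlongrightarrow> 0) at_top" by real_asymp
      then have "((\<lambda>k. A * ?s powr (8/3) * k powr (- 5/3) * ?M^2) \<longlongrightarrow> A * ?s powr (8/3) * 0 * ?M^2) at_top"
        by (intro tendsto_intros)
      then have "((\<lambda>k. A * ?s powr (8/3) * k powr (- 5/3) * ?M^2) \<longlongrightarrow> 0) at_top" by simp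
      then have "\<forall>\<^sub>F k in at_top. A * ?s powr (8/3) * k powr (- 5/3) * ?M^2 < \<epsilon>"
        using \<epsilon> by (rule order_tendstoD(2))
      then have "\<forall>\<^sub>F k in at_top. 0 < k \<and> A * ?s powr (8/3) * k powr (- 5/3) * ?M^2 < \<epsilon>"
        using eventually_gt_at_top[of "0::real"] by (rule eventually_conj[rotated])
      then obtain k where k: "0 < k" "A * ?s powr (8/3) * k powr (- 5/3) * ?M^2 < \<epsilon>"
        using eventually_happens'[OF trivial_limit_at_top_linorder] by blast
      then show "\<exists>W h. small_on_complement ?T W h \<and> h \<le> \<epsilon>"
        using approx[OF b a S k(1)] by (meson less_imp_le)
    qed
    then have comp: "compact_operator ?T"
      unfolding compact_operator_def using kernel_op_add[OF hs] kernel_op_scaleC[OF hs] by blast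
    have bound: "0 \<le> sing_val ?T K \<and> real K powr (1 / (3/4)) * sing_val ?T K \<le> A2 * (?M * S_weight (3/4) \<kappa> a)"
      if K: "1 \<le> K" for K
    proof -
      have Kpos: "0 < real K" using K by simp
      \<comment> \<open>The parameter \<open>K / 2592\<close> may be less than 1, which
        \<open>approx\<close> admits.\<close>
      obtain W where W: "real (card W) \<le> 1296 * (real K / 2592)"
        "small_on_complement ?T W (A * ?s powr (8/3) * (real K / 2592) powr (- 5/3) * ?M^2)"
        using approx[OF b a S, of "real K / 2592"] Kpos by auto
      let ?h = "A * ?s powr (8/3) * (real K / 2592) powr (- 5/3) * ?M^2"
      have half: "real (card W) \<le> real K / 2" using W(1) by simp
      then have less: "card W < K" using Kpos by linarith
      define R where "R = A2 * ?M * ?s powr (4/3) * real K powr (- 4/3)"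
      have R0: "0 \<le> R" unfolding R_def using A2 M_weight_nonneg[of \<kappa> b] by simp
      have R_sq: "R^2 = A2^2 * ?M^2 * ?s powr (8/3) * real K powr (- 8/3)"
      proof -
        have "(x powr p)^2 = x powr (2 * p)" for x p :: real
          by (simp add: power2_eq_square flip: powr_add)
        then show ?thesis by (simp add: R_def power_mult_distrib)
      qed
      have "?h / real (K - card W) \<le> ?h / (real K / 2)"
        using half less Kpos A by (intro divide_left_mono) (auto simp: of_nat_diff)
      also have "\<dots> = R^2"
      proof -
        have "(real K / 2592) powr (- 5/3) = 2592 powr (5/3) * real K powr (- 5/3)"
          by (simp add: powr_divide powr_minus_divide)
        moreover have "real K powr (- 8/3) = real K powr (- 5/3) / real K"
          using Kpos powr_add[of "real K" "- 5/3" "- 1"] by (simp add: powr_minus_divide)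
        ultimately show ?thesis unfolding R_sq A2_sq by simp
      qed
      finally have "sqrt (?h / real (K - card W)) \<le> sqrt (R^2)" by (rule real_sqrt_le_mono)
      then have le: "sing_val ?T K \<le> R"
        using sing_val_le(2)[OF lin adj W(2) less] R0 by simp
      have "real K powr (1 / (3/4)) * sing_val ?T K \<le> real K powr (4/3) * R"
        using le by (simp add: mult_left_mono)
      also have "\<dots> = A2 * (?M * ?s powr (4/3)) * (real K powr (4/3) * real K powr (- 4/3))"
        by (simp add: R_def)
      also have "real K powr (4/3) * real K powr (- 4/3) = 1" using Kpos by (simp flip: powr_add)
      finally show ?thesis using sing_val_le(1)[OF lin adj W(2) less] by (simp add: S_weight_def)
    qed
    show ?thesis
      by (intro exI[of _ ?T] conjI allI impI integral_operator_kernel_op[OF hs] comp) (use bound in auto)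
  qed
  note bound = this
  show ?thesis by (intro exI[of _ A2] conjI allI impI bound A2)
qed

end

section \<open>From the derivative bounds to the two estimates\<close>

lemma multi_partial_axis:
  "multi_partial (\<chi> j. if j = i then k else 0) f = (partial (axis i 1) ^^ k) f"
  using exhaust_3[of i] by (auto simp: multi_partial_def)

theorem theorem3p1:
  fixes \<psi> :: "'n::finite config \<Rightarrow> complex"
    and Z E :: real
    and \<kappa> :: "nat \<Rightarrow> real"
  assumes "Z > 0"
    and "eigenfunction Z E \<psi>"
    and "continuous_on UNIV \<psi>"
    and "\<And>l. \<kappa> l > 0" and "\<kappa> 0 = \<kappa> 1" and "decseq \<kappa>"
    and "\<exists>C\<^sub>0>0. \<forall>z. norm (\<psi> z) \<le> C\<^sub>0 * exp (- \<kappa> 0 * l1_norm z)"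
    and "\<And>y. smooth_on {x. coalescence_dist y x > 0} (\<lambda>x. \<psi> (y, x))"
    and "\<And>(m :: nat^3) l. l = (\<Sum>i\<in>UNIV. m $ i) \<Longrightarrow> l \<ge> 1 \<Longrightarrow>
           \<exists>C. \<forall>y x. coalescence_dist y x > 0 \<longrightarrow>
             norm (multi_partial m (\<lambda>x. \<psi> (y, x)) x)
               \<le> C * coalescence_dist y x powi (1 - int l) * exp (- \<kappa> l * l1_norm (y, x))"
  shows "\<exists>C>0. \<forall>(b :: (real^3)^'n \<Rightarrow> complex) (a :: real^3 \<Rightarrow> complex).
           b \<in> Linf \<longrightarrow> a \<in> L2_loc \<longrightarrow> S_finite (3/4) (\<kappa> 4) a \<longrightarrow>
           (\<exists>T. integral_operator (\<lambda>y x. b y * \<psi> (y, x) * a x) T \<and>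
                T \<in> weak_schatten (3/4) \<and>
                weak_schatten_norm (3/4) T
                  \<le> ereal C * Linf_norm b * ereal (S_weight (3/4) (\<kappa> 3) a) \<and>
                G_functional (3/4) T
                  \<le> C * (M_weight (\<kappa> 4) b * S_weight (3/4) (\<kappa> 4) a) powr (3/4))"
proof -
  obtain C0 where C0: "C0 > 0" "\<And>z. norm (\<psi> z) \<le> C0 * exp (- \<kappa> 0 * l1_norm z)" using assms(7) by blast
  have antimono: "\<kappa> j \<le> \<kappa> i" if "i \<le> j" for i j using assms(6) that by (rule decseqD)
  have ex: "\<exists>C. \<forall>i y x. coalescence_dist y x > 0 \<longrightarrow> norm ((partial (axis i 1) ^^ l) (\<lambda>x. \<psi> (y, x)) x)
      \<le> C * coalescence_dist y x powi (1 - int l) * exp (- \<kappa> l * l1_norm (y, x))" if l: "1 \<le> l" for l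
  proof -
    have "\<exists>C. \<forall>y x. coalescence_dist y x > 0 \<longrightarrow> norm ((partial (axis i 1) ^^ l) (\<lambda>x. \<psi> (y, x)) x)
      \<le> C * coalescence_dist y x powi (1 - int l) * exp (- \<kappa> l * l1_norm (y, x))" for i :: 3
      using assms(9)[of l "\<chi> j. if j = i then l else 0"] l by (simp add: multi_partial_axis)
    then obtain D where D: "\<And>i y x. coalescence_dist y x > 0 \<Longrightarrow> norm ((partial (axis i 1) ^^ l) (\<lambda>x. \<psi> (y, x)) x)
      \<le> D i * coalescence_dist y x powi (1 - int l) * exp (- \<kappa> l * l1_norm (y, x))" by metis
    \<comment> \<open>Summing absolute values gives one constant for all three directions, whatever
      the signs of the \<open>D i\<close>.\<close>
    have "norm ((partial (axis i 1) ^^ l) (\<lambda>x. \<psi> (y, x)) x)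
      \<le> (\<Sum>i\<in>UNIV. \<bar>D i\<bar>) * coalescence_dist y x powi (1 - int l) * exp (- \<kappa> l * l1_norm (y, x))"
      if pos: "coalescence_dist y x > 0" for i y x
    proof (rule order_trans[OF D[OF pos]], intro mult_right_mono)
      show "D i \<le> (\<Sum>i\<in>UNIV. \<bar>D i\<bar>)"
        using member_le_sum[of i UNIV "\<lambda>i. \<bar>D i\<bar>"] abs_ge_self[of "D i"] by auto
    qed (use pos in simp_all)
    then show ?thesis by blast
  qed
  obtain C1 where C1: "\<And>i y x. coalescence_dist y x > 0 \<Longrightarrow> norm ((partial (axis i 1) ^^ 1) (\<lambda>x. \<psi> (y, x)) x)
      \<le> C1 * coalescence_dist y x powi (1 - int 1) * exp (- \<kappa> 1 * l1_norm (y, x))" using ex[of 1] by auto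
  obtain C3 where C3: "\<And>i y x. coalescence_dist y x > 0 \<Longrightarrow> norm ((partial (axis i 1) ^^ 3) (\<lambda>x. \<psi> (y, x)) x)
      \<le> C3 * coalescence_dist y x powi (1 - int 3) * exp (- \<kappa> 3 * l1_norm (y, x))" using ex[of 3] by auto
  define C where "C = C0 + \<bar>C1\<bar> + \<bar>C3\<bar>"
  have C: "0 < C" "C0 \<le> C" "C1 \<le> C" "C3 \<le> C" using C0(1) by (auto simp: C_def)
  have exp_le: "exp (- \<kappa> l * l1_norm z) \<le> exp (- \<kappa> 3 * l1_norm z)" if "l \<le> 3" for l and z :: "'n config"
    using antimono[OF that] l1_norm_nonneg[of z] by (simp add: mult_right_mono)
  have scaled: "D * exp (- \<kappa> l * l1_norm z) \<le> C * exp (- \<kappa> 3 * l1_norm z)"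
    if "D \<le> C" "l \<le> 3" for D l and z :: "'n config"
    using that C(1) by (intro mult_mono exp_le) auto
  \<comment> \<open>The bounds of orders 0 and 1 decay at least as fast as with
    \<open>\<kappa> 3\<close>, so this rate is valid for all three.\<close>
  interpret cusp_function \<psi> "\<kappa> 3" C
  proof
    show "norm (\<psi> z) \<le> C * exp (- \<kappa> 3 * l1_norm z)" for z
      using C0(2)[of z] scaled[OF C(2), of 0 z] by simp
    show "norm (partial (axis i 1) (\<lambda>x. \<psi> (y, x)) x) \<le> C * exp (- \<kappa> 3 * l1_norm (y, x))"
      if "coalescence_dist y x > 0" for y x i
      using C1[OF that, of i] scaled[OF C(3), of 1 "(y, x)"] by simp
    show "norm ((partial (axis i 1) ^^ 3) (\<lambda>x. \<psi> (y, x)) x) \<le> C * exp (- \<kappa> 3 * l1_norm (y, x)) / (coalescence_dist y x)\<^sup>2"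
      if "coalescence_dist y x > 0" for y x i
    proof -
      have "coalescence_dist y x powi (1 - int 3) = 1 / (coalescence_dist y x)\<^sup>2"
        by (simp add: power_int_minus_divide)
      then have "norm ((partial (axis i 1) ^^ 3) (\<lambda>x. \<psi> (y, x)) x)
          \<le> C3 * exp (- \<kappa> 3 * l1_norm (y, x)) / (coalescence_dist y x)\<^sup>2"
        using C3[OF that, of i] by simp
      also have "\<dots> \<le> C * exp (- \<kappa> 3 * l1_norm (y, x)) / (coalescence_dist y x)\<^sup>2"
        using C(4) by (intro divide_right_mono mult_right_mono) auto
      finally show ?thesis .
    qed
  qed (use assms(3,4,8) C(1) in auto)
  obtain A where A: "0 < A" and main: "\<And>b a. b \<in> Linf \<Longrightarrow> a \<in> L2_loc \<Longrightarrow> S_finite (3/4) (\<kappa> 3) a \<Longrightarrow>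
     \<exists>T. integral_operator (weighted_kernel b a) T \<and> compact_operator T \<and>
       (\<forall>K\<ge>1. 0 \<le> sing_val T K \<and>
         real K powr (1 / (3/4)) * sing_val T K \<le> A * (M_weight (\<kappa> 3) b * S_weight (3/4) (\<kappa> 3) a))"
    using singular_value_bound by blast
  define J where "J = sqrt (LINT y|lebesgue. exp (- 2 * \<kappa> 3 * l1_norm (y :: (real^3)^'n)))"
  have J: "0 \<le> J" by (simp add: J_def integral_nonneg_AE)
  \<comment> \<open>\<open>A * J\<close> serves the norm estimate, where \<open>J\<close> converts
    \<open>M_weight\<close> into the essential supremum; \<open>A powr (3/4)\<close> serves the
    estimate of the upper limit.\<close>
  define C' where "C' = A * J + A powr (3/4)"
  have C': "0 < C'" using A J by (simp add: C'_def add_nonneg_pos)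
  have "\<exists>T. integral_operator (\<lambda>y x. b y * \<psi> (y, x) * a x) T \<and> T \<in> weak_schatten (3/4) \<and>
      weak_schatten_norm (3/4) T \<le> ereal C' * Linf_norm b * ereal (S_weight (3/4) (\<kappa> 3) a) \<and>
      G_functional (3/4) T \<le> C' * (M_weight (\<kappa> 4) b * S_weight (3/4) (\<kappa> 4) a) powr (3/4)"
    if b: "b \<in> Linf" and a: "a \<in> L2_loc" and S4: "S_finite (3/4) (\<kappa> 4) a"
    for b :: "(real^3)^'n \<Rightarrow> complex" and a
  proof -
    have S_le: "S_term (3/4) (\<kappa> 3) a n \<le> S_term (3/4) (\<kappa> 4) a n" for n
      by (rule S_term_mono) (use antimono[of 3 4] in auto)
    have S3: "S_finite (3/4) (\<kappa> 3) a"
      using S4 unfolding S_finite_def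
      by (rule summable_on_comparison_test) (use S_le S_term_nonneg in auto)
    let ?M3 = "M_weight (\<kappa> 3) b" and ?S3 = "S_weight (3/4) (\<kappa> 3) a"
    let ?M4 = "M_weight (\<kappa> 4) b" and ?S4 = "S_weight (3/4) (\<kappa> 4) a"
    have nn: "0 \<le> ?M3" "0 \<le> ?S3" by (simp_all add: M_weight_nonneg S_weight_def)
    have M34: "?M3 \<le> ?M4" by (rule M_weight_mono[OF b]) (use assms(4) antimono[of 3 4] in auto)
    have S34: "?S3 \<le> ?S4"
      unfolding S_weight_def
    proof (rule powr_mono2)
      show "infsum (S_term (3/4) (\<kappa> 3) a) UNIV \<le> infsum (S_term (3/4) (\<kappa> 4) a) UNIV"
        using S3 S4 S_le unfolding S_finite_def by (intro infsum_mono) auto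
      show "0 \<le> infsum (S_term (3/4) (\<kappa> 3) a) UNIV" by (rule infsum_nonneg) (simp add: S_term_nonneg)
    qed simp
    obtain T where T: "integral_operator (weighted_kernel b a) T" "compact_operator T"
      and sv: "\<And>K. 1 \<le> K \<Longrightarrow> 0 \<le> sing_val T K \<and> real K powr (1 / (3/4)) * sing_val T K \<le> A * (?M3 * ?S3)"
      using main[OF b a S3] by blast
    have norm_le: "weak_schatten_norm (3/4) T \<le> ereal (A * (?M3 * ?S3))"
      unfolding weak_schatten_norm_def by (rule SUP_least) (use sv in auto)
    have ws: "T \<in> weak_schatten (3/4)"
      using T(2) norm_le by (auto simp: weak_schatten_def intro: le_less_trans)
    obtain B where B: "Linf_norm b = ereal B" "0 \<le> B" using Linf_bound[OF b] by metis
    have "?M3 \<le> B * J"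
      using M_weight_le_Linf_norm[OF b assms(4)[of 3]] B(1) by (simp add: J_def)
    then have "A * (?M3 * ?S3) \<le> A * ((B * J) * ?S3)"
      using A nn by (intro mult_left_mono mult_right_mono) auto
    also have "\<dots> = (A * J) * (B * ?S3)" by simp
    also have "\<dots> \<le> C' * (B * ?S3)" using B(2) nn by (intro mult_right_mono) (auto simp: C'_def)
    finally have first: "weak_schatten_norm (3/4) T \<le> ereal C' * Linf_norm b * ereal ?S3"
      using norm_le B(1) by (simp add: mult.assoc order_trans)
    let ?L = "limsup (\<lambda>k. ereal (real k powr (1 / (3/4)) * sing_val T k))"
    \<comment> \<open>The index 0 is skipped: there \<open>sing_val\<close> is an infimum over the
      empty set.\<close>
    have Lle: "?L \<le> ereal (A * (?M3 * ?S3))"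
      by (rule Limsup_bounded) (use sv in \<open>auto intro: eventually_sequentiallyI[of 1]\<close>)
    \<comment> \<open>Excludes \<open>-\<infinity>\<close>, which \<open>real_of_ereal\<close> would
      send to 0, and supplies a nonnegative base for the monotonicity of
      \<open>powr\<close>.\<close>
    have L0: "0 \<le> ?L"
      by (rule le_Limsup) (use sv in \<open>auto intro: eventually_sequentiallyI[of 1]\<close>)
    have "real_of_ereal ?L \<le> A * (?M3 * ?S3)"
      using Lle L0 by (cases ?L) auto
    then have "G_functional (3/4) T \<le> (A * (?M3 * ?S3)) powr (3/4)"
      unfolding G_functional_def using L0 by (intro powr_mono2) (auto simp: real_of_ereal_pos)
    also have "\<dots> = A powr (3/4) * (?M3 * ?S3) powr (3/4)" by (rule powr_mult)
    also have "\<dots> \<le> C' * (?M4 * ?S4) powr (3/4)"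
      using A J nn M34 S34 by (intro mult_mono powr_mono2) (auto simp: C'_def)
    finally have second: "G_functional (3/4) T \<le> C' * (?M4 * ?S4) powr (3/4)" .
    have "weighted_kernel b a = (\<lambda>y x. b y * \<psi> (y, x) * a x)" by (simp add: fun_eq_iff weighted_kernel_def)
    then show ?thesis using T(1) ws first second by auto
  qed
  note result = this
  show ?thesis by (intro exI[of _ C'] conjI allI impI result C')
qed

end
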